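(* For $n\ge2$ let the edges of the complete graph $K_n$ carry i.i.d. $\mathrm{Exp}(1)$ weights, let $T$ be the almost surely unique minimum spanning tree, and let $L_n$ be its total weight. Let $p_0=2/n$ be the probability that a fixed edge lies in $T$; for $n\ge3$ let $p_1$ be the probability that two fixed distinct edges sharing a vertex both lie in $T$; for $n\ge4$ let $p_2$ be the probability that two fixed disjoint edges both lie in $T$. (i) For $n\ge 3$: $\displaystyle p_1\le p_0^2\iff \mathbf{E}[L_n]\ge\frac{(n-1)(n+2)}{n^2}$. (ii) For $n\ge 4$: $\displaystyle p_2\le p_0^2\iff \mathbf{E}[L_n]\le\frac{(n-1)(5n+6)}{4n^2}$. (iii) Both estimates $\mathbf{E}[L_n]\ge\frac{(n-1)(n+2)}{n^2}$ and $\mathbf{E}[L_n]\le\frac{(n-1)(5n+6)}{4n^2}$ hold for every $n\ge2$; the first is strict for $n\ge3$ and the second is strict for $n\ge4$. (iv) With $H_n=\sum_{k=1}^n \frac1k$, for every $n\ge2$, $$\mathbf{E}[L_n]\ \ge\ 1+\frac{H_n-1}{n}-\frac1{n^2},$$ with equality for $n=2,3$ and strict inequality for $n\ge4$.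
   Context: By symmetry of $K_n$, the probabilities $p_0,p_1,p_2$ do not depend on the choice of the fixed edges or pairs, and they are the same for every common atomless weight law. $\mathrm{Exp}(1)$ is the exponential distribution of rate one. *)

theory Defs
  imports "HOL-Probability.Probability"
begin

text \<open>
  Simple undirected graphs are given by their edge sets, an edge being a two-element set of
  vertices. The spanning trees of \<^emph>\<open>Graph_Theory\<close> are not used: its \<^emph>\<open>forest\<close> excludes
  \<^emph>\<open>directed\<close> cycles of a digraph, so any orientation of the edges by a linear order is a forest,
  and a symmetric digraph with an edge never is.
\<close>

definition complete_edges :: "nat \<Rightarrow> nat set set" where
  "complete_edges n = {e. e \<subseteq> {..<n} \<and> card e = 2}"

definition edges_connect :: "'v set \<Rightarrow> 'v set set \<Rightarrow> bool" where
  "edges_connect V F \<longleftrightarrow> (\<forall>u\<in>V. \<forall>v\<in>V. (u, v) \<in> {(x, y). {x, y} \<in> F}\<^sup>*)"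

definition is_cycle :: "'v set set \<Rightarrow> 'v list \<Rightarrow> bool" where
  "is_cycle F c \<longleftrightarrow> length c \<ge> 3 \<and> distinct c \<and>
     (\<forall>i<length c. {c ! i, c ! (Suc i mod length c)} \<in> F)"

definition spanning_tree :: "nat \<Rightarrow> nat set set \<Rightarrow> bool" where
  "spanning_tree n F \<longleftrightarrow>
     F \<subseteq> complete_edges n \<and> edges_connect {..<n} F \<and> \<not> (\<exists>c. is_cycle F c)"

definition is_mst :: "nat \<Rightarrow> (nat set \<Rightarrow> real) \<Rightarrow> nat set set \<Rightarrow> bool" where
  "is_mst n w = is_arg_min (\<lambda>F. \<Sum>e\<in>F. w e) (spanning_tree n)"

text \<open>If there are several minimum spanning trees (a null event for independent atomless weights),
  an arbitrary one is chosen.\<close>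

definition mst :: "nat \<Rightarrow> (nat set \<Rightarrow> real) \<Rightarrow> nat set set" where
  "mst n w = (SOME F. is_mst n w F)"

end

theory Submission
  imports Defs
begin

text \<open>
  The graph of the edges of weight below \<open>t\<close> evolves as a Markov process in \<open>t\<close> that adds each
  missing edge at rate one. The time integral of a functional \<open>\<Phi>\<close> of this graph has expectation
  \<open>avg n \<Phi>\<close>, and integrating the generator gives
  \<open>avg (\<lambda>H. \<Sum>e\<notin>H. F (H + e) - F H) = F (K\<^sub>n) - F {}\<close> for every \<open>F\<close>. The mean tree weight is the \<open>avg\<close>
  of the number of components minus one, that is of the sum of \<open>1 / (n * size of the component of x)\<close> over all
  ordered pairs \<open>(x, y)\<close> of disconnected vertices. Since
  \<open>F H = \<Sum>C. \<psi> (card C)\<close>, summed over the components, changes by \<open>\<psi> (a + b) - \<psi> a - \<psi> b\<close> when components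
  of sizes \<open>a\<close>, \<open>b\<close> merge, the lower bound comes from \<open>\<psi> a = 1 + 1 / a - H\<^sub>a\<close>, for which
  \<open>\<psi> a + \<psi> b - \<psi> (a + b) \<le> 1 / a + 1 / b\<close>. For the upper bound, \<open>1 / a\<close> is replaced by
  \<open>1 / (m + 1)\<close> for \<open>a > m\<close>, and the frequencies of the component sizes \<open>k \<le> m\<close> (\<open>m \<le> 8\<close> suffices) are
  bounded with functionals \<open>F\<close> counting sets of representatives of components of total size \<open>k\<close>.

  The edge that joins the components of \<open>x\<close> and \<open>y\<close> at time \<open>t\<close> meets at \<open>x\<close> as many earlier tree edges as the
  degree of \<open>x\<close> in the current forest. These degrees sum to \<open>2 * (a - 1)\<close> over a component of
  size \<open>a\<close>, so the expected number of adjacent pairs of tree edges, and hence \<open>p\<^sub>1\<close>, is an affine function of the mean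
  weight. Finally \<open>p\<^sub>2\<close> is determined by \<open>p\<^sub>1\<close> because the tree has \<open>n - 1\<close> edges.
\<close>

section \<open>Components\<close>

text \<open>All bounds are proved for the finite sum \<open>mst_mean n\<close>, before any
  probability enters; only later is it identified with the expected tree weight. Averages of general
  component statistics have no simple closed form, so integrands are compared with increments, whose
  averages are exact. The potential of the lower bound is forced by requiring equality whenever a
  singleton is absorbed; hence exactness for n = 2, 3, and strictness once two components of size 2
  can coexist. For the upper bound, transversals of r components are gained only from those of r + 1
  components of the same total size k, so the inequalities form a finite chain that starts at r = k
  with sets of k isolated vertices. It bounds the frequency of size k by about n / k^2, so
  truncation at m has a slope in n that tends to zeta(3) = 1.202..., the limit of the mean weight; a
  finite m is therefore enough to get below 5/4. The stated thresholds are the values of the mean at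
  which p1 equals 4 / n^2 and 3 / n^2; the latter is where p2 equals 4 / n^2.\<close>

definition conn :: "'v set set \<Rightarrow> 'v \<Rightarrow> 'v \<Rightarrow> bool" where
  "conn H u v \<longleftrightarrow> (u, v) \<in> {(x, y). {x, y} \<in> H}\<^sup>*"

lemma conn_refl [simp]: "conn H u u"
  by (simp add: conn_def)

lemma conn_edge: "{u, v} \<in> H \<Longrightarrow> conn H u v"
  by (auto simp: conn_def)

lemma conn_trans: "conn H u v \<Longrightarrow> conn H v w \<Longrightarrow> conn H u w"
  unfolding conn_def by (rule rtrancl_trans)

lemma conn_sym: "conn H u v \<Longrightarrow> conn H v u"
proof -
  have "sym {(x, y). {x, y} \<in> H}"
    by (auto simp: sym_def insert_commute)
  then have "sym ({(x, y). {x, y} \<in> H}\<^sup>*)"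
    by (rule sym_rtrancl)
  then show "conn H u v \<Longrightarrow> conn H v u"
    by (auto simp: conn_def sym_def)
qed

lemma conn_commute: "conn H u v \<longleftrightarrow> conn H v u"
  by (auto intro: conn_sym)

lemma conn_cong: "conn H u v \<Longrightarrow> conn H u w \<longleftrightarrow> conn H v w"
  by (meson conn_sym conn_trans)

lemma conn_mono:
  assumes "H \<subseteq> H'" "conn H u v"
  shows "conn H' u v"
proof -
  have "{(x, y). {x, y} \<in> H} \<subseteq> {(x, y). {x, y} \<in> H'}"
    using assms(1) by auto
  then show ?thesis
    using rtrancl_mono assms(2) unfolding conn_def by blast
qed

lemma conn_empty [simp]: "conn {} u v \<longleftrightarrow> u = v"
  by (simp add: conn_def)

lemma conn_induct [consumes 1, case_names refl step]:
  assumes "conn H u v" "P u" "\<And>y z. conn H u y \<Longrightarrow> {y, z} \<in> H \<Longrightarrow> P y \<Longrightarrow> P z"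
  shows "P v"
proof -
  have "(u, v) \<in> {(x, y). {x, y} \<in> H}\<^sup>*"
    using assms(1) by (simp add: conn_def)
  then show ?thesis
    by (induction rule: rtrancl_induct) (use assms in \<open>auto simp: conn_def\<close>)
qed

lemma conn_closed_set:
  assumes "conn H u v" "u \<in> S" "\<And>x y. {x, y} \<in> H \<Longrightarrow> x \<in> S \<Longrightarrow> y \<in> S"
  shows "v \<in> S"
  using assms(1) by (induction rule: conn_induct) (use assms in auto)

lemma conn_insert:
  "conn (insert {x, y} H) u v \<longleftrightarrow>
     conn H u v \<or> (conn H u x \<and> conn H y v) \<or> (conn H u y \<and> conn H x v)"
  (is "?L \<longleftrightarrow> ?R v")
proof
  assume ?L
  then show "?R v"
  proof (induction rule: conn_induct)
    case refl
    then show ?case by simp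
  next
    case (step b c)
    show ?case
    proof (cases "{b, c} \<in> H")
      case True
      then show ?thesis
        using step.IH conn_trans[OF _ conn_edge[OF True]] by auto
    next
      case False
      then have "{b, c} = {x, y}"
        using step.hyps by simp
      then consider "b = x" "c = y" | "b = y" "c = x"
        by (auto simp: doubleton_eq_iff)
      then show ?thesis
        using step.IH by cases auto
    qed
  qed
next
  have m: "conn H a b \<Longrightarrow> conn (insert {x, y} H) a b" for a b
    by (rule conn_mono[of H]) auto
  have e: "conn (insert {x, y} H) x y" "conn (insert {x, y} H) y x"
    by (auto intro!: conn_edge simp: insert_commute)
  assume "?R v"
  then show ?L
    by (elim disjE conjE) (auto intro: m conn_trans[OF conn_trans[OF m e(1)] m]
        conn_trans[OF conn_trans[OF m e(2)] m])
qed

lemma conn_insert_connected: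
  "conn H x y \<Longrightarrow> conn (insert {x, y} H) = conn H"
  unfolding fun_eq_iff conn_insert by (meson conn_trans conn_sym)

definition component :: "nat \<Rightarrow> nat set set \<Rightarrow> nat \<Rightarrow> nat set" where
  "component n H u = {v \<in> {..<n}. conn H u v}"

abbreviation csize :: "nat \<Rightarrow> nat set set \<Rightarrow> nat \<Rightarrow> nat" where
  "csize n H u \<equiv> card (component n H u)"

lemma finite_comp [simp]: "finite (component n H u)"
  by (simp add: component_def)

lemma comp_subset: "component n H u \<subseteq> {..<n}"
  by (auto simp: component_def)

lemma self_in_comp: "u < n \<Longrightarrow> u \<in> component n H u"
  by (simp add: component_def)

lemma csize_pos: "u < n \<Longrightarrow> csize n H u > 0"
  using self_in_comp by (metis card_gt_0_iff empty_iff finite_comp)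

lemma csize_le: "csize n H u \<le> n"
  using card_mono[OF _ comp_subset[of n H u]] by simp

lemma comp_eq: "conn H u v \<Longrightarrow> component n H u = component n H v"
  using conn_cong[of H u v] by (simp add: component_def)

lemma comp_disjoint: "\<not> conn H u v \<Longrightarrow> component n H u \<inter> component n H v = {}"
  by (auto simp: component_def dest: conn_trans[OF _ conn_sym])

lemma comp_insert:
  assumes "\<not> conn H x y"
  shows "component n (insert {x, y} H) u =
    (if conn H u x \<or> conn H u y then component n H x \<union> component n H y else component n H u)"
proof (cases "conn H u x")
  case True
  then have "conn H u v \<longleftrightarrow> conn H x v" for v
    by (rule conn_cong)
  then show ?thesis
    using assms by (auto simp: component_def conn_insert)
next
  case False
  show ?thesis
  proof (cases "conn H u y")
    case True
    then have "conn H u v \<longleftrightarrow> conn H y v" for v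
      by (rule conn_cong)
    then show ?thesis
      using False True by (auto simp: component_def conn_insert)
  qed (use False in \<open>auto simp: component_def conn_insert\<close>)
qed

lemma csize_insert:
  assumes "\<not> conn H x y"
  shows "csize n (insert {x, y} H) u =
    (if conn H u x \<or> conn H u y then csize n H x + csize n H y else csize n H u)"
  by (simp add: comp_insert[OF assms] card_Un_disjoint comp_disjoint[OF assms])

lemma csize_empty: "u < n \<Longrightarrow> csize n {} u = 1"
proof -
  assume "u < n"
  then have "component n {} u = {u}"
    by (auto simp: component_def)
  then show ?thesis by simp
qed

lemma csize_add_le:
  assumes "\<not> conn H u v"
  shows "csize n H u + csize n H v \<le> n"
proof -
  have "card (component n H u \<union> component n H v) \<le> card {..<n}"
    by (rule card_mono) (use comp_subset in auto)
  then show ?thesis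
    by (simp add: card_Un_disjoint comp_disjoint[OF assms])
qed

text \<open>After exchanging the sums, v receives \<open>f v / csize n H v\<close> once from each
  vertex of its component. This lets data known only per component replace values at single
  vertices.\<close>

lemma comp_sum:
  fixes f :: "nat \<Rightarrow> real"
  shows "(\<Sum>u<n. (\<Sum>v\<in>component n H u. f v) / csize n H u) = (\<Sum>u<n. f u)"
proof -
  have "(\<Sum>u<n. (\<Sum>v\<in>component n H u. f v) / csize n H u)
      = (\<Sum>u<n. \<Sum>v | v \<in> {..<n} \<and> conn H u v. f v / csize n H u)"
    by (simp add: sum_divide_distrib component_def)
  also have "\<dots> = (\<Sum>v<n. \<Sum>u | u \<in> {..<n} \<and> conn H u v. f v / csize n H u)"
    by (rule sum.swap_restrict) auto
  also have "\<dots> = (\<Sum>v<n. \<Sum>u\<in>component n H v. f v / csize n H v)"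
    using comp_eq by (intro sum.cong) (auto simp: component_def conn_commute)
  also have "\<dots> = (\<Sum>v<n. f v)"
    using csize_pos by (intro sum.cong) (auto simp: less_le_not_le)
  finally show ?thesis .
qed

definition nonconn :: "nat \<Rightarrow> nat set set \<Rightarrow> (nat \<times> nat) set" where
  "nonconn n H = {(x, y). x < n \<and> y < n \<and> \<not> conn H x y}"

lemma finite_nonconn [simp]: "finite (nonconn n H)"
  by (rule finite_subset[of _ "{..<n} \<times> {..<n}"]) (auto simp: nonconn_def)

lemma sum_nonconn:
  fixes f :: "nat \<Rightarrow> real"
  shows "(\<Sum>(x, y)\<in>nonconn n H. f x) = (\<Sum>x<n. f x * (real n - csize n H x))"
proof -
  have "nonconn n H = (SIGMA x:{..<n}. {..<n} - component n H x)"
    by (auto simp: nonconn_def component_def)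
  then have "(\<Sum>(x, y)\<in>nonconn n H. f x) = (\<Sum>x<n. \<Sum>y\<in>{..<n} - component n H x. f x)"
    by (simp only:) (subst sum.Sigma; simp)
  also have "\<dots> = (\<Sum>x<n. f x * (real n - csize n H x))"
    by (intro sum.cong) (simp_all add: card_Diff_subset comp_subset of_nat_diff csize_le)
  finally show ?thesis .
qed

lemma sum_nonconn_swap: "(\<Sum>(x, y)\<in>nonconn n H. f y) = (\<Sum>(x, y)\<in>nonconn n H. f x :: real)"
  by (rule sum.reindex_bij_witness[of _ prod.swap prod.swap])
     (auto simp: nonconn_def conn_commute)

text \<open>Dividing by the size makes each component C contribute \<psi> (card C) exactly once, so
  a sum over components is obtained without forming the partition. The choice \<psi> = 1 counts the
  components.\<close>

definition comp_total :: "nat \<Rightarrow> (nat \<Rightarrow> real) \<Rightarrow> nat set set \<Rightarrow> real" where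
  "comp_total n \<psi> H = (\<Sum>v<n. \<psi> (csize n H v) / csize n H v)"

lemma comp_total_insert:
  assumes "x < n" "y < n" "\<not> conn H x y"
  shows "comp_total n \<psi> (insert {x, y} H) =
    comp_total n \<psi> H + \<psi> (csize n H x + csize n H y) - \<psi> (csize n H x) - \<psi> (csize n H y)"
proof -
  define C where "C = component n H x"
  define D where "D = component n H y"
  define R where "R = {..<n} - (C \<union> D)"
  have fin: "finite C" "finite D" "finite R" and dis: "C \<inter> D = {}" "(C \<union> D) \<inter> R = {}"
    by (auto simp: C_def D_def R_def comp_disjoint[OF assms(3)])
  have V: "{..<n} = (C \<union> D) \<union> R"
    using comp_subset by (auto simp: C_def D_def R_def)
  have split: "(\<Sum>v<n. f v) = (\<Sum>v\<in>C. f v) + (\<Sum>v\<in>D. f v) + (\<Sum>v\<in>R. f v)" for f :: "nat \<Rightarrow> real"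
    using fin dis unfolding V by (subst sum.union_disjoint; simp add: sum.union_disjoint)
  have pos: "card C > 0" "card D > 0"
    using assms csize_pos by (auto simp: C_def D_def)
  let ?g = "\<lambda>v. \<psi> (csize n H v) / csize n H v"
  let ?g' = "\<lambda>v. \<psi> (csize n (insert {x, y} H) v) / csize n (insert {x, y} H) v"
  have "(\<Sum>v\<in>C. ?g v) = (\<Sum>v\<in>C. \<psi> (card C) / card C)"
    by (intro sum.cong) (auto simp: C_def component_def dest: comp_eq[of _ _ _ n, unfolded component_def])
  moreover have "(\<Sum>v\<in>D. ?g v) = (\<Sum>v\<in>D. \<psi> (card D) / card D)"
    by (intro sum.cong) (auto simp: D_def component_def dest: comp_eq[of _ _ _ n, unfolded component_def])
  moreover have "(\<Sum>v\<in>C. ?g' v) = (\<Sum>v\<in>C. \<psi> (card C + card D) / (card C + card D))"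
    using csize_insert[OF assms(3)]
    by (intro sum.cong) (auto simp: C_def D_def component_def conn_commute)
  moreover have "(\<Sum>v\<in>D. ?g' v) = (\<Sum>v\<in>D. \<psi> (card C + card D) / (card C + card D))"
    using csize_insert[OF assms(3)]
    by (intro sum.cong) (auto simp: C_def D_def component_def conn_commute)
  moreover have "(\<Sum>v\<in>R. ?g' v) = (\<Sum>v\<in>R. ?g v)"
    using csize_insert[OF assms(3)]
    by (intro sum.cong) (auto simp: R_def C_def D_def component_def conn_commute)
  moreover have "card C * (\<psi> (card C + card D) / (card C + card D)) +
      card D * (\<psi> (card C + card D) / (card C + card D)) = \<psi> (card C + card D)"
    unfolding distrib_right[symmetric] using pos by simp
  ultimately show ?thesis
    unfolding comp_total_def split using pos
    by (simp add: C_def[symmetric] D_def[symmetric])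
qed

lemma comp_total_insert_connected:
  "conn H x y \<Longrightarrow> comp_total n \<psi> (insert {x, y} H) = comp_total n \<psi> H"
  by (simp add: comp_total_def component_def conn_insert_connected)

lemma comp_total_empty: "comp_total n \<psi> {} = n * \<psi> 1"
  by (simp add: comp_total_def csize_empty)

section \<open>Edges of the complete graph and ordered vertex pairs\<close>

lemma in_complete_edges [simp]: "{x, y} \<in> complete_edges n \<longleftrightarrow> x < n \<and> y < n \<and> x \<noteq> y"
  by (auto simp: complete_edges_def card_2_iff doubleton_eq_iff card_insert_if)

lemma complete_edgesE:
  assumes "e \<in> complete_edges n"
  obtains x y where "e = {x, y}" "x < y" "y < n"
proof -
  obtain x y where "e = {x, y}" "x \<noteq> y"
    using assms by (auto simp: complete_edges_def card_2_iff)
  then show ?thesis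
    using that[of x y] that[of y x] assms
    by (cases "x < y") (auto simp: insert_commute complete_edges_def)
qed

lemma finite_complete_edges [simp]: "finite (complete_edges n)"
  by (rule finite_subset[of _ "Pow {..<n}"]) (auto simp: complete_edges_def)

lemma conn_complete: "x < n \<Longrightarrow> y < n \<Longrightarrow> conn (complete_edges n) x y"
  by (cases "x = y") (auto intro: conn_edge)

lemma comp_complete: "u < n \<Longrightarrow> component n (complete_edges n) u = {..<n}"
  by (auto simp: component_def conn_complete)

lemma comp_total_complete: "n > 0 \<Longrightarrow> comp_total n \<psi> (complete_edges n) = \<psi> n"
  by (simp add: comp_total_def comp_complete)

lemma sum_complete_edges:
  fixes f :: "nat set \<Rightarrow> real"
  shows "(\<Sum>x<n. \<Sum>y\<in>{..<n} - {x}. f {x, y}) = 2 * (\<Sum>e\<in>complete_edges n. f e)"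
proof -
  define P where "P = {(x, y). x < y \<and> y < n}"
  have finP: "finite P"
    by (rule finite_subset[of _ "{..<n} \<times> {..<n}"]) (auto simp: P_def)
  have "bij_betw (\<lambda>(x, y). {x, y}) P (complete_edges n)"
    by (auto simp: bij_betw_def inj_on_def P_def doubleton_eq_iff elim!: complete_edgesE)
  then have e: "(\<Sum>e\<in>complete_edges n. f e) = (\<Sum>(x, y)\<in>P. f {x, y})"
    using sum.reindex_bij_betw[of "\<lambda>(x, y). {x, y}" P "complete_edges n" f]
    by (simp add: case_prod_beta)
  have swap: "(\<Sum>(x, y)\<in>prod.swap ` P. f {x, y}) = (\<Sum>(x, y)\<in>P. f {x, y})"
    by (subst sum.reindex) (auto simp: insert_commute intro!: sum.cong)
  have "(\<Sum>x<n. \<Sum>y\<in>{..<n} - {x}. f {x, y}) = (\<Sum>(x, y)\<in>(SIGMA x:{..<n}. {..<n} - {x}). f {x, y})"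
    by (simp add: sum.Sigma)
  also have "(SIGMA x:{..<n}. {..<n} - {x}) = P \<union> prod.swap ` P"
    by (auto simp: P_def image_iff)
  also have "(\<Sum>(x, y)\<in>P \<union> prod.swap ` P. f {x, y})
      = (\<Sum>(x, y)\<in>P. f {x, y}) + (\<Sum>(x, y)\<in>prod.swap ` P. f {x, y})"
    by (rule sum.union_disjoint) (auto simp: finP, auto simp: P_def)
  finally show ?thesis
    by (simp add: swap e)
qed

lemma card_complete_edges: "2 * real (card (complete_edges n)) = real n * (real n - 1)"
  using sum_complete_edges[where f = "\<lambda>_. 1" and n = n] by (cases n) (auto simp: algebra_simps)

text \<open>Missing edges inside a component contribute nothing, and an edge between two components
  is always missing. The factor 2 appears because \<open>nonconn\<close> consists of ordered
  pairs.\<close>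

lemma sum_new_edges:
  fixes \<Delta> :: "nat set \<Rightarrow> real"
  assumes "H \<subseteq> complete_edges n"
    and "\<And>x y. x < n \<Longrightarrow> y < n \<Longrightarrow> x \<noteq> y \<Longrightarrow> {x, y} \<notin> H \<Longrightarrow> conn H x y \<Longrightarrow> \<Delta> {x, y} = 0"
  shows "2 * (\<Sum>e\<in>complete_edges n - H. \<Delta> e) = (\<Sum>(x, y)\<in>nonconn n H. \<Delta> {x, y})"
proof -
  have "2 * (\<Sum>e\<in>complete_edges n - H. \<Delta> e) = 2 * (\<Sum>e\<in>complete_edges n. if e \<in> H then 0 else \<Delta> e)"
    by (simp add: sum.If_cases Diff_eq)
  also have "\<dots> = (\<Sum>x<n. \<Sum>y\<in>{..<n} - {x}. if {x, y} \<in> H then 0 else \<Delta> {x, y})"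
    by (rule sum_complete_edges[symmetric])
  also have "\<dots> = (\<Sum>(x, y)\<in>(SIGMA x:{..<n}. {..<n} - {x}). if {x, y} \<in> H then 0 else \<Delta> {x, y})"
    by (simp add: sum.Sigma)
  also have "\<dots> = (\<Sum>(x, y)\<in>nonconn n H. \<Delta> {x, y})"
    proof (rule sum.mono_neutral_cong_right)
    show "nonconn n H \<subseteq> (SIGMA x:{..<n}. {..<n} - {x})"
      by (auto simp: nonconn_def)
    show "\<forall>p\<in>(SIGMA x:{..<n}. {..<n} - {x}) - nonconn n H.
        (case p of (x, y) \<Rightarrow> if {x, y} \<in> H then 0 else \<Delta> {x, y}) = 0"
      using assms(2) by (auto simp: nonconn_def split: if_splits)
    show "(case p of (x, y) \<Rightarrow> if {x, y} \<in> H then 0 else \<Delta> {x, y}) = (case p of (x, y) \<Rightarrow> \<Delta> {x, y})"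
      if "p \<in> nonconn n H" for p
      using that conn_edge[of "fst p" "snd p" H] by (auto simp: nonconn_def)
  qed simp
  finally show ?thesis .
qed

section \<open>Time averages\<close>

text \<open>The weight of \<open>H\<close> is the expected time during which the edges of weight below \<open>t\<close> are exactly those
  of \<open>H\<close>. This time is infinite for the complete graph, which division by zero excludes from the sum.\<close>

definition avg :: "nat \<Rightarrow> (nat set set \<Rightarrow> real) \<Rightarrow> real" where
  "avg n \<Phi> = (\<Sum>H\<in>Pow (complete_edges n). \<Phi> H /
     (real (card (complete_edges n) - card H) * real (card (complete_edges n) choose card H)))"

lemma avg_add: "avg n (\<lambda>H. \<Phi> H + \<Psi> H) = avg n \<Phi> + avg n \<Psi>"
  by (simp add: avg_def add_divide_distrib sum.distrib)

lemma avg_diff: "avg n (\<lambda>H. \<Phi> H - \<Psi> H) = avg n \<Phi> - avg n \<Psi>"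
  by (simp add: avg_def diff_divide_distrib sum_subtractf)

lemma avg_cmult: "avg n (\<lambda>H. c * \<Phi> H) = c * avg n \<Phi>"
  by (simp add: avg_def sum_distrib_left)

lemma avg_sum: "avg n (\<lambda>H. \<Sum>i\<in>I. \<Phi> i H) = (\<Sum>i\<in>I. avg n (\<Phi> i))"
  unfolding avg_def by (subst sum.swap) (simp add: sum_divide_distrib)

lemma avg_mono:
  assumes "\<And>H. H \<subseteq> complete_edges n \<Longrightarrow> \<Phi> H \<le> \<Psi> H"
  shows "avg n \<Phi> \<le> avg n \<Psi>"
  unfolding avg_def by (intro sum_mono divide_right_mono) (use assms in auto)

lemma avg_cong:
  assumes "\<And>H. H \<subseteq> complete_edges n \<Longrightarrow> \<Phi> H = \<Psi> H"
  shows "avg n \<Phi> = avg n \<Psi>"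
  unfolding avg_def by (intro sum.cong) (use assms in auto)

lemma avg_strict_mono:
  assumes "\<And>H. H \<subseteq> complete_edges n \<Longrightarrow> \<Phi> H \<le> \<Psi> H"
    and "H \<subset> complete_edges n" "\<Phi> H < \<Psi> H"
  shows "avg n \<Phi> < avg n \<Psi>"
proof -
  have *: "card H < card (complete_edges n)"
    using assms(2) psubset_card_mono[of "complete_edges n" H] by auto
  show ?thesis
    unfolding avg_def
  proof (rule sum_strict_mono_ex1)
    show "\<exists>a\<in>Pow (complete_edges n). \<Phi> a / (real (card (complete_edges n) - card a) * real (card (complete_edges n) choose card a))
      < \<Psi> a / (real (card (complete_edges n) - card a) * real (card (complete_edges n) choose card a))"
      using assms(2,3) * by (intro bexI[of _ H] divide_strict_right_mono) auto
  qed (use assms in \<open>auto intro!: divide_right_mono\<close>)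
qed

text \<open>For h < N edges, the weight of H times its N - h possible jumps is 1 / (N choose h), the
  probability that the process visits H. So F H enters with equal coefficients through arrivals at H
  and departures from H, except that {} has no arrival and the complete graph no departure.\<close>

lemma avg_increments:
  fixes F :: "nat set set \<Rightarrow> real"
  shows "avg n (\<lambda>H. \<Sum>e\<in>complete_edges n - H. F (insert e H) - F H) = F (complete_edges n) - F {}"
proof -
  define E where "E = complete_edges n"
  define N where "N = card E"
  define \<tau> where "\<tau> h = 1 / (real (N - h) * real (N choose h))" for h
  have fin: "finite E" and finP: "finite (Pow E)"
    by (auto simp: E_def)
  have fin': "finite H" and le: "card H \<le> N" if "H \<in> Pow E" for H
    using that fin by (auto simp: N_def intro: card_mono finite_subset)
  have eq_N: "card H = N \<longleftrightarrow> H = E" if "H \<in> Pow E" for H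
    using that fin card_subset_eq[of E H] by (auto simp: N_def)
  have up: "real (N - h) * \<tau> h = 1 / (N choose h) - (if h = N then 1 else 0)" if "h \<le> N" for h
    using that by (auto simp: \<tau>_def)
  \<comment> \<open>At h = 0 the truncated \<open>h - 1\<close> is harmless: the factor h vanishes
    and the correction term cancels the 1.\<close>
  have down: "real h * \<tau> (h - 1) = 1 / (N choose h) - (if h = 0 then 1 else 0)" if "h \<le> N" for h
  proof (cases h)
    case (Suc k)
    have "real (N - k) * real (N choose k) = real (Suc k) * real (N choose Suc k)"
      using binomial_absorb_comp[of N k] binomial_absorption[of k N]
      by (metis of_nat_mult)
    then show ?thesis
      using Suc that by (simp add: \<tau>_def)
  qed auto
  have "(\<Sum>H\<in>Pow E. \<Sum>e\<in>E - H. \<tau> (card H) * F (insert e H))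
      = (\<Sum>(H, e)\<in>(SIGMA H:Pow E. E - H). \<tau> (card H) * F (insert e H))"
    using finP fin by (simp add: sum.Sigma)
  also have "\<dots> = (\<Sum>(H, e)\<in>(SIGMA H:Pow E. H). \<tau> (card H - 1) * F H)"
    by (rule sum.reindex_bij_witness[of _ "\<lambda>(H, e). (H - {e}, e)" "\<lambda>(H, e). (insert e H, e)"])
       (auto simp: insert_absorb fin' card_insert_if)
  also have "\<dots> = (\<Sum>H\<in>Pow E. \<Sum>e\<in>H. \<tau> (card H - 1) * F H)"
    by (rule sum.Sigma[symmetric]) (use finP fin' in auto)
  also have "\<dots> = (\<Sum>H\<in>Pow E. (1 / (N choose card H) - (if card H = 0 then 1 else 0)) * F H)"
    by (intro sum.cong) (auto simp: le down[symmetric])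
  finally have 1: "(\<Sum>H\<in>Pow E. \<Sum>e\<in>E - H. \<tau> (card H) * F (insert e H))
     = (\<Sum>H\<in>Pow E. (1 / (N choose card H) - (if card H = 0 then 1 else 0)) * F H)" .
  have 2: "(\<Sum>H\<in>Pow E. \<Sum>e\<in>E - H. \<tau> (card H) * F H)
     = (\<Sum>H\<in>Pow E. (1 / (N choose card H) - (if card H = N then 1 else 0)) * F H)"
    by (intro sum.cong) (auto simp: le up[symmetric] fin' card_Diff_subset N_def[symmetric])
  have "avg n (\<lambda>H. \<Sum>e\<in>complete_edges n - H. F (insert e H) - F H)
     = (\<Sum>H\<in>Pow E. \<Sum>e\<in>E - H. \<tau> (card H) * F (insert e H)) - (\<Sum>H\<in>Pow E. \<Sum>e\<in>E - H. \<tau> (card H) * F H)"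
    by (simp add: avg_def E_def[symmetric] N_def[symmetric] \<tau>_def sum_subtractf diff_divide_distrib
        sum_divide_distrib)
  also have "\<dots> = (\<Sum>H\<in>Pow E. ((if card H = N then 1 else 0) - (if card H = 0 then 1 else 0)) * F H)"
    unfolding 1 2 by (simp add: sum_subtractf[symmetric] algebra_simps)
  also have "\<dots> = (\<Sum>H\<in>Pow E. (if H = E then F H else 0)) - (\<Sum>H\<in>Pow E. (if H = {} then F H else 0))"
    unfolding sum_subtractf[symmetric] by (intro sum.cong) (auto simp: eq_N fin')
  also have "\<dots> = F E - F {}"
    using finP by (simp add: sum.delta)
  finally show ?thesis
    by (simp add: E_def)
qed

lemma avg_nonconn_increments:
  assumes "\<And>H x y. H \<subseteq> complete_edges n \<Longrightarrow> conn H x y \<Longrightarrow> F (insert {x, y} H) = F H"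
  shows "avg n (\<lambda>H. \<Sum>(x, y)\<in>nonconn n H. F (insert {x, y} H) - F H)
     = 2 * (F (complete_edges n) - F {})"
proof -
  have "(\<Sum>(x, y)\<in>nonconn n H. F (insert {x, y} H) - F H)
      = 2 * (\<Sum>e\<in>complete_edges n - H. F (insert e H) - F H)" if "H \<subseteq> complete_edges n" for H
    by (rule sum_new_edges[symmetric]) (use that assms in auto)
  then show ?thesis
    by (simp add: avg_cmult avg_increments cong: avg_cong)
qed

text \<open>The source of the exact averages: any \<psi> whose merger cost dominates, or is
  dominated by, an integrand bounds the average of that integrand.\<close>

lemma avg_comp_total:
  assumes "n > 0"
  shows "avg n (\<lambda>H. \<Sum>(x, y)\<in>nonconn n H. \<psi> (csize n H x) + \<psi> (csize n H y) - \<psi> (csize n H x + csize n H y))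
     = 2 * (n * \<psi> 1 - \<psi> n)"
proof -
  have "avg n (\<lambda>H. \<Sum>(x, y)\<in>nonconn n H. comp_total n \<psi> (insert {x, y} H) - comp_total n \<psi> H)
     = 2 * (\<psi> n - n * \<psi> 1)"
    using assms by (subst avg_nonconn_increments)
      (auto simp: comp_total_insert_connected comp_total_complete comp_total_empty)
  moreover have "avg n (\<lambda>H. \<Sum>(x, y)\<in>nonconn n H. comp_total n \<psi> (insert {x, y} H) - comp_total n \<psi> H)
     = avg n (\<lambda>H. (-1) * (\<Sum>(x, y)\<in>nonconn n H. \<psi> (csize n H x) + \<psi> (csize n H y) - \<psi> (csize n H x + csize n H y)))"
    by (intro avg_cong, unfold sum_distrib_left, intro sum.cong)
       (auto simp: nonconn_def comp_total_insert)
  ultimately show ?thesis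
    unfolding avg_cmult by simp
qed

text \<open>With \<psi> = 1 every merger costs one component, and their number falls from n to
  1.\<close>

lemma avg_card_nonconn:
  assumes "n > 0"
  shows "avg n (\<lambda>H. real (card (nonconn n H))) = 2 * (real n - 1)"
  using avg_comp_total[OF assms, of "\<lambda>_. 1"] by (simp add: case_prod_beta)

section \<open>Bounds for the mean weight\<close>

text \<open>The number of tree edges of weight at least t is the number of components at time t
  minus one; integrating over t gives the tree weight. \<open>integral_mst_weight\<close> makes the
  identification.\<close>

definition mst_mean :: "nat \<Rightarrow> real" where
  "mst_mean n = avg n (\<lambda>H. comp_total n (\<lambda>_. 1) H - 1)"

lemma comp_total_one:
  assumes "n > 0"
  shows "n * (comp_total n (\<lambda>_. 1) H - 1) = (\<Sum>(x, y)\<in>nonconn n H. 1 / csize n H x)"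
proof -
  have "(\<Sum>(x, y)\<in>nonconn n H. 1 / csize n H x) = (\<Sum>x<n. n * (1 / csize n H x) - 1)"
    unfolding sum_nonconn by (intro sum.cong) (auto simp: diff_divide_distrib algebra_simps dest: csize_pos[of _ n H])
  then show ?thesis
    by (simp add: sum_subtractf comp_total_def sum_distrib_left algebra_simps)
qed

lemma mst_mean_eq:
  assumes "n > 0"
  shows "n * mst_mean n = avg n (\<lambda>H. \<Sum>(x, y)\<in>nonconn n H. 1 / csize n H x)"
  unfolding mst_mean_def avg_cmult[symmetric] using comp_total_one[OF assms] by simp

text \<open>Symmetrized to match merger costs, which depend symmetrically on the two sizes.\<close>

lemma mst_mean_eq_symmetric:
  assumes "n > 0"
  shows "2 * real n * mst_mean n = avg n (\<lambda>H. \<Sum>(x, y)\<in>nonconn n H. 1 / csize n H x + 1 / csize n H y)"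
proof -
  have "(\<Sum>(x, y)\<in>nonconn n H. 1 / csize n H x + 1 / csize n H y)
     = 2 * (\<Sum>(x, y)\<in>nonconn n H. 1 / csize n H x)" for H
    using sum_nonconn_swap[of "\<lambda>y. 1 / csize n H y" n H]
    by (simp add: case_prod_beta sum.distrib)
  then show ?thesis
    by (simp add: avg_cmult mst_mean_eq[OF assms, symmetric])
qed

section \<open>Lower bounds by a harmonic potential\<close>

lemma harm_add_le:
  assumes "a > 0"
  shows "harm (a + b) + 1 \<le> (harm a + harm (Suc b) :: real)"
proof (induction b)
  case (Suc b)
  \<comment> \<open>Raising b by one adds the left term to the smaller side and the right term to
    the larger side; at b = 0 both sides agree.\<close>
  have "1 / (real a + real b + 1) \<le> 1 / (real b + 2)"
    using assms by (intro divide_left_mono) auto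
  then show ?case
    using Suc by (simp add: harm_Suc[of "Suc b"] harm_Suc[of "a + b"] inverse_eq_divide algebra_simps)
qed (simp add: harm_def)

lemma harm_add_less:
  assumes "a \<ge> 2" "b > 0"
  shows "harm (a + b) + 1 < (harm a + harm (Suc b) :: real)"
  using assms(2)
proof (induction b)
  case (Suc b)
  have "1 / (real a + real b + 1) < 1 / (real b + 2)"
    using assms by (intro divide_strict_left_mono) auto
  then show ?case
    using harm_add_le[of a b] assms
    by (simp add: harm_Suc[of "Suc b"] harm_Suc[of "a + b"] inverse_eq_divide algebra_simps)
qed simp

text \<open>For a > 0 this is 1 minus the harmonic number of a - 1: the solution of \<psi> 1 = 1 and
  \<psi> (a + 1) = \<psi> a - 1 / a, which says that absorbing a singleton costs exactly 1 / a +
  1.\<close>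

definition merge_pot :: "nat \<Rightarrow> real" where
  "merge_pot a = 1 + 1 / a - harm a"

lemma merge_pot_eq:
  "merge_pot a + merge_pot (Suc b) - merge_pot (a + Suc b)
    = 1 / a + 1 / Suc b + (harm (a + b) + 1 - (harm a + harm (Suc b)))"
  by (simp add: merge_pot_def harm_Suc[of "a + b"] inverse_eq_divide)

lemma merge_pot_le:
  assumes "a > 0" "b > 0"
  shows "merge_pot a + merge_pot b - merge_pot (a + b) \<le> 1 / a + 1 / b"
  using merge_pot_eq[of a "b - 1"] harm_add_le[of a "b - 1"] assms by simp

lemma merge_pot_less:
  assumes "a \<ge> 2" "b \<ge> 2"
  shows "merge_pot a + merge_pot b - merge_pot (a + b) < 1 / a + 1 / b"
  using merge_pot_eq[of a "b - 1"] harm_add_less[of a "b - 1"] assms by simp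

lemma merge_pot_one_right: "merge_pot a + merge_pot 1 - merge_pot (a + 1) = 1 / a + 1"
  using merge_pot_eq[of a 0] by (simp add: harm_def)

lemma merge_pot_one:
  assumes "a = 1 \<or> b = 1"
  shows "merge_pot a + merge_pot b - merge_pot (a + b) = 1 / a + 1 / b"
  using assms merge_pot_one_right[of a] merge_pot_one_right[of b] by (auto simp: add.commute)

lemma avg_merge_pot:
  assumes "n > 0"
  shows "avg n (\<lambda>H. \<Sum>(x, y)\<in>nonconn n H. merge_pot (csize n H x) + merge_pot (csize n H y)
      - merge_pot (csize n H x + csize n H y)) = 2 * real n * (1 + (harm n - 1) / real n - 1 / (real n)\<^sup>2)"
  unfolding avg_comp_total[OF assms] using assms
  by (simp add: merge_pot_def harm_def[of "Suc 0"] power2_eq_square field_simps)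

lemma mst_mean_ge:
  assumes "n > 0"
  shows "mst_mean n \<ge> 1 + (harm n - 1) / real n - 1 / (real n)\<^sup>2"
proof -
  have "2 * real n * (1 + (harm n - 1) / real n - 1 / (real n)\<^sup>2) \<le> 2 * real n * mst_mean n"
    unfolding mst_mean_eq_symmetric[OF assms] avg_merge_pot[OF assms, symmetric]
    by (intro avg_mono sum_mono) (auto simp: nonconn_def csize_pos intro!: merge_pot_le)
  then show ?thesis
    using assms by simp
qed

lemma mst_mean_eq_harm:
  assumes "n > 0" "n \<le> 3"
  shows "mst_mean n = 1 + (harm n - 1) / real n - 1 / (real n)\<^sup>2"
proof -
  \<comment> \<open>Among at most three vertices two distinct components cannot both have size at
    least 2, so every merger absorbs a singleton and is exact.\<close>
  have *: "csize n H x = 1 \<or> csize n H y = 1" if "(x, y) \<in> nonconn n H" for x y H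
    using that assms(2) csize_add_le[of H x y n] csize_pos[of x n H] csize_pos[of y n H]
    by (auto simp: nonconn_def)
  have "2 * real n * (1 + (harm n - 1) / real n - 1 / (real n)\<^sup>2) = 2 * real n * mst_mean n"
    unfolding mst_mean_eq_symmetric[OF assms(1)] avg_merge_pot[OF assms(1), symmetric]
    by (intro avg_cong sum.cong refl) (use * merge_pot_one in \<open>auto simp del: One_nat_def\<close>)
  then show ?thesis
    using assms by simp
qed

lemma mst_mean_greater:
  assumes "n \<ge> 4"
  shows "mst_mean n > 1 + (harm n - 1) / real n - 1 / (real n)\<^sup>2"
proof -
  \<comment> \<open>Two coexisting components of size 2 give a strict merger inequality; H is not
    complete, so it has positive weight in \<open>avg\<close>.\<close>
  define H :: "nat set set" where "H = {{0, 1}, {2, 3}}"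
  have sub: "H \<subset> complete_edges n"
  proof -
    have "{0, 2} \<in> complete_edges n" "{0, 2} \<notin> H"
      using assms by (auto simp: H_def doubleton_eq_iff)
    moreover have "H \<subseteq> complete_edges n"
      using assms by (auto simp: H_def)
    ultimately show ?thesis by auto
  qed
  have nc: "\<not> conn H 0 2"
  proof
    assume "conn H 0 2"
    then have "2 \<in> {0, 1 :: nat}"
      by (rule conn_closed_set) (auto simp: H_def doubleton_eq_iff)
    then show False by simp
  qed
  have "{0, 1} \<subseteq> component n H 0" "{2, 3} \<subseteq> component n H 2"
    using assms by (auto simp: component_def H_def intro!: conn_edge)
  then have "csize n H 0 \<ge> 2" "csize n H 2 \<ge> 2"
    using card_mono[OF finite_comp, of "{0, 1}" n H 0] card_mono[OF finite_comp, of "{2, 3}" n H 2]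
    by simp_all
  note big = merge_pot_less[OF this]
  have n: "n > 0"
    using assms by simp
  have le: "(\<lambda>(x, y). merge_pot (csize n H x) + merge_pot (csize n H y) - merge_pot (csize n H x + csize n H y)) p
      \<le> (\<lambda>(x, y). 1 / csize n H x + 1 / csize n H y) p" if "p \<in> nonconn n H" for p H
    using that by (auto simp: nonconn_def csize_pos intro!: merge_pot_le)
  have "2 * real n * (1 + (harm n - 1) / real n - 1 / (real n)\<^sup>2) < 2 * real n * mst_mean n"
    unfolding mst_mean_eq_symmetric[OF n] avg_merge_pot[OF n, symmetric]
  proof (rule avg_strict_mono[OF _ sub])
    show "(\<Sum>(x, y)\<in>nonconn n H. merge_pot (csize n H x) + merge_pot (csize n H y) - merge_pot (csize n H x + csize n H y))
       < (\<Sum>(x, y)\<in>nonconn n H. 1 / csize n H x + 1 / csize n H y)"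
    proof (rule sum_strict_mono_ex1)
      show "\<exists>p\<in>nonconn n H. (case p of (x, y) \<Rightarrow> merge_pot (csize n H x) + merge_pot (csize n H y) - merge_pot (csize n H x + csize n H y))
         < (case p of (x, y) \<Rightarrow> 1 / csize n H x + 1 / csize n H y)"
        using big nc assms by (intro bexI[of _ "(0, 2)"]) (auto simp: nonconn_def)
    qed (use le in auto)
  qed (intro sum_mono le)
  then show ?thesis
    using n by simp
qed

lemma harm_ge: "n > 0 \<Longrightarrow> (harm n :: real) \<ge> 2 - 1 / n"
proof (induction n)
  case (Suc n)
  show ?case
  proof (cases "n = 0")
    case False
    then have "1 / real n - 1 / Suc n \<le> 1 / Suc n"
      by (simp add: divide_simps)
    then show ?thesis
      using Suc False by (simp add: harm_Suc inverse_eq_divide del: of_nat_Suc)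
  qed (simp add: harm_def)
qed simp

lemma harm_greater: "n \<ge> 3 \<Longrightarrow> (harm n :: real) > 2 - 1 / n"
proof (induction n rule: nat_induct_at_least)
  case base
  show ?case by (simp add: harm_def numeral_3_eq_3)
next
  case (Suc n)
  then have "1 / real n - 1 / Suc n \<le> 1 / Suc n"
    by (simp add: divide_simps)
  then show ?case
    using Suc by (simp add: harm_Suc inverse_eq_divide del: of_nat_Suc)
qed

text \<open>The simple bound is the harmonic one with the harmonic number replaced by its lower
  estimate 2 - 1 / n; strictness for n \<ge> 3 comes from that estimate.\<close>

lemma lower_bound_eq: "n > 0 \<Longrightarrow> (real n - 1) * (real n + 2) / (real n)\<^sup>2 = 1 + ((2 - 1 / real n) - 1) / real n - 1 / (real n)\<^sup>2"
  by (simp add: field_simps power2_eq_square)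

lemma mst_mean_ge_simple:
  assumes "n > 0"
  shows "mst_mean n \<ge> (real n - 1) * (real n + 2) / (real n)\<^sup>2"
proof -
  have "((2 - 1 / n) - 1) / n \<le> (harm n - 1) / n"
    using harm_ge assms by (intro divide_right_mono) auto
  then show ?thesis
    unfolding lower_bound_eq[OF assms] using mst_mean_ge[OF assms] by linarith
qed

lemma mst_mean_greater_simple:
  assumes "n \<ge> 3"
  shows "mst_mean n > (real n - 1) * (real n + 2) / (real n)\<^sup>2"
proof -
  have n: "n > 0"
    using assms by simp
  have "((2 - 1 / n) - 1) / n < (harm n - 1) / n"
    using harm_greater assms by (intro divide_strict_right_mono) auto
  then show ?thesis
    unfolding lower_bound_eq[OF n] using mst_mean_ge[OF n] by linarith
qed

text \<open>These are transversals of \<open>r\<close> components of total size \<open>k\<close>. Counting transversals weights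
  a family of components by the product of their sizes, which makes the gain in the next lemmas a multiple
  of the number of transversals of \<open>r + 1\<close> components.\<close>

definition reps :: "nat \<Rightarrow> nat \<Rightarrow> nat \<Rightarrow> nat set set \<Rightarrow> nat set set" where
  "reps n k r H = {R. R \<subseteq> {..<n} \<and> card R = r \<and> (\<forall>x\<in>R. \<forall>y\<in>R. x \<noteq> y \<longrightarrow> \<not> conn H x y) \<and>
     (\<Sum>v\<in>R. csize n H v) = k}"

lemma finite_reps [simp]: "finite (reps n k r H)"
  by (rule finite_subset[of _ "Pow {..<n}"]) (auto simp: reps_def)

lemma finite_rep: "R \<in> reps n k r H \<Longrightarrow> finite R"
  by (auto simp: reps_def intro: finite_subset)

definition span :: "nat \<Rightarrow> nat set set \<Rightarrow> nat set \<Rightarrow> nat set" where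
  "span n H R = (\<Union>v\<in>R. component n H v)"

lemma finite_span: "finite R \<Longrightarrow> finite (span n H R)"
  by (simp add: span_def)

lemma span_subset: "span n H R \<subseteq> {..<n}"
  using comp_subset by (auto simp: span_def)

lemma card_span:
  assumes "R \<in> reps n k r H"
  shows "card (span n H R) = k"
proof -
  have "card (span n H R) = (\<Sum>v\<in>R. csize n H v)"
    unfolding span_def using assms comp_disjoint[of H _ _ n] finite_rep[OF assms]
    by (intro card_UN_disjoint) (auto simp: reps_def)
  then show ?thesis
    using assms by (simp add: reps_def)
qed

lemma csize_rep_le:
  assumes "R \<in> reps n k r H" "v \<in> R"
  shows "csize n H v + r \<le> k + 1"
proof -
  have fin: "finite R"
    using assms(1) by (rule finite_rep)
  have "(\<Sum>v\<in>R - {v}. 1) \<le> (\<Sum>v\<in>R - {v}. csize n H v)"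
    by (intro sum_mono) (use assms(1) csize_pos[of _ n H] in \<open>auto simp: reps_def Suc_le_eq subset_iff\<close>)
  moreover have "k = csize n H v + (\<Sum>v\<in>R - {v}. csize n H v)"
    using assms fin sum.remove[OF fin assms(2), of "csize n H"] by (simp add: reps_def)
  moreover have "card (R - {v}) = r - 1"
    using assms fin by (simp add: reps_def)
  ultimately show ?thesis
    by simp
qed

lemma reps_insert_connected: "conn H x y \<Longrightarrow> reps n k r (insert {x, y} H) = reps n k r H"
  by (simp add: reps_def component_def conn_insert_connected)

lemma reps_empty: "reps n k r {} = (if r = k then {R. R \<subseteq> {..<n} \<and> card R = k} else {})"
proof -
  have "(\<Sum>v\<in>R. csize n {} v) = card R" if "R \<subseteq> {..<n}" for R
    using that by (simp add: csize_empty subset_iff)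
  then show ?thesis
    by (auto simp: reps_def)
qed

lemma reps_complete:
  assumes "k < n" "r > 0"
  shows "reps n k r (complete_edges n) = {}"
proof -
  have False if R: "R \<in> reps n k r (complete_edges n)" for R
  proof -
    obtain v where v: "v \<in> R"
      using R assms(2) by (auto simp: reps_def card_gt_0_iff)
    have "csize n (complete_edges n) v \<le> (\<Sum>v\<in>R. csize n (complete_edges n) v)"
      using finite_rep[OF R] v by (intro member_le_sum) auto
    then show False
      using R v assms(1) by (auto simp: reps_def comp_complete subset_iff)
  qed
  then show ?thesis by blast
qed

lemma reps_empty_of_large: "k < r \<Longrightarrow> reps n k r H = {}"
proof (rule ccontr)
  assume "k < r" "reps n k r H \<noteq> {}"
  then obtain R where R: "R \<in> reps n k r H" by auto
  have "(\<Sum>v\<in>R. 1) \<le> (\<Sum>v\<in>R. csize n H v)"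
    by (intro sum_mono) (use R csize_pos[of _ n H] in \<open>auto simp: reps_def Suc_le_eq subset_iff\<close>)
  then show False
    using R \<open>k < r\<close> by (auto simp: reps_def)
qed

text \<open>In the new graph the component of v is the union of the old components of x and y.
  Making y a further representative splits it again without changing the total size k, and no other
  representative lies in either part.\<close>

lemma gain_reps:
  assumes xy: "x < n" "y < n" "\<not> conn H x y"
    and R: "R \<in> reps n k r (insert {x, y} H)"
    and v: "v \<in> R" "conn H v x"
  shows "y \<notin> R \<and> insert y R \<in> reps n k (Suc r) H \<and> x \<in> span n H (insert y R) - component n H y"
proof -
  have fin: "finite R"
    using R by (rule finite_rep)
  have sep: "\<not> conn (insert {x, y} H) a b" if "a \<in> R" "b \<in> R" "a \<noteq> b" for a b
    using R that by (simp add: reps_def)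
  have sepH: "\<not> conn H a b" if "a \<in> R" "b \<in> R" "a \<noteq> b" for a b
    using sep[OF that] by (simp add: conn_insert)
  have y: "\<not> conn H y w" if "w \<in> R" for w
  proof (cases "w = v")
    case True
    then show ?thesis
      using v(2) xy(3) by (meson conn_sym conn_trans)
  next
    case False
    then show ?thesis
      using sep[OF v(1) that] v(2) by (auto simp: conn_insert)
  qed
  have y_notin: "y \<notin> R"
    using y[of y] by auto
  have y': "\<not> conn H w y" if "w \<in> R" for w
    using y[OF that] conn_sym[of H w y] by auto
  have "\<not> conn H w x" if "w \<in> R - {v}" for w
    using that sepH[of v w] v conn_trans[OF v(2) conn_sym, of w] by auto
  then have "csize n (insert {x, y} H) w = csize n H w" if "w \<in> R - {v}" for w
    using that y' by (simp add: csize_insert[OF xy(3)])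
  moreover have "csize n (insert {x, y} H) v = csize n H v + csize n H y"
    using v comp_eq[OF v(2), of n] by (subst csize_insert[OF xy(3)]) simp
  ultimately have "(\<Sum>w\<in>R. csize n (insert {x, y} H) w) = csize n H y + (\<Sum>w\<in>R. csize n H w)"
    using sum.remove[OF fin v(1), of "csize n (insert {x, y} H)"] sum.remove[OF fin v(1), of "csize n H"]
    by simp
  then have "insert y R \<in> reps n k (Suc r) H"
    using R fin xy y y' y_notin sepH by (auto simp: reps_def)
  moreover have "x \<in> span n H (insert y R) - component n H y"
    using v xy conn_sym[of H y x] by (auto simp: span_def component_def)
  ultimately show ?thesis
    using y_notin by blast
qed

text \<open>A gained R and its edge are recovered from Q = \<open>insert y R\<close>, the vertex y
  of Q to drop, and the place of x in the rest of the span of Q. For fixed Q the number of choices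
  is the sum of k - \<open>csize n H y\<close> over y in Q, that is (r + 1) * k - k = r * k. The
  factor 2 records which entry of the ordered pair plays the role of y.\<close>

lemma sum_gain_le:
  "(\<Sum>(x, y)\<in>nonconn n H. card (reps n k r (insert {x, y} H) - reps n k r H))
     \<le> 2 * r * k * card (reps n k (Suc r) H)"
proof -
  define G where "G = (SIGMA p:nonconn n H. reps n k r (insert {fst p, snd p} H) - reps n k r H)"
  define T where "T = (SIGMA Q:reps n k (Suc r) H. SIGMA y:Q. span n H Q - component n H y)"
  have fin: "finite T"
    unfolding T_def by (intro finite_SigmaI finite_Diff finite_span) (auto dest: finite_rep)
  have "G \<subseteq> (\<lambda>(Q, y, x). ((x, y), Q - {y})) ` T \<union> (\<lambda>(Q, y, x). ((y, x), Q - {y})) ` T"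
  proof
    fix q assume "q \<in> G"
    then obtain x y R where q: "q = ((x, y), R)" and xy: "x < n" "y < n" "\<not> conn H x y"
      and R: "R \<in> reps n k r (insert {x, y} H)" "R \<notin> reps n k r H"
      by (auto simp: G_def nonconn_def)
    \<comment> \<open>Otherwise no representative changes its component size and R was a transversal
      already.\<close>
    have "\<exists>v\<in>R. conn H v x \<or> conn H v y"
    proof (rule ccontr)
      assume "\<not> ?thesis"
      then have "(\<Sum>v\<in>R. csize n (insert {x, y} H) v) = (\<Sum>v\<in>R. csize n H v)"
        by (intro sum.cong) (auto simp: csize_insert[OF xy(3)])
      then show False
        using R by (auto simp: reps_def conn_insert)
    qed
    then obtain v where v: "v \<in> R" "conn H v x \<or> conn H v y" by auto
    show "q \<in> (\<lambda>(Q, y, x). ((x, y), Q - {y})) ` T \<union> (\<lambda>(Q, y, x). ((y, x), Q - {y})) ` T"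
    proof (cases "conn H v x")
      case True
      have "y \<notin> R" "(insert y R, y, x) \<in> T"
        using gain_reps[OF xy R(1) v(1) True] by (auto simp: T_def)
      then show ?thesis
        by (intro UnI1 image_eqI[of _ _ "(insert y R, y, x)"]) (auto simp: q)
    next
      case False
      have "x \<notin> R" "(insert x R, x, y) \<in> T"
        using gain_reps[of y n x H R k r v] v False xy R(1) conn_sym[of H y x]
        by (auto simp: T_def insert_commute)
      then show ?thesis
        by (intro UnI2 image_eqI[of _ _ "(insert x R, x, y)"]) (auto simp: q)
    qed
  qed
  then have "card G \<le> card ((\<lambda>(Q, y, x). ((x, y), Q - {y})) ` T \<union> (\<lambda>(Q, y, x). ((y, x), Q - {y})) ` T)"
    using fin by (intro card_mono) auto
  also have "\<dots> \<le> card T + card T"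
    by (rule order_trans[OF card_Un_le]) (intro add_mono card_image_le fin)
  finally have le: "card G \<le> 2 * card T" by simp
  have "card T = (\<Sum>Q\<in>reps n k (Suc r) H. card (SIGMA y:Q. span n H Q - component n H y))"
    unfolding T_def by (intro card_SigmaI ballI finite_SigmaI finite_Diff finite_span) (auto dest: finite_rep)
  also have "\<dots> = (\<Sum>Q\<in>reps n k (Suc r) H. r * k)"
  proof (intro sum.cong refl)
    fix Q assume Q: "Q \<in> reps n k (Suc r) H"
    have finQ: "finite Q"
      using Q by (rule finite_rep)
    have "card (SIGMA y:Q. span n H Q - component n H y) = (\<Sum>y\<in>Q. card (span n H Q - component n H y))"
      using finQ by (intro card_SigmaI) (auto simp: finite_span)
    also have "\<dots> = (\<Sum>y\<in>Q. k - csize n H y)"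
      by (intro sum.cong) (use card_span[OF Q] in \<open>auto simp: span_def intro!: card_Diff_subset\<close>)
    also have "\<dots> = (\<Sum>y\<in>Q. k) - (\<Sum>y\<in>Q. csize n H y)"
    proof (rule sum_subtractf_nat)
      show "csize n H y \<le> k" if "y \<in> Q" for y
        using csize_rep_le[OF Q that] by simp
    qed
    also have "\<dots> = r * k"
      using Q by (simp add: reps_def)
    finally show "card (SIGMA y:Q. span n H Q - component n H y) = r * k" .
  qed
  finally have "card T = card (reps n k (Suc r) H) * (r * k)"
    by simp
  moreover have "card G = (\<Sum>(x, y)\<in>nonconn n H. card (reps n k r (insert {x, y} H) - reps n k r H))"
    unfolding G_def by (subst card_SigmaI) (auto simp: case_prod_beta)
  ultimately show ?thesis
    using le by (simp add: mult_ac)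
qed

lemma loss_reps:
  assumes R: "R \<in> reps n k r H" and xy: "(x, y) \<in> nonconn n H" "x \<in> span n H R"
  shows "R \<notin> reps n k r (insert {x, y} H)"
proof
  assume R': "R \<in> reps n k r (insert {x, y} H)"
  have xy': "x < n" "y < n" "\<not> conn H x y"
    using xy by (auto simp: nonconn_def)
  obtain v where v: "v \<in> R" "conn H v x"
    using xy by (auto simp: span_def component_def)
  have "(\<Sum>w\<in>R. csize n H w) < (\<Sum>w\<in>R. csize n (insert {x, y} H) w)"
  proof (rule sum_strict_mono_ex1)
    show "\<exists>w\<in>R. csize n H w < csize n (insert {x, y} H) w"
      using v comp_eq[OF v(2), of n] csize_pos[OF xy'(2), of H]
      by (intro bexI[of _ v]) (auto simp: csize_insert[OF xy'(3)])
    show "\<forall>w\<in>R. csize n H w \<le> csize n (insert {x, y} H) w"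
      by (auto intro!: card_mono simp: component_def conn_insert)
  qed (rule finite_rep[OF R])
  then show False
    using R R' by (simp add: reps_def)
qed

text \<open>A merging edge with an endpoint in the span S of R enlarges the total size and so
  destroys R. A component met by R has at most k + 1 - r vertices, since the other r - 1 take at
  least one each; so at least k * (n - (k + 1 - r)) such pairs start in S, and k * (n - k) more
  enter S from outside.\<close>

lemma card_loss_ge:
  assumes R: "R \<in> reps n k r H" and "k \<le> n" "r > 0"
  shows "k * (2 * (n - k) + r - 1) \<le> card {(x, y) \<in> nonconn n H. R \<notin> reps n k r (insert {x, y} H)}"
proof -
  define S where "S = span n H R"
  have finS: "finite S" and S: "S \<subseteq> {..<n}" and cS: "card S = k"
    using card_span[OF R] finite_span[OF finite_rep[OF R]] span_subset by (auto simp: S_def)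
  define A where "A = (SIGMA x:S. {..<n} - component n H x)"
  have nc: "\<not> conn H x y" if "x \<in> S" "y \<in> {..<n} - S" for x y
    using that by (auto simp: S_def span_def component_def dest: conn_trans)
  have sub: "A \<union> ({..<n} - S) \<times> S \<subseteq> {(x, y) \<in> nonconn n H. R \<notin> reps n k r (insert {x, y} H)}"
  proof
    fix p assume p: "p \<in> A \<union> ({..<n} - S) \<times> S"
    obtain x y where xy: "p = (x, y)" by fastforce
    consider "x \<in> S" "(x, y) \<in> nonconn n H" | "x \<in> {..<n} - S" "y \<in> S"
      using p S by (auto simp: xy A_def nonconn_def component_def)
    then show "p \<in> {(x, y) \<in> nonconn n H. R \<notin> reps n k r (insert {x, y} H)}"
    proof cases
      case 1
      then show ?thesis
        using loss_reps[OF R] by (auto simp: xy S_def)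
    next
      case 2
      then have yx: "(y, x) \<in> nonconn n H"
        using nc S by (auto simp: nonconn_def)
      then have "(x, y) \<in> nonconn n H"
        using conn_sym[of H x y] by (auto simp: nonconn_def)
      then show ?thesis
        using loss_reps[OF R yx] 2 by (simp add: xy S_def insert_commute)
    qed
  qed
  have "k * (2 * (n - k) + r - 1) = (\<Sum>x\<in>S. n - (k + 1 - r)) + (n - k) * k"
  proof -
    obtain v where "v \<in> R"
      using R assms(3) by (auto simp: reps_def card_gt_0_iff)
    then have "r \<le> k"
      using csize_rep_le[OF R] csize_pos[of v n H] R by (force simp: reps_def)
    then have "n - (k + 1 - r) = (n - k) + (r - 1)"
      using assms by simp
    moreover have "k * (2 * d + r - 1) = k * (d + (r - 1)) + d * k" for d
      using assms(3) by (cases r) (auto simp: algebra_simps)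
    ultimately show ?thesis
      by (simp add: cS)
  qed
  also have "\<dots> \<le> (\<Sum>x\<in>S. n - csize n H x) + (n - k) * k"
  proof (intro add_mono sum_mono order_refl)
    fix x assume "x \<in> S"
    then obtain v where v: "v \<in> R" "conn H v x"
      by (auto simp: S_def span_def component_def)
    then show "n - (k + 1 - r) \<le> n - csize n H x"
      using csize_rep_le[OF R v(1)] comp_eq[OF v(2), of n] by simp
  qed
  also have "\<dots> = card A + card (({..<n} - S) \<times> S)"
    using finS S by (simp add: A_def card_Diff_subset comp_subset cS card_cartesian_product)
  also have "\<dots> = card (A \<union> ({..<n} - S) \<times> S)"
    by (rule card_Un_disjoint[symmetric]) (use finS in \<open>auto simp: A_def\<close>)
  also have "\<dots> \<le> card {(x, y) \<in> nonconn n H. R \<notin> reps n k r (insert {x, y} H)}"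
    by (rule card_mono[OF _ sub]) (auto intro: finite_subset[OF _ finite_nonconn])
  finally show ?thesis .
qed

lemma sum_increments_reps_le:
  assumes "k \<le> n" "r > 0"
  shows "(\<Sum>(x, y)\<in>nonconn n H. real (card (reps n k r (insert {x, y} H))) - card (reps n k r H))
     \<le> 2 * r * k * real (card (reps n k (Suc r) H)) - k * (2 * (real n - k) + r - 1) * card (reps n k r H)"
proof -
  have diff: "real (card A) - card B = real (card (A - B)) - card (B - A)"
    if "finite A" "finite B" for A B :: "nat set set"
    using card_Int_Diff[OF that(1), of B] card_Int_Diff[OF that(2), of A] by (simp add: Int_commute)
  have "k * (2 * (n - k) + r - 1) * card (reps n k r H)
      \<le> (\<Sum>R\<in>reps n k r H. card {(x, y) \<in> nonconn n H. R \<notin> reps n k r (insert {x, y} H)})"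
    using sum_mono[of "reps n k r H" "\<lambda>_. k * (2 * (n - k) + r - 1)"] card_loss_ge assms
    by (simp add: mult.commute)
  also have "\<dots> = (\<Sum>R\<in>reps n k r H. \<Sum>p | p \<in> nonconn n H \<and> R \<notin> reps n k r (insert {fst p, snd p} H). 1)"
    by (intro sum.cong) (auto intro!: arg_cong[where f = card])
  also have "\<dots> = (\<Sum>p\<in>nonconn n H. \<Sum>R | R \<in> reps n k r H \<and> R \<notin> reps n k r (insert {fst p, snd p} H). 1)"
    by (rule sum.swap_restrict) auto
  also have "\<dots> = (\<Sum>(x, y)\<in>nonconn n H. card (reps n k r H - reps n k r (insert {x, y} H)))"
    by (intro sum.cong) (auto simp: set_diff_eq)
  finally have loss: "k * (2 * (n - k) + r - 1) * card (reps n k r H)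
     \<le> (\<Sum>(x, y)\<in>nonconn n H. card (reps n k r H - reps n k r (insert {x, y} H)))" .
  have "(\<Sum>(x, y)\<in>nonconn n H. real (card (reps n k r (insert {x, y} H))) - card (reps n k r H))
     = real (\<Sum>(x, y)\<in>nonconn n H. card (reps n k r (insert {x, y} H) - reps n k r H))
      - real (\<Sum>(x, y)\<in>nonconn n H. card (reps n k r H - reps n k r (insert {x, y} H)))"
    unfolding case_prod_beta of_nat_sum sum_subtractf[symmetric] by (intro sum.cong refl diff) auto
  also have "\<dots> \<le> real (2 * r * k * card (reps n k (Suc r) H)) - real (k * (2 * (n - k) + r - 1) * card (reps n k r H))"
    by (intro diff_mono of_nat_mono loss sum_gain_le)
  also have "\<dots> = 2 * real r * real k * real (card (reps n k (Suc r) H)) - k * (2 * (real n - k) + r - 1) * card (reps n k r H)"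
    using assms by (simp add: of_nat_diff Suc_le_eq)
  finally show ?thesis by simp
qed

definition avg_reps :: "nat \<Rightarrow> nat \<Rightarrow> nat \<Rightarrow> real" where
  "avg_reps n k r = avg n (\<lambda>H. real (card (reps n k r H)))"

text \<open>The generator identity for the number of transversals. At the end there are none, as the
  only component has n > k vertices; at the start all components are singletons, so only r = k
  contributes, with n choose k sets. Ordered pairs account for the factor 2.\<close>

lemma avg_reps_le:
  assumes "k < n" "r > 0"
  shows "k * (2 * (real n - k) + r - 1) * avg_reps n k r
    \<le> 2 * r * k * avg_reps n k (Suc r) + (if r = k then 2 * real (n choose k) else 0)"
proof -
  have "2 * (real (card (reps n k r (complete_edges n))) - card (reps n k r {}))
     = avg n (\<lambda>H. \<Sum>(x, y)\<in>nonconn n H. real (card (reps n k r (insert {x, y} H))) - card (reps n k r H))"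
    by (rule avg_nonconn_increments[symmetric]) (simp add: reps_insert_connected)
  also have "\<dots> \<le> avg n (\<lambda>H. 2 * r * k * real (card (reps n k (Suc r) H))
      - k * (2 * (real n - k) + r - 1) * card (reps n k r H))"
    by (rule avg_mono) (use sum_increments_reps_le assms in auto)
  also have "\<dots> = 2 * r * k * avg_reps n k (Suc r) - k * (2 * (real n - k) + r - 1) * avg_reps n k r"
    by (simp only: avg_diff avg_cmult avg_reps_def)
  finally show ?thesis
    using assms by (auto simp: reps_complete reps_empty n_subsets split: if_splits)
qed
lemma card_reps_one: "real (card (reps n k 1 H)) = (\<Sum>u<n. of_bool (csize n H u = k))"
proof -
  have "reps n k 1 H = (\<lambda>u. {u}) ` {u \<in> {..<n}. csize n H u = k}"
    by (auto simp: reps_def card_1_singleton_iff)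
  then have "card (reps n k 1 H) = card {u \<in> {..<n}. csize n H u = k}"
    by (simp add: card_image)
  then show ?thesis
    by (simp add: of_bool_def sum.If_cases Int_def)
qed

lemma fact_add_prod: "(fact (d + k) :: real) = fact d * (\<Prod>i=1..k. real (d + i))"
  by (induction k) (auto simp: algebra_simps)

lemma binomial_eq_prod:
  assumes "k \<le> n"
  shows "real (n choose k) * (\<Prod>i=1..k. real i) = (\<Prod>i=1..k. real (n - k + i))"
proof -
  have "(\<Prod>i=1..k. real i) = fact k"
    using fact_add_prod[of 0 k] by simp
  moreover have "real (n choose k) = fact n / (fact k * fact (n - k))"
    using assms by (rule binomial_fact)
  moreover have "(fact n :: real) = fact (n - k) * (\<Prod>i=1..k. real (n - k + i))"
    using fact_add_prod[of "n - k" k] assms by simp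
  ultimately show ?thesis
    by simp
qed

text \<open>Downward induction on r: there are no transversals with r > k, so the chain starts from
  n choose k at r = k, and each step down costs a factor 2 r / (2 (n - k) + r - 1).\<close>

lemma avg_reps_prod_le:
  assumes "r \<le> k" "0 < r" "k < n"
  shows "avg_reps n k r * (\<Prod>i=r..k. 2 * (real n - real k) + real i - 1) \<le> 2 / k * (n choose k) * (\<Prod>i=r..<k. 2 * real i)"
  using assms(1,2)
proof (induction rule: inc_induct)
  case base
  have "avg_reps n k (Suc k) = 0"
    by (simp add: avg_reps_def reps_empty_of_large avg_def)
  then show ?case
    using avg_reps_le[OF assms(3), of k] assms by (simp add: field_simps)
next
  case (step r)
  let ?P = "\<Prod>i=Suc r..k. 2 * (real n - k) + i - 1"
  have P: "?P \<ge> 0"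
    using assms by (intro prod_nonneg) auto
  have "k * ((2 * (real n - k) + r - 1) * avg_reps n k r) \<le> k * (2 * r * avg_reps n k (Suc r))"
    using avg_reps_le[OF assms(3), of r] step assms by (simp add: mult_ac)
  then have le: "(2 * (real n - k) + r - 1) * avg_reps n k r \<le> 2 * r * avg_reps n k (Suc r)"
    using assms by simp
  have "avg_reps n k r * (\<Prod>i=r..k. 2 * (real n - real k) + real i - 1) = ((2 * (real n - k) + r - 1) * avg_reps n k r) * ?P"
    using step by (simp add: prod.atLeast_Suc_atMost)
  also have "\<dots> \<le> 2 * r * avg_reps n k (Suc r) * ?P"
    using le P by (rule mult_right_mono)
  also have "\<dots> \<le> 2 * r * (2 / k * (n choose k) * (\<Prod>i=Suc r..<k. 2 * real i))"
    using mult_left_mono[OF step.IH, of "2 * real r"] by (simp only: mult.assoc) simp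
  also have "\<dots> = 2 / k * (n choose k) * (\<Prod>i=r..<k. 2 * real i)"
    using step by (simp add: prod.atLeast_Suc_lessThan)
  finally show ?case .
qed

text \<open>A bound for the average number of ordered disconnected pairs \<open>(x, y)\<close> with \<open>x\<close> in a component of size \<open>k\<close>.\<close>

definition comp_weight :: "nat \<Rightarrow> nat \<Rightarrow> real" where
  "comp_weight n k = (real n - k) / k\<^sup>2 * (\<Prod>i=1..k. 2 * (real n - real k + real i) / (2 * (real n - real k) + real i - 1))"

text \<open>The end r = 1 of the chain. The factors 2 i cancel the k! in n choose k; the factor 2 k
  missing from their product, together with the leading 2 / k, leaves 1 / k^2.\<close>

lemma avg_reps_one_le:
  assumes "0 < k" "k < n"
  shows "(real n - k) * avg_reps n k 1 \<le> comp_weight n k"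
proof -
  let ?D = "\<Prod>i=1..k. 2 * (real n - k) + i - 1"
  have D: "?D > 0"
    using assms by (intro prod_pos) auto
  have "(\<Prod>i=1..k. 2 * real i) = (\<Prod>i=1..<k. 2 * real i) * (2 * k)"
    using assms by (simp add: prod.last_plus)
  then have "2 / k * (n choose k) * (\<Prod>i=1..<k. 2 * real i) = (n choose k) * (\<Prod>i=1..k. 2 * real i) / k\<^sup>2"
    using assms by (simp add: power2_eq_square)
  also have "\<dots> = 2 ^ k * ((n choose k) * (\<Prod>i=1..k. real i)) / k\<^sup>2"
    by (simp only: prod.distrib prod_constant card_atLeastAtMost diff_Suc_1 mult_ac)
  also have "\<dots> = (\<Prod>i=1..k. 2 * (real n - real k + real i)) / k\<^sup>2"
  proof -
    have "real (n choose k) * (\<Prod>i=1..k. real i) = (\<Prod>i=1..k. real n - real k + real i)"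
      using binomial_eq_prod[of k n] assms by (simp add: of_nat_diff diff_add_eq)
    then show ?thesis
      by (simp only: prod.distrib prod_constant card_atLeastAtMost diff_Suc_1)
  qed
  finally have "avg_reps n k 1 * ?D \<le> (\<Prod>i=1..k. 2 * (real n - real k + real i)) / k\<^sup>2"
    using avg_reps_prod_le[of 1 k n] assms by simp
  then have "avg_reps n k 1 \<le> (\<Prod>i=1..k. 2 * (real n - real k + real i)) / k\<^sup>2 / ?D"
    using D by (simp only: pos_le_divide_eq)
  then have "(real n - k) * avg_reps n k 1 \<le> (real n - k) * ((\<Prod>i=1..k. 2 * (real n - real k + real i)) / k\<^sup>2 / ?D)"
    using assms by (intro mult_left_mono) auto
  also have "\<dots> = comp_weight n k"
    by (simp add: comp_weight_def prod_dividef)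
  finally show ?thesis .
qed

lemma inverse_le_truncated:
  fixes a m :: nat
  assumes "a > 0"
  shows "1 / real a \<le> 1 / (real m + 1) + (\<Sum>k=1..m. (1 / real k - 1 / (real m + 1)) * of_bool (a = k))"
proof (cases "a \<le> m")
  case True
  then have "(\<Sum>k=1..m. (1 / real k - 1 / (real m + 1)) * of_bool (a = k)) = 1 / a - 1 / (real m + 1)"
    using assms by (simp add: of_bool_def if_distrib[of "\<lambda>x. _ * x"] cong: if_cong)
  then show ?thesis by simp
next
  case False
  then have "(\<Sum>k=1..m. (1 / real k - 1 / (real m + 1)) * of_bool (a = k)) = 0"
    by (intro sum.neutral) auto
  moreover have "1 / real a \<le> 1 / (real m + 1)"
    using False by (intro divide_left_mono) auto
  ultimately show ?thesis by simp
qed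

text \<open>The coefficients 1 / k - 1 / (m + 1) are nonnegative for k \<le> m, so upper bounds for
  the frequencies may be inserted; the constant part is averaged exactly by
  \<open>avg_card_nonconn\<close>.\<close>

lemma mst_mean_le_sum:
  assumes "m < n"
  shows "n * mst_mean n \<le> 2 * (real n - 1) / (m + 1) + (\<Sum>k=1..m. (1 / real k - 1 / (real m + 1)) * comp_weight n k)"
proof -
  have n: "n > 0"
    using assms by simp
  let ?c = "\<lambda>k. 1 / real k - 1 / (real m + 1)"
  have sel: "(\<Sum>(x, y)\<in>nonconn n H. of_bool (csize n H x = k)) = (real n - k) * card (reps n k 1 H)" for H k
    unfolding sum_nonconn card_reps_one sum_distrib_left by (intro sum.cong) auto
  have "(\<Sum>(x, y)\<in>nonconn n H. 1 / csize n H x)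
      \<le> 1 / (real m + 1) * card (nonconn n H) + (\<Sum>k=1..m. ?c k * ((real n - k) * card (reps n k 1 H)))" for H
  proof -
    have "(\<Sum>(x, y)\<in>nonconn n H. 1 / csize n H x)
        \<le> (\<Sum>(x, y)\<in>nonconn n H. 1 / (real m + 1) + (\<Sum>k=1..m. ?c k * of_bool (csize n H x = k)))"
      by (intro sum_mono) (use inverse_le_truncated csize_pos in \<open>auto simp: nonconn_def add_ac\<close>)
    also have "\<dots> = 1 / (real m + 1) * card (nonconn n H)
        + (\<Sum>p\<in>nonconn n H. \<Sum>k=1..m. ?c k * of_bool (csize n H (fst p) = k))"
      by (simp add: case_prod_beta sum.distrib)
    also have "(\<Sum>p\<in>nonconn n H. \<Sum>k=1..m. ?c k * of_bool (csize n H (fst p) = k))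
        = (\<Sum>k=1..m. ?c k * (\<Sum>(x, y)\<in>nonconn n H. of_bool (csize n H x = k)))"
      by (subst sum.swap) (simp only: sum_distrib_left case_prod_beta)
    finally show ?thesis
      by (simp only: sel)
  qed
  then have "n * mst_mean n \<le> avg n (\<lambda>H. 1 / (real m + 1) * card (nonconn n H)
      + (\<Sum>k=1..m. ?c k * ((real n - k) * card (reps n k 1 H))))"
    unfolding mst_mean_eq[OF n] by (intro avg_mono)
  also have "\<dots> = 2 * (real n - 1) / (m + 1) + (\<Sum>k=1..m. ?c k * ((real n - k) * avg_reps n k 1))"
    unfolding avg_add avg_sum avg_cmult avg_card_nonconn[OF n] avg_reps_def by (simp add: add_ac)
  also have "\<dots> \<le> 2 * (real n - 1) / (m + 1) + (\<Sum>k=1..m. ?c k * comp_weight n k)"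
    using assms by (intro add_left_mono sum_mono mult_left_mono avg_reps_one_le) (auto simp: field_simps)
  finally show ?thesis by (simp add: add_ac)
qed

section \<open>Numerical evaluation of the truncated upper bound\<close>

lemma interval_sets: "{Suc 0..2} = {1, 2 :: nat}" "{Suc 0..3} = {1, 2, 3 :: nat}" "{Suc 0..4} = {1, 2, 3, 4 :: nat}"
  "{Suc 0..5} = {1, 2, 3, 4, 5 :: nat}" "{Suc 0..6} = {1, 2, 3, 4, 5, 6 :: nat}"
  "{Suc 0..7} = {1, 2, 3, 4, 5, 6, 7 :: nat}" "{Suc 0..8} = {1, 2, 3, 4, 5, 6, 7, 8 :: nat}"
  by auto

text \<open>In this and the next seven lemmas the added constants 0, 1, 2, 5, 11, 22, 49, 130 are
  the least integers for which the estimate holds at n = 10. With n = 10 + x and denominators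
  cleared, the difference of the two sides is a polynomial in x with nonnegative coefficients, so
  the estimate persists for larger n.\<close>

lemma comp_weight_le_1:
  assumes "n \<ge> 10"
  shows "comp_weight n 1 \<le> (real n + 0) / 1"
proof -
  obtain x :: real where x: "real n = 10 + x" "x \<ge> 0"
    using assms by (metis add_diff_cancel_left' diff_add_cancel add.commute diff_ge_0_iff_ge numeral_le_real_of_nat_iff)
  have "(10 + x) * ((18 + 2 * x)) - (9 + x) * ((20 + 2 * x)) = 0"
    by algebra
  then have "(9 + x) * ((20 + 2 * x)) \<le> (10 + x) * ((18 + 2 * x))"
    using x(2) by (smt (verit) add_nonneg_nonneg mult_nonneg_nonneg zero_le_power)
  then have "(9 + x) * ((20 + 2 * x)) / ((18 + 2 * x)) \<le> 10 + x"
    using x(2) by (simp add: pos_divide_le_eq)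
  then show ?thesis
    using x by (simp add: comp_weight_def interval_sets)
qed

lemma comp_weight_le_2:
  assumes "n \<ge> 10"
  shows "comp_weight n 2 \<le> (real n + 1) / 4"
proof -
  obtain x :: real where x: "real n = 10 + x" "x \<ge> 0"
    using assms by (metis add_diff_cancel_left' diff_add_cancel add.commute diff_ge_0_iff_ge numeral_le_real_of_nat_iff)
  have "(11 + x) * ((16 + 2 * x) * (17 + 2 * x)) - (8 + x) * ((18 + 2 * x) * (20 + 2 * x)) = 112 * x ^ 0 + 30 * x ^ 1 + 2 * x ^ 2"
    by algebra
  then have "(8 + x) * ((18 + 2 * x) * (20 + 2 * x)) \<le> (11 + x) * ((16 + 2 * x) * (17 + 2 * x))"
    using x(2) by (smt (verit) add_nonneg_nonneg mult_nonneg_nonneg zero_le_power)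
  then have "(8 + x) * ((18 + 2 * x) * (20 + 2 * x)) / ((16 + 2 * x) * (17 + 2 * x)) \<le> 11 + x"
    using x(2) by (simp add: pos_divide_le_eq)
  then show ?thesis
    using x by (simp add: comp_weight_def interval_sets)
qed

lemma comp_weight_le_3:
  assumes "n \<ge> 10"
  shows "comp_weight n 3 \<le> (real n + 2) / 9"
proof -
  obtain x :: real where x: "real n = 10 + x" "x \<ge> 0"
    using assms by (metis add_diff_cancel_left' diff_add_cancel add.commute diff_ge_0_iff_ge numeral_le_real_of_nat_iff)
  have "(12 + x) * ((14 + 2 * x) * (15 + 2 * x) * (16 + 2 * x)) - (7 + x) * ((16 + 2 * x) * (18 + 2 * x) * (20 + 2 * x)) = 224 * x ^ 1 + 60 * x ^ 2 + 4 * x ^ 3"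
    by algebra
  then have "(7 + x) * ((16 + 2 * x) * (18 + 2 * x) * (20 + 2 * x)) \<le> (12 + x) * ((14 + 2 * x) * (15 + 2 * x) * (16 + 2 * x))"
    using x(2) by (smt (verit) add_nonneg_nonneg mult_nonneg_nonneg zero_le_power)
  then have "(7 + x) * ((16 + 2 * x) * (18 + 2 * x) * (20 + 2 * x)) / ((14 + 2 * x) * (15 + 2 * x) * (16 + 2 * x)) \<le> 12 + x"
    using x(2) by (simp add: pos_divide_le_eq)
  then show ?thesis
    using x by (simp add: comp_weight_def interval_sets)
qed

lemma comp_weight_le_4:
  assumes "n \<ge> 10"
  shows "comp_weight n 4 \<le> (real n + 5) / 16"
proof -
  obtain x :: real where x: "real n = 10 + x" "x \<ge> 0"
    using assms by (metis add_diff_cancel_left' diff_add_cancel add.commute diff_ge_0_iff_ge numeral_le_real_of_nat_iff)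
  have "(15 + x) * ((12 + 2 * x) * (13 + 2 * x) * (14 + 2 * x) * (15 + 2 * x)) - (6 + x) * ((14 + 2 * x) * (16 + 2 * x) * (18 + 2 * x) * (20 + 2 * x)) = 7560 * x ^ 0 + 13596 * x ^ 1 + 5008 * x ^ 2 + 684 * x ^ 3 + 32 * x ^ 4"
    by algebra
  then have "(6 + x) * ((14 + 2 * x) * (16 + 2 * x) * (18 + 2 * x) * (20 + 2 * x)) \<le> (15 + x) * ((12 + 2 * x) * (13 + 2 * x) * (14 + 2 * x) * (15 + 2 * x))"
    using x(2) by (smt (verit) add_nonneg_nonneg mult_nonneg_nonneg zero_le_power)
  then have "(6 + x) * ((14 + 2 * x) * (16 + 2 * x) * (18 + 2 * x) * (20 + 2 * x)) / ((12 + 2 * x) * (13 + 2 * x) * (14 + 2 * x) * (15 + 2 * x)) \<le> 15 + x"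
    using x(2) by (simp add: pos_divide_le_eq)
  then show ?thesis
    using x by (simp add: comp_weight_def interval_sets)
qed

lemma comp_weight_le_5:
  assumes "n \<ge> 10"
  shows "comp_weight n 5 \<le> (real n + 11) / 25"
proof -
  obtain x :: real where x: "real n = 10 + x" "x \<ge> 0"
    using assms by (metis add_diff_cancel_left' diff_add_cancel add.commute diff_ge_0_iff_ge numeral_le_real_of_nat_iff)
  have "(21 + x) * ((10 + 2 * x) * (11 + 2 * x) * (12 + 2 * x) * (13 + 2 * x) * (14 + 2 * x)) - (5 + x) * ((12 + 2 * x) * (14 + 2 * x) * (16 + 2 * x) * (18 + 2 * x) * (20 + 2 * x)) = 206640 * x ^ 0 + 412728 * x ^ 1 + 214680 * x ^ 2 + 47880 * x ^ 3 + 4920 * x ^ 4 + 192 * x ^ 5"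
    by algebra
  then have "(5 + x) * ((12 + 2 * x) * (14 + 2 * x) * (16 + 2 * x) * (18 + 2 * x) * (20 + 2 * x)) \<le> (21 + x) * ((10 + 2 * x) * (11 + 2 * x) * (12 + 2 * x) * (13 + 2 * x) * (14 + 2 * x))"
    using x(2) by (smt (verit) add_nonneg_nonneg mult_nonneg_nonneg zero_le_power)
  then have "(5 + x) * ((12 + 2 * x) * (14 + 2 * x) * (16 + 2 * x) * (18 + 2 * x) * (20 + 2 * x)) / ((10 + 2 * x) * (11 + 2 * x) * (12 + 2 * x) * (13 + 2 * x) * (14 + 2 * x)) \<le> 21 + x"
    using x(2) by (simp add: pos_divide_le_eq)
  then show ?thesis
    using x by (simp add: comp_weight_def interval_sets)
qed

lemma comp_weight_le_6:
  assumes "n \<ge> 10"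
  shows "comp_weight n 6 \<le> (real n + 22) / 36"
proof -
  obtain x :: real where x: "real n = 10 + x" "x \<ge> 0"
    using assms by (metis add_diff_cancel_left' diff_add_cancel add.commute diff_ge_0_iff_ge numeral_le_real_of_nat_iff)
  have "(32 + x) * ((8 + 2 * x) * (9 + 2 * x) * (10 + 2 * x) * (11 + 2 * x) * (12 + 2 * x) * (13 + 2 * x)) - (4 + x) * ((10 + 2 * x) * (12 + 2 * x) * (14 + 2 * x) * (16 + 2 * x) * (18 + 2 * x) * (20 + 2 * x)) = 829440 * x ^ 0 + 5264448 * x ^ 1 + 4468912 * x ^ 2 + 1596840 * x ^ 3 + 287560 * x ^ 4 + 25872 * x ^ 5 + 928 * x ^ 6"
    by algebra
  then have "(4 + x) * ((10 + 2 * x) * (12 + 2 * x) * (14 + 2 * x) * (16 + 2 * x) * (18 + 2 * x) * (20 + 2 * x)) \<le> (32 + x) * ((8 + 2 * x) * (9 + 2 * x) * (10 + 2 * x) * (11 + 2 * x) * (12 + 2 * x) * (13 + 2 * x))"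
    using x(2) by (smt (verit) add_nonneg_nonneg mult_nonneg_nonneg zero_le_power)
  then have "(4 + x) * ((10 + 2 * x) * (12 + 2 * x) * (14 + 2 * x) * (16 + 2 * x) * (18 + 2 * x) * (20 + 2 * x)) / ((8 + 2 * x) * (9 + 2 * x) * (10 + 2 * x) * (11 + 2 * x) * (12 + 2 * x) * (13 + 2 * x)) \<le> 32 + x"
    using x(2) by (simp add: pos_divide_le_eq)
  then show ?thesis
    using x by (simp add: comp_weight_def interval_sets)
qed

lemma comp_weight_le_7:
  assumes "n \<ge> 10"
  shows "comp_weight n 7 \<le> (real n + 49) / 49"
proof -
  obtain x :: real where x: "real n = 10 + x" "x \<ge> 0"
    using assms by (metis add_diff_cancel_left' diff_add_cancel add.commute diff_ge_0_iff_ge numeral_le_real_of_nat_iff)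
  have "(59 + x) * ((6 + 2 * x) * (7 + 2 * x) * (8 + 2 * x) * (9 + 2 * x) * (10 + 2 * x) * (11 + 2 * x) * (12 + 2 * x)) - (3 + x) * ((8 + 2 * x) * (10 + 2 * x) * (12 + 2 * x) * (14 + 2 * x) * (16 + 2 * x) * (18 + 2 * x) * (20 + 2 * x)) = 3265920 * x ^ 0 + 58300704 * x ^ 1 + 73113264 * x ^ 2 + 38799152 * x ^ 3 + 10931760 * x ^ 4 + 1719536 * x ^ 5 + 143136 * x ^ 6 + 4928 * x ^ 7"
    by algebra
  then have "(3 + x) * ((8 + 2 * x) * (10 + 2 * x) * (12 + 2 * x) * (14 + 2 * x) * (16 + 2 * x) * (18 + 2 * x) * (20 + 2 * x)) \<le> (59 + x) * ((6 + 2 * x) * (7 + 2 * x) * (8 + 2 * x) * (9 + 2 * x) * (10 + 2 * x) * (11 + 2 * x) * (12 + 2 * x))"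
    using x(2) by (smt (verit) add_nonneg_nonneg mult_nonneg_nonneg zero_le_power)
  then have "(3 + x) * ((8 + 2 * x) * (10 + 2 * x) * (12 + 2 * x) * (14 + 2 * x) * (16 + 2 * x) * (18 + 2 * x) * (20 + 2 * x)) / ((6 + 2 * x) * (7 + 2 * x) * (8 + 2 * x) * (9 + 2 * x) * (10 + 2 * x) * (11 + 2 * x) * (12 + 2 * x)) \<le> 59 + x"
    using x(2) by (simp add: pos_divide_le_eq)
  then show ?thesis
    using x by (simp add: comp_weight_def interval_sets)
qed

lemma comp_weight_le_8:
  assumes "n \<ge> 10"
  shows "comp_weight n 8 \<le> (real n + 130) / 64"
proof -
  obtain x :: real where x: "real n = 10 + x" "x \<ge> 0"
    using assms by (metis add_diff_cancel_left' diff_add_cancel add.commute diff_ge_0_iff_ge numeral_le_real_of_nat_iff)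
  have "(140 + x) * ((4 + 2 * x) * (5 + 2 * x) * (6 + 2 * x) * (7 + 2 * x) * (8 + 2 * x) * (9 + 2 * x) * (10 + 2 * x) * (11 + 2 * x)) - (2 + x) * ((6 + 2 * x) * (8 + 2 * x) * (10 + 2 * x) * (12 + 2 * x) * (14 + 2 * x) * (16 + 2 * x) * (18 + 2 * x) * (20 + 2 * x)) = 2419200 * x ^ 0 + 424968960 * x ^ 1 + 798598624 * x ^ 2 + 630307440 * x ^ 3 + 271096224 * x ^ 4 + 68801040 * x ^ 5 + 10327296 * x ^ 6 + 850560 * x ^ 7 + 29696 * x ^ 8"
    by algebra
  then have "(2 + x) * ((6 + 2 * x) * (8 + 2 * x) * (10 + 2 * x) * (12 + 2 * x) * (14 + 2 * x) * (16 + 2 * x) * (18 + 2 * x) * (20 + 2 * x)) \<le> (140 + x) * ((4 + 2 * x) * (5 + 2 * x) * (6 + 2 * x) * (7 + 2 * x) * (8 + 2 * x) * (9 + 2 * x) * (10 + 2 * x) * (11 + 2 * x))"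
    using x(2) by (smt (verit) add_nonneg_nonneg mult_nonneg_nonneg zero_le_power)
  then have "(2 + x) * ((6 + 2 * x) * (8 + 2 * x) * (10 + 2 * x) * (12 + 2 * x) * (14 + 2 * x) * (16 + 2 * x) * (18 + 2 * x) * (20 + 2 * x)) / ((4 + 2 * x) * (5 + 2 * x) * (6 + 2 * x) * (7 + 2 * x) * (8 + 2 * x) * (9 + 2 * x) * (10 + 2 * x) * (11 + 2 * x)) \<le> 140 + x"
    using x(2) by (simp add: pos_divide_le_eq)
  then show ?thesis
    using x by (simp add: comp_weight_def interval_sets)
qed

lemma mst_mean_less_small:
  assumes "n \<in> {4, 5, 6, 7, 8, 9}"
  shows "n * mst_mean n < (real n - 1) * (5 * real n + 6) / (4 * real n)"
proof -
  \<comment> \<open>The tight case: m = 2 yields 73/15 against the target 39/8.\<close>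
  have "4 * mst_mean 4 < (4 - 1) * (5 * 4 + 6) / (4 * 4)"
    using mst_mean_le_sum[of 2 4] by (simp add: comp_weight_def interval_sets power2_eq_square)
  moreover have "n * mst_mean n < (real n - 1) * (5 * real n + 6) / (4 * real n)" if "n \<in> {5, 6, 7, 8, 9}"
    using mst_mean_le_sum[of 4 n] that by (auto simp: comp_weight_def interval_sets power2_eq_square)
  ultimately show ?thesis
    using assms by auto
qed

text \<open>Truncation at m has asymptotic slope 2 / (m + 1) plus the sum of (1 / k - 1 / (m + 1)) /
  k^2 over k \<le> m. This is about 1.2542 for m = 7 and 1.2477 for m = 8, so 8 is the first value
  below the required 5/4.\<close>

lemma mst_mean_less_large:
  assumes "n \<ge> 10"
  shows "n * mst_mean n < (real n - 1) * (5 * real n + 6) / (4 * real n)"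
proof -
  have "n * mst_mean n \<le> 2 * (real n - 1) / 9 + (\<Sum>k\<in>{1..8}. (1 / real k - 1 / 9) * comp_weight n k)"
    using mst_mean_le_sum[of 8 n] assms by simp
  also have "(\<Sum>k\<in>{1..8}. (1 / real k - 1 / 9) * comp_weight n k) =
      8 / 9 * comp_weight n 1 + 7 / 18 * comp_weight n 2 + 2 / 9 * comp_weight n 3 + 5 / 36 * comp_weight n 4
      + 4 / 45 * comp_weight n 5 + 1 / 18 * comp_weight n 6 + 2 / 63 * comp_weight n 7 + 1 / 72 * comp_weight n 8"
    by (simp add: interval_sets)
  finally have "n * mst_mean n < 5 / 4 * real n + 1 / 4 - 3 / 20" \<comment> \<open>the target at \<open>n = 10\<close>\<close>
    using comp_weight_le_1[OF assms] comp_weight_le_2[OF assms] comp_weight_le_3[OF assms]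
      comp_weight_le_4[OF assms] comp_weight_le_5[OF assms] comp_weight_le_6[OF assms]
      comp_weight_le_7[OF assms] comp_weight_le_8[OF assms] assms
    by (simp add: field_simps)
  also have "\<dots> \<le> 5 / 4 * real n + 1 / 4 - 3 / 2 / n"
    using assms by (simp add: field_simps)
  also have "\<dots> = (real n - 1) * (5 * real n + 6) / (4 * real n)"
    using assms by (simp add: field_simps)
  finally show ?thesis .
qed

lemma mst_mean_less:
  assumes "n \<ge> 4"
  shows "mst_mean n < (real n - 1) * (5 * real n + 6) / (4 * (real n)\<^sup>2)"
proof -
  have "n * mst_mean n < (real n - 1) * (5 * real n + 6) / (4 * real n)"
    using mst_mean_less_large[of n] mst_mean_less_small[of n] assms by force
  then show ?thesis
    using assms by (simp add: field_simps power2_eq_square)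
qed

lemma mst_mean_le:
  assumes "n \<ge> 2"
  shows "mst_mean n \<le> (real n - 1) * (5 * real n + 6) / (4 * (real n)\<^sup>2)"
proof (cases "n \<ge> 4")
  case False
  then have "n = 2 \<or> n = 3"
    using assms by auto
  then show ?thesis
    using mst_mean_eq_harm[of n] by (auto simp: harm_def numeral_2_eq_2 numeral_3_eq_3 power2_eq_square)
qed (use mst_mean_less in \<open>auto simp: less_imp_le\<close>)

section \<open>Minimum spanning trees\<close>

text \<open>Quantifies over all namings of the endpoints because an edge is a set; by symmetry of
  \<open>conn\<close> one naming decides.\<close>

definition unlinked :: "'v set set \<Rightarrow> 'v set \<Rightarrow> bool" where
  "unlinked L e \<longleftrightarrow> (\<forall>x y. e = {x, y} \<longrightarrow> \<not> conn L x y)"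

lemma unlinked_doubleton: "unlinked L {x, y} \<longleftrightarrow> \<not> conn L x y"
  using conn_sym[of L] unfolding unlinked_def doubleton_eq_iff by metis

text \<open>The result of Kruskal's algorithm as a separate test for each edge rather than a
  process. This makes membership an event and lets the forest be cut at any weight level, see
  \<open>kruskal_below\<close>.\<close>

definition kruskal :: "(nat set \<Rightarrow> real) \<Rightarrow> nat set set \<Rightarrow> nat set set" where
  "kruskal w H = {e \<in> H. unlinked {f \<in> H. w f < w e} e}"

lemma kruskal_subset: "kruskal w H \<subseteq> H"
  by (auto simp: kruskal_def)

lemma kruskal_empty [simp]: "kruskal w {} = {}"
  by (auto simp: kruskal_def)

lemma doubleton_in_kruskal:
  "{x, y} \<in> kruskal w H \<longleftrightarrow> {x, y} \<in> H \<and> \<not> conn {f \<in> H. w f < w {x, y}} x y"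
  by (simp add: kruskal_def unlinked_doubleton)

lemma kruskal_insert:
  assumes "{x, y} \<notin> H" "\<And>f. f \<in> H \<Longrightarrow> w f < w {x, y}"
  shows "kruskal w (insert {x, y} H) = (if conn H x y then kruskal w H else insert {x, y} (kruskal w H))"
proof -
  have 1: "{f \<in> insert {x, y} H. w f < w e} = {f \<in> H. w f < w e}" if "e \<in> H" for e
    using assms(2)[OF that] by auto
  have 2: "{f \<in> insert {x, y} H. w f < w {x, y}} = H"
    using assms by auto
  have "e \<in> kruskal w (insert {x, y} H) \<longleftrightarrow> e \<in> kruskal w H" if "e \<in> H" for e
    using that by (simp only: kruskal_def mem_Collect_eq 1) simp
  moreover have "{x, y} \<in> kruskal w (insert {x, y} H) \<longleftrightarrow> \<not> conn H x y"
    by (simp only: doubleton_in_kruskal 2) simp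
  moreover note kruskal_subset[of w H] kruskal_subset[of w "insert {x, y} H"] assms(1)
  ultimately show ?thesis
    by (intro set_eqI) auto
qed

lemma kruskal_below:
  "kruskal w {f \<in> H. w f < t} = {e \<in> kruskal w H. w e < t}"
proof -
  have "{f \<in> {f \<in> H. w f < t}. w f < w e} = {f \<in> H. w f < w e}" if "w e < t" for e
    using that by auto
  then have "e \<in> kruskal w {f \<in> H. w f < t} \<longleftrightarrow> e \<in> kruskal w H \<and> w e < t" for e
    by (cases "w e < t") (simp_all add: kruskal_def)
  then show ?thesis
    by blast
qed

lemma kruskal_cong:
  assumes "\<And>f. f \<in> H \<Longrightarrow> w f = w' f"
  shows "kruskal w H = kruskal w' H"
proof -
  have "{f \<in> H. w f < w e} = {f \<in> H. w' f < w' e}" if "e \<in> H" for e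
    using assms that by auto
  then have "e \<in> kruskal w H \<longleftrightarrow> e \<in> kruskal w' H" for e
    by (cases "e \<in> H") (simp_all add: kruskal_def)
  then show ?thesis
    by blast
qed

text \<open>Edges enter by increasing weight, so each new edge is heavier than all present ones and
  \<open>kruskal_insert\<close> decides its fate.\<close>

lemma weight_order_induct [consumes 2, case_names empty insert]:
  fixes w :: "nat set \<Rightarrow> real"
  assumes "H \<subseteq> complete_edges n" "inj_on w H" "P {}"
    and "\<And>H x y. H \<subseteq> complete_edges n \<Longrightarrow> {x, y} \<notin> H \<Longrightarrow> x < n \<Longrightarrow> y < n \<Longrightarrow> x \<noteq> y \<Longrightarrow>
      (\<And>f. f \<in> H \<Longrightarrow> w f < w {x, y}) \<Longrightarrow> P H \<Longrightarrow> P (insert {x, y} H)"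
  shows "P H"
proof -
  have "finite H"
    using assms(1) by (rule finite_subset) simp
  then show ?thesis
    using assms(1,2)
  proof (induction H rule: finite_ranking_induct[where f = w])
    case empty
    show ?case by (rule assms(3))
  next
    case (insert e H)
    have IH: "P H"
      using insert by (auto intro: inj_on_subset)
    show ?case
    proof (cases "e \<in> H")
      case True
      then show ?thesis
        using IH by (simp add: insert_absorb)
    next
      case False
      obtain x y where e: "e = {x, y}" "x < y" "y < n"
        using insert.prems(1) by (auto elim: complete_edgesE)
      have "w f < w e" if "f \<in> H" for f
      proof -
        have "f \<noteq> e"
          using that False by auto
        then have "w f \<noteq> w e"
          using insert.prems(2) that by (auto simp: inj_on_def)
        then show ?thesis
          using insert.hyps(2)[OF that] by simp
      qed
      then show ?thesis
        using assms(4)[of H x y] IH False e insert.prems(1) by auto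
    qed
  qed
qed

lemma conn_kruskal:
  assumes "H \<subseteq> complete_edges n" "inj_on w H"
  shows "conn (kruskal w H) = conn H"
  using assms
proof (induction rule: weight_order_induct)
  case (insert H x y)
  then show ?case
    by (cases "conn H x y") (simp_all add: kruskal_insert conn_insert_connected fun_eq_iff[of "conn (insert _ _)"] conn_insert)
qed simp

definition vertex_degree :: "nat \<Rightarrow> nat set set \<Rightarrow> nat \<Rightarrow> real" where
  "vertex_degree n F u = (\<Sum>v\<in>{..<n} - {u}. of_bool ({u, v} \<in> F))"

lemma degree_empty [simp]: "vertex_degree n {} u = 0"
  by (simp add: vertex_degree_def)

lemma degree_insert:
  assumes "{x, y} \<notin> F" "x < n" "y < n" "x \<noteq> y" "u < n"
  shows "vertex_degree n (insert {x, y} F) u = vertex_degree n F u + of_bool (u = x) + of_bool (u = y)"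
proof -
  have "vertex_degree n (insert {x, y} F) u - vertex_degree n F u
      = (\<Sum>v\<in>{..<n} - {u}. of_bool (u = x \<and> v = y) + of_bool (u = y \<and> v = x))"
    unfolding vertex_degree_def sum_subtractf[symmetric]
    by (intro sum.cong) (use assms in \<open>auto simp: doubleton_eq_iff insert_commute\<close>)
  also have "\<dots> = of_bool (u = x) + of_bool (u = y)"
    using assms by (auto simp: sum.distrib of_bool_conj)
  finally show ?thesis by simp
qed

lemma sum_degree:
  assumes "F \<subseteq> complete_edges n"
  shows "(\<Sum>u<n. vertex_degree n F u) = 2 * card F"
  unfolding vertex_degree_def sum_complete_edges[of "\<lambda>e. of_bool (e \<in> F)"] using assms
  by (simp add: of_bool_def sum.If_cases Int_absorb1)

text \<open>The forest spans each component by a tree. An accepted edge between components of sizes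
  a and b adds 2 to the degrees: 2 * (a - 1) + 2 * (b - 1) + 2 = 2 * (a + b - 1).\<close>

lemma sum_degree_kruskal_component:
  assumes "H \<subseteq> complete_edges n" "inj_on w H"
  shows "u < n \<Longrightarrow> (\<Sum>v\<in>component n H u. vertex_degree n (kruskal w H) v) = 2 * (real (csize n H u) - 1)"
  using assms
proof (induction arbitrary: u rule: weight_order_induct)
  case empty
  then show ?case by (simp add: csize_empty)
next
  case (insert H x y)
  show ?case
  proof (cases "conn H x y")
    case True
    then show ?thesis
      using insert.IH insert.prems insert.hyps by (simp add: kruskal_insert conn_insert_connected component_def)
  next
    case False
    have new: "{x, y} \<notin> kruskal w H"
      using insert.hyps(2) kruskal_subset by blast
    have deg: "(\<Sum>v\<in>C. vertex_degree n (insert {x, y} (kruskal w H)) v)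
        = (\<Sum>v\<in>C. vertex_degree n (kruskal w H) v) + of_bool (x \<in> C) + of_bool (y \<in> C)" if "C \<subseteq> {..<n}" for C
    proof -
      have "finite C"
        using that by (rule finite_subset) simp
      moreover have "(\<Sum>v\<in>C. vertex_degree n (insert {x, y} (kruskal w H)) v)
        = (\<Sum>v\<in>C. vertex_degree n (kruskal w H) v + of_bool (v = x) + of_bool (v = y))"
        using that insert.hyps new by (intro sum.cong) (auto simp: degree_insert)
      ultimately show ?thesis
        by (simp add: sum.distrib of_bool_def)
    qed
    show ?thesis
    proof (cases "conn H u x \<or> conn H u y")
      case True
      then have c: "component n (insert {x, y} H) u = component n H x \<union> component n H y"
        by (simp add: comp_insert[OF False])
      have "(\<Sum>v\<in>component n H x \<union> component n H y. vertex_degree n (kruskal w H) v)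
          = 2 * (real (csize n H x) - 1) + 2 * (real (csize n H y) - 1)"
        using comp_disjoint[OF False, of n] insert.IH insert.hyps by (simp add: sum.union_disjoint)
      moreover have "component n H x \<union> component n H y \<subseteq> {..<n}"
        using comp_subset by auto
      ultimately show ?thesis
        using False insert.hyps self_in_comp
        by (simp add: kruskal_insert deg c card_Un_disjoint comp_disjoint)
    next
      case F: False
      then have "component n (insert {x, y} H) u = component n H u" "x \<notin> component n H u" "y \<notin> component n H u"
        by (simp_all add: comp_insert[OF False]) (auto simp: component_def)
      then show ?thesis
        using False insert.hyps insert.IH insert.prems comp_subset[of n H u] by (simp add: kruskal_insert deg)
    qed
  qed
qed

text \<open>Since g is constant on components, \<open>comp_sum\<close> replaces degrees by their
  component mean 2 - 2 / a. The result no longer depends on the weights, although the forest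
  does.\<close>

lemma sum_degree_kruskal:
  fixes g :: "nat \<Rightarrow> real"
  assumes "H \<subseteq> complete_edges n" "inj_on w H"
  shows "(\<Sum>u<n. vertex_degree n (kruskal w H) u * g (csize n H u)) = (\<Sum>u<n. g (csize n H u) * (2 - 2 / csize n H u))"
proof -
  have arith: "2 * (c - 1) * G / c = G * (2 - 2 / c)" if "c \<noteq> 0" for c G :: real
    using that by (simp add: field_simps)
  have "(\<Sum>u<n. vertex_degree n (kruskal w H) u * g (csize n H u))
      = (\<Sum>u<n. (\<Sum>v\<in>component n H u. vertex_degree n (kruskal w H) v * g (csize n H v)) / csize n H u)"
    by (rule comp_sum[symmetric])
  also have "\<dots> = (\<Sum>u<n. g (csize n H u) * (2 - 2 / csize n H u))"
  proof (intro sum.cong refl)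
    fix u assume u: "u \<in> {..<n}"
    have "(\<Sum>v\<in>component n H u. vertex_degree n (kruskal w H) v * g (csize n H v))
        = (\<Sum>v\<in>component n H u. vertex_degree n (kruskal w H) v * g (csize n H u))"
      using comp_eq[of H u _ n] by (intro sum.cong) (auto simp: component_def)
    also have "\<dots> = 2 * (real (csize n H u) - 1) * g (csize n H u)"
      using sum_degree_kruskal_component[OF assms, of u] u by (simp add: sum_distrib_right[symmetric])
    finally have eq: "(\<Sum>v\<in>component n H u. vertex_degree n (kruskal w H) v * g (csize n H v))
        = 2 * (real (csize n H u) - 1) * g (csize n H u)" .
    have nz: "real (csize n H u) \<noteq> 0"
      using csize_pos[of u n H] u by (metis lessThan_iff less_irrefl of_nat_eq_0_iff)
    show "(\<Sum>v\<in>component n H u. vertex_degree n (kruskal w H) v * g (csize n H v)) / csize n H u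
        = g (csize n H u) * (2 - 2 / csize n H u)"
      unfolding eq by (rule arith[OF nz])
  qed
  finally show ?thesis .
qed

abbreviation comp_count :: "nat \<Rightarrow> nat set set \<Rightarrow> real" where
  "comp_count n \<equiv> comp_total n (\<lambda>_. 1)"

lemma card_kruskal:
  assumes "H \<subseteq> complete_edges n" "inj_on w H"
  shows "real (card (kruskal w H)) = real n - comp_count n H"
proof -
  have "2 * real (card (kruskal w H)) = (\<Sum>u<n. vertex_degree n (kruskal w H) u * 1)"
    using sum_degree[of "kruskal w H" n] kruskal_subset assms by fastforce
  also have "\<dots> = (\<Sum>u<n. 1 * (2 - 2 / csize n H u))"
    by (rule sum_degree_kruskal[OF assms])
  also have "\<dots> = 2 * (real n - comp_count n H)"
    by (simp add: sum_subtractf comp_total_def sum_distrib_left)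
  finally show ?thesis by simp
qed

lemma sum_nonconn_degree_kruskal:
  assumes "H \<subseteq> complete_edges n" "inj_on w H"
  shows "(\<Sum>(x, y)\<in>nonconn n H. vertex_degree n (kruskal w H) x)
    = 2 * real (card (nonconn n H)) - 2 * real n * (comp_count n H - 1)"
proof -
  have "(\<Sum>(x, y)\<in>nonconn n H. vertex_degree n (kruskal w H) x)
      = (\<Sum>x<n. (real n - csize n H x) * (2 - 2 / csize n H x))"
    unfolding sum_nonconn by (rule sum_degree_kruskal[OF assms])
  also have "\<dots> = (\<Sum>x<n. 2 * (1 * (real n - csize n H x)) - (2 * n * (1 / csize n H x) - 2))"
    by (intro sum.cong) (auto simp: algebra_simps diff_divide_distrib dest: csize_pos[of _ n H])
  also have "\<dots> = 2 * (\<Sum>x<n. 1 * (real n - csize n H x)) - 2 * real n * (comp_count n H - 1)"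
    unfolding sum_subtractf comp_total_def by (simp add: sum_distrib_left algebra_simps)
  also have "(\<Sum>x<n. 1 * (real n - csize n H x)) = card (nonconn n H)"
    unfolding sum_nonconn[symmetric] by (simp add: case_prod_beta)
  finally show ?thesis by simp
qed

text \<open>Starting from n components, an edge removes at most one.\<close>

lemma comp_count_ge:
  assumes "H \<subseteq> complete_edges n"
  shows "comp_count n H \<ge> real n - card H"
proof -
  have "finite H"
    using assms by (rule finite_subset) simp
  then show ?thesis
    using assms
  proof (induction H rule: finite_induct)
    case (insert e H)
    obtain x y where e: "e = {x, y}" "x < y" "y < n"
      using insert.prems by (auto elim: complete_edgesE)
    then show ?case
      using insert by (cases "conn H x y") (auto simp: comp_total_insert comp_total_insert_connected)
  qed (simp add: comp_total_empty)
qed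

text \<open>Each of the n summands is at least 1 / n, so the total 1 forces every component to have
  n vertices.\<close>

lemma comp_count_eq_1_iff:
  assumes "n > 0"
  shows "comp_count n H = 1 \<longleftrightarrow> edges_connect {..<n} H"
proof -
  have 1: "1 / real (csize n H v) - 1 / n \<ge> 0" if "v < n" for v
    using csize_le[of n H v] csize_pos[OF that, of H] by (simp add: frac_le)
  have "comp_count n H = 1 \<longleftrightarrow> (\<Sum>v<n. 1 / real (csize n H v) - 1 / n) = 0"
    using assms by (simp add: comp_total_def sum_subtractf)
  also have "\<dots> \<longleftrightarrow> (\<forall>v<n. 1 / real (csize n H v) - 1 / n = 0)"
    using 1 by (subst sum_nonneg_eq_0_iff) auto
  also have "\<dots> \<longleftrightarrow> (\<forall>v<n. csize n H v = n)"
    using csize_pos[of _ n H] assms by (auto simp: field_simps)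
  also have "\<dots> \<longleftrightarrow> (\<forall>v<n. component n H v = {..<n})"
    using card_subset_eq[OF finite_lessThan comp_subset[of n H]] by auto
  also have "\<dots> \<longleftrightarrow> edges_connect {..<n} H"
    by (auto simp: component_def edges_connect_def conn_def)
  finally show ?thesis .
qed

section \<open>Cycles, bridges and the edge count of spanning trees\<close>

lemma conn_distinct_path:
  assumes "conn H u v"
  shows "\<exists>p. p \<noteq> [] \<and> hd p = u \<and> last p = v \<and> distinct p \<and> successively (\<lambda>a b. {a, b} \<in> H) p"
  using assms
proof (induction rule: conn_induct)
  case refl
  show ?case by (rule exI[of _ "[u]"]) simp
next
  case (step y z)
  then obtain p where p: "p \<noteq> []" "hd p = u" "last p = y" "distinct p" "successively (\<lambda>a b. {a, b} \<in> H) p"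
    by auto
  show ?case
  proof (cases "z \<in> set p")
    case True
    then obtain qs rs where q: "p = qs @ z # rs"
      by (meson split_list)
    have "hd (qs @ [z]) = u"
      using p(2) q by (cases qs) auto
    then show ?thesis
      using p(4,5) by (intro exI[of _ "qs @ [z]"]) (auto simp: q successively_append_iff)
  next
    case False
    then show ?thesis
      using p step by (intro exI[of _ "p @ [z]"]) (auto simp: successively_append_iff)
  qed
qed

text \<open>Acyclicity in a form that survives removing an edge, hence fit for induction on the edge
  set; it mediates between cycles as vertex lists and edge counts.\<close>

definition all_bridges :: "nat set set \<Rightarrow> bool" where
  "all_bridges F \<longleftrightarrow> (\<forall>x y. {x, y} \<in> F \<longrightarrow> \<not> conn (F - {{x, y}}) x y)"

text \<open>A simple path avoiding the edge closes up with it. It has at least three vertices: one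
  would mean x = y, and two would use the deleted edge itself.\<close>

lemma cycle_of_nonbridge:
  assumes "{x, y} \<in> F" "conn (F - {{x, y}}) x y" "x \<noteq> y"
  shows "\<exists>c. is_cycle F c"
proof -
  obtain p where p: "p \<noteq> []" "hd p = x" "last p = y" "distinct p"
      "successively (\<lambda>a b. {a, b} \<in> F - {{x, y}}) p"
    using conn_distinct_path[OF assms(2)] by (elim exE conjE) (rule that)
  have e: "{p ! i, p ! Suc i} \<in> F - {{x, y}}" if "Suc i < length p" for i
    using p(5) that unfolding successively_conv_nth by (elim allE impE)
  have hd: "p ! 0 = x" and last: "p ! (length p - 1) = y"
    using p by (simp_all add: hd_conv_nth last_conv_nth)
  have "length p \<noteq> 1"
    using hd last assms(3) by auto
  moreover have "length p \<noteq> 2"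
    using hd last e[of 0] by auto
  moreover have "length p \<noteq> 0"
    using p(1) by simp
  ultimately have len: "length p \<ge> 3"
    by linarith
  have "{p ! i, p ! (Suc i mod length p)} \<in> F" if "i < length p" for i
  proof (cases "Suc i < length p")
    case True
    then show ?thesis
      using e[of i] by simp
  next
    case False
    then have i: "i = length p - 1" "Suc i = length p"
      using that by auto
    then have "{p ! i, p ! (Suc i mod length p)} = {y, x}"
      using hd last by simp
    then show ?thesis
      using assms(1) by (simp add: insert_commute)
  qed
  then show ?thesis
    using len p(4) by (auto simp: is_cycle_def)
qed

text \<open>Without its first edge a cycle is still a path from \<open>c ! 1\<close> round to
  \<open>c ! 0\<close>; distinctness and length at least 3 keep the remaining edges different from
  the deleted one.\<close>

lemma no_cycle_of_all_bridges:
  assumes "all_bridges F"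
  shows "\<not> is_cycle F c"
proof
  assume "is_cycle F c"
  then have len: "length c \<ge> 3" and dis: "distinct c"
    and e: "\<And>i. i < length c \<Longrightarrow> {c ! i, c ! (Suc i mod length c)} \<in> F"
    by (auto simp: is_cycle_def)
  define F' where "F' = F - {{c ! 0, c ! 1}}"
  have ne: "c \<noteq> []"
    using len by auto
  have idx: "c ! i = c ! j \<longleftrightarrow> i = j" if "i < length c" "j < length c" for i j
    using that dis by (simp add: nth_eq_iff_index_eq)
  have "{c ! 0, c ! 1} \<in> F"
  proof -
    have "Suc 0 mod length c = 1"
      using len by (simp add: mod_less)
    moreover have "{c ! 0, c ! (Suc 0 mod length c)} \<in> F"
      by (rule e) (use len in linarith)
    ultimately show ?thesis by simp
  qed
  have edge: "{c ! i, c ! Suc i} \<in> F'" if "1 \<le> i" "Suc i < length c" for i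
    using e[of i] that len ne idx[of i 0] idx[of "Suc i" 0] by (auto simp: F'_def doubleton_eq_iff)
  have "{c ! (length c - 1), c ! 0} \<in> F'"
    using e[of "length c - 1"] len idx[of "length c - 1" 0] idx[of "length c - 1" 1] ne
    by (auto simp: F'_def doubleton_eq_iff)
  moreover have "conn F' (c ! 1) (c ! i)" if "1 \<le> i" "i < length c" for i
    using that
  proof (induction i rule: dec_induct)
    case (step i)
    then show ?case
      using conn_trans[OF _ conn_edge[OF edge[of i]], of "c ! 1"] by auto
  qed simp
  ultimately have "conn F' (c ! 1) (c ! 0)"
    using conn_trans[OF _ conn_edge, of F' "c ! 1" "c ! (length c - 1)" "c ! 0"] len by auto
  then have "conn F' (c ! 0) (c ! 1)"
    by (rule conn_sym)
  then show False
    using assms \<open>{c ! 0, c ! 1} \<in> F\<close> unfolding all_bridges_def F'_def by (elim allE impE notE)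
qed

lemma card_of_all_bridges:
  assumes "F \<subseteq> complete_edges n" "all_bridges F"
  shows "real (card F) = real n - comp_count n F"
proof -
  have "finite F"
    using assms(1) by (rule finite_subset) simp
  then show ?thesis
    using assms
  proof (induction F rule: finite_induct)
    case (insert e F)
    obtain x y where e: "e = {x, y}" "x < y" "y < n"
      using insert.prems by (auto elim: complete_edgesE)
    have "\<not> conn F x y"
      using insert.prems(2) insert.hyps(2) e by (auto simp: all_bridges_def)
    moreover have "all_bridges F"
      unfolding all_bridges_def
    proof (intro allI impI)
      fix a b assume ab: "{a, b} \<in> F"
      then have "\<not> conn (insert e F - {{a, b}}) a b"
        using insert.prems(2) by (auto simp: all_bridges_def)
      then show "\<not> conn (F - {{a, b}}) a b"
        using conn_mono[of "F - {{a, b}}" "insert e F - {{a, b}}"] by auto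
    qed
    ultimately show ?case
      using insert e by (simp add: comp_total_insert)
  qed (simp add: comp_total_empty)
qed

text \<open>Reduces spanning trees to counting. For the converse, deleting an edge that is no bridge
  would leave a single component with n - 2 edges, against \<open>comp_count_ge\<close>.\<close>

lemma spanning_tree_iff:
  assumes "n > 0"
  shows "spanning_tree n F \<longleftrightarrow> F \<subseteq> complete_edges n \<and> comp_count n F = 1 \<and> card F = n - 1"
proof
  assume *: "spanning_tree n F"
  then have F: "F \<subseteq> complete_edges n" and c: "comp_count n F = 1"
    by (auto simp: spanning_tree_def comp_count_eq_1_iff[OF assms])
  have "all_bridges F"
    unfolding all_bridges_def
  proof (intro allI impI notI)
    fix x y assume "{x, y} \<in> F" "conn (F - {{x, y}}) x y"
    moreover from this have "x \<noteq> y"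
      using F in_complete_edges[of x y n] by blast
    ultimately show False
      using cycle_of_nonbridge[of x y F] * by (auto simp: spanning_tree_def)
  qed
  then show "F \<subseteq> complete_edges n \<and> comp_count n F = 1 \<and> card F = n - 1"
    using card_of_all_bridges[OF F] F c by simp
next
  assume *: "F \<subseteq> complete_edges n \<and> comp_count n F = 1 \<and> card F = n - 1"
  have "all_bridges F"
    unfolding all_bridges_def
  proof (intro allI impI notI)
    fix x y assume xy: "{x, y} \<in> F" "conn (F - {{x, y}}) x y"
    have "finite F"
      using * by (auto intro: finite_subset)
    then have "card (F - {{x, y}}) < card F"
      using xy by (intro psubset_card_mono) auto
    moreover have "comp_count n F = comp_count n (F - {{x, y}})"
      using comp_total_insert_connected[OF xy(2)] xy(1) by (metis insert_Diff)
    moreover have "comp_count n (F - {{x, y}}) \<ge> real n - card (F - {{x, y}})"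
      by (rule comp_count_ge) (use * in auto)
    ultimately show False
      using * assms by (simp add: of_nat_diff)
  qed
  then show "spanning_tree n F"
    using * no_cycle_of_all_bridges by (auto simp: spanning_tree_def comp_count_eq_1_iff[OF assms])
qed

lemma kruskal_spanning_tree:
  assumes "n > 0" "inj_on w (complete_edges n)"
  shows "spanning_tree n (kruskal w (complete_edges n))"
proof -
  have "comp_count n (kruskal w (complete_edges n)) = comp_count n (complete_edges n)"
    by (simp add: comp_total_def component_def conn_kruskal[OF order_refl assms(2)])
  then show ?thesis
    using card_kruskal[OF order_refl assms(2)] assms(1) kruskal_subset
    by (simp add: spanning_tree_iff comp_total_complete)
qed

text \<open>The exchange argument: removing e splits the tree in two. As e fails the Kruskal test, a
  path of lighter edges joins its endpoints, and one of those edges crosses the split and can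
  replace e.\<close>

lemma improve_spanning_tree:
  assumes "n > 0" "spanning_tree n F" "e \<in> F" "e \<notin> kruskal w (complete_edges n)"
  shows "\<exists>F'. spanning_tree n F' \<and> sum w F' < sum w F"
proof -
  have F: "F \<subseteq> complete_edges n" "comp_count n F = 1" "card F = n - 1"
    using assms(1,2) by (auto simp: spanning_tree_iff)
  have fin: "finite F"
    using F(1) by (rule finite_subset) simp
  obtain x y where e: "e = {x, y}" "x < y" "y < n"
    using F(1) assms(3) complete_edgesE[of e n] by blast
  define F0 where "F0 = F - {e}"
  have Fe: "F = insert {x, y} F0" "{x, y} \<notin> F0" "F0 \<subseteq> complete_edges n" "finite F0"
    using assms(3) e F fin by (auto simp: F0_def)
  have card: "card F = Suc (card F0)"
    using Fe by (metis card_insert_disjoint)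
  have nc: "\<not> conn F0 x y"
  proof
    assume "conn F0 x y"
    then have "comp_count n F0 = 1"
      using F(2) comp_total_insert_connected[of F0 x y] Fe(1) by simp
    then show False
      using comp_count_ge[OF Fe(3)] card F(3) assms(1) by simp
  qed
  have lighter: "conn {f \<in> complete_edges n. w f < w e} x y"
    using assms(3,4) e F(1) doubleton_in_kruskal[of x y w "complete_edges n"] by auto
  have "\<exists>a b. {a, b} \<in> complete_edges n \<and> w {a, b} < w e \<and> \<not> conn F0 a b"
  proof (rule ccontr)
    assume *: "\<not> ?thesis"
    from lighter have "conn F0 x y"
    proof (induction rule: conn_induct)
      case (step b c)
      then have "conn F0 b c"
        using * by blast
      then show ?case
        using step conn_trans by metis
    qed simp
    then show False
      using nc by simp
  qed
  then obtain a b where ab: "{a, b} \<in> complete_edges n" "w {a, b} < w e" "\<not> conn F0 a b"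
    by auto
  have new: "{a, b} \<notin> F0"
    using ab(3) conn_edge[of a b F0] by auto
  have "comp_count n F0 = 2"
    using F(2) e nc by (simp add: Fe(1) comp_total_insert)
  then have "comp_count n (insert {a, b} F0) = 1"
    using ab by (simp add: comp_total_insert)
  then have "spanning_tree n (insert {a, b} F0)"
    using ab Fe new card F(3) assms(1) by (auto simp: spanning_tree_iff)
  moreover have "sum w (insert {a, b} F0) < sum w F"
    using new Fe(2,4) ab(2) by (simp add: Fe(1) e)
  ultimately show ?thesis by auto
qed

lemma spanning_trees_finite: "finite {F. spanning_tree n F}"
  by (rule finite_subset[of _ "Pow (complete_edges n)"]) (auto simp: spanning_tree_def)

text \<open>By exchange every minimum lies inside the Kruskal forest, and equal cardinality makes
  them equal. Some minimum exists by finiteness, so the Kruskal forest is it.\<close>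

lemma is_mst_iff:
  assumes "n > 0" "inj_on w (complete_edges n)"
  shows "is_mst n w F \<longleftrightarrow> F = kruskal w (complete_edges n)"
proof -
  have *: "F = kruskal w (complete_edges n)" if "is_mst n w F" for F
  proof -
    have F: "spanning_tree n F" "\<And>F'. spanning_tree n F' \<Longrightarrow> \<not> sum w F' < sum w F"
      using that by (auto simp: is_mst_def is_arg_min_def)
    have "F \<subseteq> kruskal w (complete_edges n)"
      using improve_spanning_tree[OF assms(1) F(1)] F(2) by blast
    moreover have "card F = card (kruskal w (complete_edges n))"
      using F(1) kruskal_spanning_tree[OF assms] by (simp add: spanning_tree_iff[OF assms(1)])
    moreover have "finite (kruskal w (complete_edges n))"
      using kruskal_subset by (rule finite_subset) simp
    ultimately show ?thesis
      by (rule card_subset_eq[rotated])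
  qed
  obtain F0 where "is_mst n w F0"
    using ex_is_arg_min_if_finite[OF spanning_trees_finite[of n], of "sum w"] kruskal_spanning_tree[OF assms]
    unfolding is_mst_def by auto
  then show ?thesis
    using * by metis
qed

lemma mst_eq_kruskal:
  assumes "n > 0" "inj_on w (complete_edges n)"
  shows "mst n w = kruskal w (complete_edges n)"
  by (simp add: mst_def is_mst_iff[OF assms])

section \<open>Independent exponential weights\<close>

definition exp1 :: "real measure" where
  "exp1 = density lborel (exponential_density 1)"

lemma sets_exp1 [simp, measurable_cong]: "sets exp1 = sets borel"
  by (simp add: exp1_def)

lemma space_exp1 [simp]: "space exp1 = UNIV"
  by (simp add: exp1_def)

lemma prob_space_exp1: "prob_space exp1"
  unfolding exp1_def by (rule prob_space_exponential_density) simp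

lemma distributed_exp1: "distributed exp1 lborel (\<lambda>x. x) (exponential_density 1)"
  by (auto simp: distributed_def exp1_def distr_id2)

lemma nn_integral_exp1:
  fixes f :: "real \<Rightarrow> ennreal"
  assumes "f \<in> borel_measurable borel"
  shows "(\<integral>\<^sup>+ y. f y \<partial>exp1) = (\<integral>\<^sup>+ y. ennreal (exponential_density 1 y) * f y \<partial>lborel)"
  using assms by (simp add: exp1_def nn_integral_density)

lemma emeasure_exp1_singleton: "emeasure exp1 {a} = 0"
proof -
  have "emeasure exp1 {a} = (\<integral>\<^sup>+ y. indicator {a} y \<partial>exp1)"
    by simp
  also have "\<dots> = (\<integral>\<^sup>+ y. ennreal (exponential_density 1 y) * indicator {a} y \<partial>lborel)"
    by (rule nn_integral_exp1) simp
  also have "\<dots> = 0"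
  proof -
    have "AE y in lborel. ennreal (exponential_density 1 y) * indicator {a} y = 0"
      using AE_lborel_singleton[of a] by eventually_elim simp
    then show ?thesis
      unfolding nn_integral_cong_AE[OF \<open>AE y in lborel. _\<close>] by simp
  qed
  finally show ?thesis .
qed

lemma emeasure_exp1_atLeast:
  assumes "t \<ge> 0"
  shows "emeasure exp1 {t..} = exp (- t)"
proof -
  interpret prob_space exp1 by (rule prob_space_exp1)
  have "emeasure exp1 {t<..} = exp (- t)"
    using exponential_distributedD_gt[OF distributed_exp1 assms] by (simp add: emeasure_eq_measure greaterThan_def)
  moreover have "emeasure exp1 {t..} = emeasure exp1 ({t} \<union> {t<..})"
    by (rule arg_cong[where f = "emeasure exp1"]) auto
  moreover have "\<dots> = emeasure exp1 {t} + emeasure exp1 {t<..}"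
    by (rule plus_emeasure[symmetric]) auto
  ultimately show ?thesis
    by (simp add: emeasure_exp1_singleton)
qed

lemma emeasure_exp1_lessThan:
  assumes "t \<ge> 0"
  shows "emeasure exp1 {..<t} = ennreal (1 - exp (- t))"
proof -
  interpret prob_space exp1 by (rule prob_space_exp1)
  have "prob (space exp1 - {t..}) = 1 - prob {t..}"
    by (rule prob_compl) simp
  moreover have "space exp1 - {t..} = {..<t}"
    by auto
  moreover have "prob {t..} = exp (- t)"
    using emeasure_exp1_atLeast[OF assms] by (simp add: emeasure_eq_measure)
  ultimately show ?thesis
    by (simp add: emeasure_eq_measure)
qed

text \<open>With u = exp (- t) this is the Beta integral B(h + 1, m + 1). The induction multiplies
  the integrand by 1 = (1 - u) + u, which raises either h or m.\<close>

lemma beta_exp_integral: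
  "(\<integral>\<^sup>+ t. ennreal ((1 - exp (- t)) ^ h * exp (- t) ^ Suc m) * indicator {0..} t \<partial>lborel)
    = ennreal (fact h * fact m / fact (Suc (m + h)))"
proof (induction h arbitrary: m)
  case 0
  have exp_pow: "exp (- t) ^ Suc m = exp (- (Suc m * t))" for t :: real
    by (simp add: exp_of_nat_mult[symmetric] algebra_simps flip: exp_add)
  have "((\<lambda>t::real. - exp (- (Suc m * t)) / Suc m) \<longlongrightarrow> 0) at_top"
    by real_asymp
  moreover have "((\<lambda>t::real. - exp (- (Suc m * t)) / Suc m) has_real_derivative exp (- (Suc m * t))) (at t)" for t :: real
    by (rule derivative_eq_intros refl | simp)+ (simp add: field_simps)
  ultimately have "(\<integral>\<^sup>+ t. ennreal (exp (- (Suc m * t))) * indicator {0..} t \<partial>lborel) = ennreal (0 - - exp (- (real (Suc m) * 0)) / real (Suc m))"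
    by (intro nn_integral_FTC_atLeast[where F = "\<lambda>t. - exp (- (Suc m * t)) / Suc m"]) auto
  then show ?case
    unfolding exp_pow by (simp add: divide_simps)
next
  case (Suc h)
  let ?A = "\<lambda>h m. \<integral>\<^sup>+ t. ennreal ((1 - exp (- t)) ^ h * exp (- t) ^ Suc m) * indicator {0..} t \<partial>lborel"
  let ?b = "\<lambda>h m. fact h * fact m / fact (Suc (m + h)) :: real"
  have "ennreal ((1 - exp (- t)) ^ h * exp (- t) ^ Suc m) * indicator {0..} t
     = ennreal ((1 - exp (- t)) ^ Suc h * exp (- t) ^ Suc m) * indicator {0..} t
      + ennreal ((1 - exp (- t)) ^ h * exp (- t) ^ Suc (Suc m)) * indicator {0..} t" for t :: real
  proof (cases "t \<ge> 0")
    case True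
    have "(1 - exp (- t)) ^ h * exp (- t) ^ Suc m
       = (1 - exp (- t)) ^ Suc h * exp (- t) ^ Suc m + (1 - exp (- t)) ^ h * exp (- t) ^ Suc (Suc m)"
      by (simp add: algebra_simps)
    moreover have "(1 - exp (- t)) ^ Suc h * exp (- t) ^ Suc m \<ge> 0" "(1 - exp (- t)) ^ h * exp (- t) ^ Suc (Suc m) \<ge> 0"
      using True by (intro mult_nonneg_nonneg zero_le_power; simp)+
    ultimately show ?thesis
      using True by (simp only: ennreal_plus indicator_simps atLeast_iff mult_1_right)
  qed auto
  then have "?A h m = ?A (Suc h) m + ?A h (Suc m)"
    by (subst nn_integral_add[symmetric]) auto
  then have "?A (Suc h) m = ennreal (?b h m) - ennreal (?b h (Suc m))"
    by (simp only: Suc.IH) (simp add: ennreal_add_diff_cancel_right)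
  also have "\<dots> = ennreal (?b h m - ?b h (Suc m))"
    by (rule ennreal_minus) simp
  also have "?b h m - ?b h (Suc m) = ?b (Suc h) m"
    by (simp add: divide_simps) (simp add: algebra_simps)
  finally show ?case .
qed

section \<open>The product law of the weights and the graph of light edges\<close>

definition weight_law :: "nat \<Rightarrow> (nat set \<Rightarrow> real) measure" where
  "weight_law n = (\<Pi>\<^sub>M e\<in>complete_edges n. exp1)"

lemma prob_space_weight_law: "prob_space (weight_law n)"
  unfolding weight_law_def by (intro prob_space_PiM prob_space_exp1)

lemma product_sigma_finite_exp1: "product_sigma_finite (\<lambda>_. exp1)"
  unfolding product_sigma_finite_def
  by (intro allI prob_space_imp_sigma_finite prob_space_exp1)

lemma measurable_weight [measurable]:
  "e \<in> complete_edges n \<Longrightarrow> (\<lambda>w. w e) \<in> borel_measurable (weight_law n)"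
  using measurable_component_singleton[of e "complete_edges n" "\<lambda>_. exp1"]
  unfolding weight_law_def by (simp add: measurable_cong_sets[OF refl sets_exp1])

definition edges_below :: "nat \<Rightarrow> (nat set \<Rightarrow> real) \<Rightarrow> real \<Rightarrow> nat set set" where
  "edges_below n w t = {f \<in> complete_edges n. w f < t}"

lemma edges_below_subset: "edges_below n w t \<subseteq> complete_edges n"
  by (auto simp: edges_below_def)

lemma measurable_set_valued:
  assumes "finite E" "\<And>x. x \<in> space M \<Longrightarrow> S x \<subseteq> E" "\<And>f. f \<in> E \<Longrightarrow> Measurable.pred M (\<lambda>x. f \<in> S x)"
  shows "S \<in> measurable M (count_space (Pow E))"
proof (subst measurable_count_space_eq2)
  show "finite (Pow E)"
    using assms(1) by simp
  show "S \<in> space M \<rightarrow> Pow E \<and> (\<forall>A\<in>Pow E. S -` {A} \<inter> space M \<in> sets M)"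
  proof (intro conjI ballI)
    show "S \<in> space M \<rightarrow> Pow E"
      using assms(2) by auto
    fix A assume A: "A \<in> Pow E"
    have "S -` {A} \<inter> space M = {x \<in> space M. \<forall>f\<in>E. f \<in> S x \<longleftrightarrow> f \<in> A}"
      using A assms(2) by blast
    also have "\<dots> \<in> sets M"
      using assms(1,3) by measurable
    finally show "S -` {A} \<inter> space M \<in> sets M" .
  qed
qed

lemma measurable_edges_below:
  "(\<lambda>(t, w). edges_below n w t) \<in> measurable (borel \<Otimes>\<^sub>M weight_law n) (count_space (Pow (complete_edges n)))"
proof (rule measurable_set_valued)
  show "Measurable.pred (borel \<Otimes>\<^sub>M weight_law n) (\<lambda>p. f \<in> (case p of (t, w) \<Rightarrow> edges_below n w t))"
    if f: "f \<in> complete_edges n" for f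
  proof -
    have "(\<lambda>p. snd p f) \<in> borel_measurable (borel \<Otimes>\<^sub>M weight_law n)"
      using measurable_compose[OF measurable_snd measurable_weight[OF f]] .
    then show ?thesis
      using f by (simp add: edges_below_def case_prod_beta)
  qed
qed (auto simp: edges_below_def)

lemma emeasure_edges_below:
  assumes "t \<ge> 0" "H \<subseteq> complete_edges n"
  shows "emeasure (weight_law n) {w \<in> space (weight_law n). edges_below n w t = H}
    = ennreal ((1 - exp (- t)) ^ card H * exp (- t) ^ (card (complete_edges n) - card H))"
proof -
  let ?E = "complete_edges n"
  interpret product_sigma_finite "\<lambda>_. exp1" by (rule product_sigma_finite_exp1)
  have "{w \<in> space (weight_law n). edges_below n w t = H} = (\<Pi>\<^sub>E f\<in>?E. if f \<in> H then {..<t} else {t..})"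
  proof (intro set_eqI iffI)
    fix w assume "w \<in> {w \<in> space (weight_law n). edges_below n w t = H}"
    then show "w \<in> (\<Pi>\<^sub>E f\<in>?E. if f \<in> H then {..<t} else {t..})"
      by (auto simp: weight_law_def space_PiM PiE_iff edges_below_def not_less)
  next
    fix w assume w: "w \<in> (\<Pi>\<^sub>E f\<in>?E. if f \<in> H then {..<t} else {t..})"
    have "w f < t \<longleftrightarrow> f \<in> H" if "f \<in> ?E" for f
      using PiE_mem[OF w that] by (auto split: if_splits)
    then show "w \<in> {w \<in> space (weight_law n). edges_below n w t = H}"
      using w assms(2) by (auto simp: weight_law_def space_PiM PiE_iff edges_below_def)
  qed
  then have "emeasure (weight_law n) {w \<in> space (weight_law n). edges_below n w t = H}
     = (\<Prod>f\<in>?E. emeasure exp1 (if f \<in> H then {..<t} else {t..}))"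
    unfolding weight_law_def by (simp add: emeasure_PiM)
  also have "\<dots> = (\<Prod>f\<in>?E. ennreal (if f \<in> H then 1 - exp (- t) else exp (- t)))"
    using assms(1) by (intro prod.cong) (auto simp: emeasure_exp1_lessThan emeasure_exp1_atLeast)
  also have "\<dots> = ennreal (\<Prod>f\<in>?E. if f \<in> H then 1 - exp (- t) else exp (- t))"
    using assms(1) by (intro prod_ennreal) auto
  also have "(\<Prod>f\<in>?E. if f \<in> H then 1 - exp (- t) else exp (- t))
      = (1 - exp (- t)) ^ card H * exp (- t) ^ (card ?E - card H)"
    using assms(2) finite_subset[OF assms(2)]
    by (simp add: prod.If_cases Int_absorb1 Diff_eq[symmetric] card_Diff_subset)
  finally show ?thesis .
qed

text \<open>Justifies the weights in \<open>avg\<close>: the expected time at a graph with h < N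
  edges is the Beta value h! (N - h - 1)! / N! = 1 / ((N - h) (N choose h)). The complete graph
  persists for ever, so \<Phi> has to vanish there.\<close>

lemma nn_integral_edges_below:
  assumes "\<And>H. H \<subseteq> complete_edges n \<Longrightarrow> \<Phi> H \<ge> 0" "\<Phi> (complete_edges n) = 0"
  shows "(\<integral>\<^sup>+ t. (\<integral>\<^sup>+ w. ennreal (\<Phi> (edges_below n w t)) \<partial>weight_law n) * indicator {0..} t \<partial>lborel) = ennreal (avg n \<Phi>)"
proof -
  let ?E = "complete_edges n"
  let ?N = "card ?E"
  let ?p = "\<lambda>H t. (1 - exp (- t)) ^ card H * exp (- t) ^ (?N - card H) :: real"
  have inner: "(\<integral>\<^sup>+ w. ennreal (\<Phi> (edges_below n w t)) \<partial>weight_law n) = (\<Sum>H\<in>Pow ?E. ennreal (\<Phi> H) * ennreal (?p H t))"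
    if "t \<ge> 0" for t
  proof -
    have [measurable]: "{w \<in> space (weight_law n). edges_below n w t = H} \<in> sets (weight_law n)" if "H \<in> Pow ?E" for H
      using measurable_sets[OF measurable_Pair2[OF measurable_edges_below, of t], of "{H}"] that
      by (simp add: vimage_def Int_def conj_commute)
    have "(\<integral>\<^sup>+ w. ennreal (\<Phi> (edges_below n w t)) \<partial>weight_law n)
        = (\<integral>\<^sup>+ w. (\<Sum>H\<in>Pow ?E. ennreal (\<Phi> H) * indicator {w \<in> space (weight_law n). edges_below n w t = H} w) \<partial>weight_law n)"
    proof (rule nn_integral_cong)
      fix w assume w: "w \<in> space (weight_law n)"
      have "(\<Sum>H\<in>Pow ?E. ennreal (\<Phi> H) * indicator {w \<in> space (weight_law n). edges_below n w t = H} w)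
          = (\<Sum>H\<in>Pow ?E. if H = edges_below n w t then ennreal (\<Phi> H) else 0)"
        using w by (intro sum.cong) (auto split: split_indicator)
      then show "ennreal (\<Phi> (edges_below n w t)) = (\<Sum>H\<in>Pow ?E. ennreal (\<Phi> H) * indicator {w \<in> space (weight_law n). edges_below n w t = H} w)"
        using edges_below_subset by (simp add: sum.delta)
    qed
    also have "\<dots> = (\<Sum>H\<in>Pow ?E. ennreal (\<Phi> H) * emeasure (weight_law n) {w \<in> space (weight_law n). edges_below n w t = H})"
      by (subst nn_integral_sum) (auto simp: nn_integral_cmult)
    also have "\<dots> = (\<Sum>H\<in>Pow ?E. ennreal (\<Phi> H) * ennreal (?p H t))"
      using that by (intro sum.cong) (auto simp: emeasure_edges_below)
    finally show ?thesis .
  qed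
  have "(\<integral>\<^sup>+ t. (\<integral>\<^sup>+ w. ennreal (\<Phi> (edges_below n w t)) \<partial>weight_law n) * indicator {0..} t \<partial>lborel)
      = (\<integral>\<^sup>+ t. (\<Sum>H\<in>Pow ?E. ennreal (\<Phi> H) * (ennreal (?p H t) * indicator {0..} t)) \<partial>lborel)"
    by (intro nn_integral_cong) (auto simp: inner sum_distrib_right mult.assoc split: split_indicator)
  also have "\<dots> = (\<Sum>H\<in>Pow ?E. ennreal (\<Phi> H) * (\<integral>\<^sup>+ t. ennreal (?p H t) * indicator {0..} t \<partial>lborel))"
    by (subst nn_integral_sum) (auto simp: nn_integral_cmult)
  also have "\<dots> = (\<Sum>H\<in>Pow ?E. ennreal (\<Phi> H / (real (?N - card H) * real (?N choose card H))))"
  proof (intro sum.cong refl)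
    fix H assume H: "H \<in> Pow ?E"
    show "ennreal (\<Phi> H) * (\<integral>\<^sup>+ t. ennreal (?p H t) * indicator {0..} t \<partial>lborel)
        = ennreal (\<Phi> H / (real (?N - card H) * real (?N choose card H)))"
    proof (cases "H = ?E")
      case True
      then show ?thesis
        using assms(2) by simp
    next
      case False
      then have "card H < ?N"
        using H by (intro psubset_card_mono) auto
      then obtain m where m: "?N = Suc (m + card H)"
        using less_imp_Suc_add by (metis add.commute)
      then have d: "?N - card H = Suc m"
        by simp
      have "(\<integral>\<^sup>+ t. ennreal (?p H t) * indicator {0..} t \<partial>lborel)
          = ennreal (fact (card H) * fact m / fact (Suc (m + card H)))"
        unfolding d by (rule beta_exp_integral)
      also have "fact (card H) * fact m / fact (Suc (m + card H)) = 1 / (real (Suc m) * real (?N choose card H))"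
        using binomial_fact[of "card H" ?N, where 'a = real] \<open>card H < ?N\<close> unfolding d unfolding m by simp
      finally show ?thesis
        unfolding d using H assms(1) by (simp add: ennreal_mult[symmetric])
    qed
  qed
  also have "\<dots> = ennreal (avg n \<Phi>)"
    unfolding avg_def using assms(1) by (intro sum_ennreal) auto
  finally show ?thesis .
qed

lemma measurable_edges_below_comp [measurable (raw)]:
  assumes "t \<in> borel_measurable M" "w \<in> measurable M (weight_law n)"
  shows "Measurable.pred M (\<lambda>x. Q (edges_below n (w x) (t x)))"
    and "(\<lambda>x. (g (edges_below n (w x) (t x)) :: real)) \<in> borel_measurable M"
proof -
  have "(\<lambda>x. edges_below n (w x) (t x)) \<in> measurable M (count_space (Pow (complete_edges n)))"
    using measurable_compose[OF measurable_Pair[OF assms] measurable_edges_below] by simp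
  then show "Measurable.pred M (\<lambda>x. Q (edges_below n (w x) (t x)))"
    and "(\<lambda>x. (g (edges_below n (w x) (t x)) :: real)) \<in> borel_measurable M"
    by (auto intro: measurable_compose[where g = Q] measurable_compose[where g = g])
qed

lemma unlinked_in_kruskal:
  "e \<in> kruskal w (complete_edges n) \<longleftrightarrow> e \<in> complete_edges n \<and> unlinked (edges_below n w (w e)) e"
  by (simp add: kruskal_def edges_below_def)

lemma measurable_in_kruskal:
  "Measurable.pred (weight_law n) (\<lambda>w. e \<in> kruskal w (complete_edges n))"
proof (cases "e \<in> complete_edges n")
  case True
  then show ?thesis
    unfolding unlinked_in_kruskal
    using measurable_edges_below_comp(1)[OF measurable_weight[OF True] measurable_ident_sets[OF refl]] by simp
qed (simp add: unlinked_in_kruskal)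

lemma kruskal_edges_below:
  "kruskal w (edges_below n w t) = {e \<in> kruskal w (complete_edges n). w e < t}"
  unfolding edges_below_def by (rule kruskal_below)

lemma nn_integral_weight_law_split:
  assumes "e \<in> complete_edges n" "f \<in> borel_measurable (weight_law n)"
  shows "(\<integral>\<^sup>+ w. f w \<partial>weight_law n)
    = (\<integral>\<^sup>+ x. (\<integral>\<^sup>+ y. f (x(e := y)) \<partial>exp1) \<partial>(\<Pi>\<^sub>M e\<in>complete_edges n - {e}. exp1))"
proof -
  interpret product_sigma_finite "\<lambda>_. exp1" by (rule product_sigma_finite_exp1)
  have "insert e (complete_edges n - {e}) = complete_edges n"
    using assms(1) by auto
  then show ?thesis
    using product_nn_integral_insert[of "complete_edges n - {e}" e f] assms(2)
    by (simp add: weight_law_def)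
qed

lemma measurable_weight_upd:
  assumes "e \<in> complete_edges n"
  shows "(\<lambda>(t, x). x(e := t)) \<in> measurable (borel \<Otimes>\<^sub>M (\<Pi>\<^sub>M e\<in>complete_edges n - {e}. exp1)) (weight_law n)"
proof -
  have "(\<lambda>p. (snd p)(e := fst p)) \<in> measurable (borel \<Otimes>\<^sub>M (\<Pi>\<^sub>M e\<in>complete_edges n - {e}. exp1)) (\<Pi>\<^sub>M e\<in>complete_edges n. exp1)"
    by (rule measurable_fun_upd[where J = "complete_edges n - {e}"])
       (use assms in \<open>auto simp: measurable_cong_sets[OF refl sets_exp1]\<close>)
  then show ?thesis
    by (simp add: weight_law_def case_prod_beta)
qed

text \<open>With the other weights fixed, a tie confines the weight of e to one point, which is null
  for \<open>exp1\<close>.\<close>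

lemma AE_weight_neq:
  assumes "e \<in> complete_edges n" "f \<in> complete_edges n" "e \<noteq> f"
  shows "AE w in weight_law n. w e \<noteq> w f"
proof -
  note [measurable] = measurable_weight[OF assms(1)] measurable_weight[OF assms(2)]
  let ?A = "{w \<in> space (weight_law n). w e = w f}"
  have A: "?A \<in> sets (weight_law n)"
    by measurable
  have "emeasure (weight_law n) ?A = (\<integral>\<^sup>+ w. indicator ?A w \<partial>weight_law n)"
    using A by simp
  also have "\<dots> = (\<integral>\<^sup>+ x. (\<integral>\<^sup>+ y. indicator ?A (x(e := y)) \<partial>exp1) \<partial>(\<Pi>\<^sub>M e\<in>complete_edges n - {e}. exp1))"
    using A by (intro nn_integral_weight_law_split assms(1)) auto
  also have "\<dots> = (\<integral>\<^sup>+ x. 0 \<partial>(\<Pi>\<^sub>M e\<in>complete_edges n - {e}. exp1))"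
  proof (intro nn_integral_cong)
    fix x :: "nat set \<Rightarrow> real"
    have "(\<integral>\<^sup>+ y. indicator ?A (x(e := y)) \<partial>exp1) \<le> (\<integral>\<^sup>+ y. indicator {x f} y \<partial>exp1)"
      using assms(3) by (intro nn_integral_mono) (auto split: split_indicator)
    then show "(\<integral>\<^sup>+ y. indicator ?A (x(e := y)) \<partial>exp1) = 0"
      by (simp add: emeasure_exp1_singleton)
  qed
  finally have "emeasure (weight_law n) ?A = 0"
    by simp
  then show ?thesis
    using A by (intro AE_I[of _ _ ?A]) auto
qed

lemma AE_inj_weights: "AE w in weight_law n. inj_on w (complete_edges n)"
proof -
  have "AE w in weight_law n. \<forall>e\<in>complete_edges n. \<forall>f\<in>complete_edges n. e \<noteq> f \<longrightarrow> w e \<noteq> w f"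
    by (intro AE_finite_allI finite_complete_edges) (auto intro: AE_weight_neq simp: AE_impI)
  then show ?thesis
    by eventually_elim (auto simp: inj_on_def)
qed

lemma AE_nonneg_weights: "AE w in weight_law n. \<forall>e\<in>complete_edges n. w e \<ge> 0"
proof -
  interpret prob_space "weight_law n" by (rule prob_space_weight_law)
  have "emeasure (weight_law n) {w \<in> space (weight_law n). edges_below n w 0 = {}} = 1"
    using emeasure_edges_below[of 0 "{}" n] by simp
  then have "prob {w \<in> space (weight_law n). edges_below n w 0 = {}} = 1"
    by (simp add: emeasure_eq_measure)
  then have "AE w in weight_law n. edges_below n w 0 = {}"
    using AE_prob_1 by fastforce
  then show ?thesis
    by eventually_elim (auto simp: edges_below_def not_less)
qed

text \<open>Conditioning on the weight \<open>t\<close> of \<open>e\<close>: its density \<open>exp (- t)\<close> is also the probability that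
  \<open>e\<close> is still absent at time \<open>t\<close>, so a rate-one clock replaces the weight of \<open>e\<close>.\<close>

lemma nn_integral_at_weight:
  fixes h :: "real \<Rightarrow> (nat set \<Rightarrow> real) \<Rightarrow> ennreal"
  assumes e: "e \<in> complete_edges n"
    and h: "(\<lambda>(t, w). h t w) \<in> borel_measurable (borel \<Otimes>\<^sub>M weight_law n)"
    and inv: "\<And>t y w. t \<le> y \<Longrightarrow> h t (w(e := y)) = h t (w(e := t))"
  shows "(\<integral>\<^sup>+ w. h (w e) w \<partial>weight_law n)
    = (\<integral>\<^sup>+ t. (\<integral>\<^sup>+ w. h t w * indicator {t..} (w e) \<partial>weight_law n) * indicator {0..} t \<partial>lborel)"
proof -
  let ?P = "\<Pi>\<^sub>M e\<in>complete_edges n - {e}. exp1"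
  define F where "F t x = h t (x(e := t))" for t x
  interpret product_sigma_finite "\<lambda>_. exp1" by (rule product_sigma_finite_exp1)
  interpret P: sigma_finite_measure ?P
    by (rule sigma_finite) simp
  interpret pair_sigma_finite lborel ?P ..
  note [measurable] = measurable_weight[OF e]
  have "(\<lambda>p. (fst p, (\<lambda>(t, x). x(e := t)) p)) \<in> measurable (borel \<Otimes>\<^sub>M ?P) (borel \<Otimes>\<^sub>M weight_law n)"
    by (intro measurable_Pair measurable_fst measurable_weight_upd e)
  from measurable_compose[OF this h]
  have F [measurable]: "(\<lambda>(t, x). F t x) \<in> borel_measurable (borel \<Otimes>\<^sub>M ?P)"
    by (simp add: F_def case_prod_beta)
  have "(\<lambda>w. (w e, w)) \<in> measurable (weight_law n) (borel \<Otimes>\<^sub>M weight_law n)"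
    by (intro measurable_Pair) auto
  from measurable_compose[OF this h] have he: "(\<lambda>w. h (w e) w) \<in> borel_measurable (weight_law n)"
    by simp
  have ht: "(\<lambda>w. h t w * indicator {t..} (w e)) \<in> borel_measurable (weight_law n)" for t
    using measurable_Pair2[OF h, of t] by simp
  have Fx: "(\<lambda>t. F t x) \<in> borel_measurable borel" if "x \<in> space ?P" for x
    using measurable_Pair1[OF F that] by simp
  have inner: "(\<integral>\<^sup>+ w. h t w * indicator {t..} (w e) \<partial>weight_law n) * indicator {0..} t
      = (\<integral>\<^sup>+ x. ennreal (exponential_density 1 t) * F t x \<partial>?P)" for t
  proof (cases "t \<ge> 0")
    case True
    have "(\<integral>\<^sup>+ w. h t w * indicator {t..} (w e) \<partial>weight_law n)
        = (\<integral>\<^sup>+ x. (\<integral>\<^sup>+ y. h t (x(e := y)) * indicator {t..} y \<partial>exp1) \<partial>?P)"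
      by (subst nn_integral_weight_law_split[OF e ht]) simp
    also have "\<dots> = (\<integral>\<^sup>+ x. (\<integral>\<^sup>+ y. F t x * indicator {t..} y \<partial>exp1) \<partial>?P)"
    proof (intro nn_integral_cong)
      show "h t (x(e := y)) * indicator {t..} y = F t x * indicator {t..} y" for x y
        using inv[of t y x] by (cases "t \<le> y") (simp_all add: F_def)
    qed
    also have "\<dots> = (\<integral>\<^sup>+ x. ennreal (exp (- t)) * F t x \<partial>?P)"
      using True by (intro nn_integral_cong) (simp add: nn_integral_cmult_indicator emeasure_exp1_atLeast mult.commute)
    finally show ?thesis
      using True by (simp add: exponential_density_def)
  qed (simp add: exponential_density_def)
  have "(\<integral>\<^sup>+ w. h (w e) w \<partial>weight_law n) = (\<integral>\<^sup>+ x. (\<integral>\<^sup>+ y. F y x \<partial>exp1) \<partial>?P)"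
    by (subst nn_integral_weight_law_split[OF e he]) (simp add: F_def)
  also have "\<dots> = (\<integral>\<^sup>+ x. (\<integral>\<^sup>+ t. ennreal (exponential_density 1 t) * F t x \<partial>lborel) \<partial>?P)"
    by (intro nn_integral_cong nn_integral_exp1 Fx)
  also have "\<dots> = (\<integral>\<^sup>+ t. (\<integral>\<^sup>+ x. ennreal (exponential_density 1 t) * F t x \<partial>?P) \<partial>lborel)"
    by (rule Fubini') simp
  finally show ?thesis
    by (simp add: inner)
qed

section \<open>Adjacent tree edges and the tree weight as time integrals\<close>

lemma exists_inj_weights: "\<exists>w :: nat set \<Rightarrow> real. inj_on w (complete_edges n)"
proof -
  obtain g :: "nat set \<Rightarrow> nat" where "inj_on g (complete_edges n)"
    using finite_imp_inj_to_nat_seg[OF finite_complete_edges[of n]] by auto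
  then have "inj_on (\<lambda>e. real (g e)) (complete_edges n)"
    by (auto simp: inj_on_def)
  then show ?thesis by blast
qed

lemma vertex_degree_nonneg: "vertex_degree n F u \<ge> 0"
  by (auto simp: vertex_degree_def intro!: sum_nonneg)

lemma nonconn_complete: "nonconn n (complete_edges n) = {}"
  by (auto simp: nonconn_def conn_complete)

text \<open>For distinct weights, every unordered pair of tree edges with common vertex x is counted
  once: at x, by the heavier of the two.\<close>

definition earlier_neighbours :: "nat \<Rightarrow> (nat set \<Rightarrow> real) \<Rightarrow> real" where
  "earlier_neighbours n w = (\<Sum>x<n. \<Sum>y\<in>{..<n} - {x}. of_bool ({x, y} \<in> kruskal w (complete_edges n)) *
     vertex_degree n (kruskal w (edges_below n w (w {x, y}))) x)"

text \<open>Conditioning each summand on the weight t of its edge produces a time integral of forest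
  degrees over disconnected pairs. By \<open>sum_nonconn_degree_kruskal\<close> the total depends on
  the current graph alone, so \<open>avg\<close> applies.\<close>

lemma nn_integral_earlier_neighbours:
  assumes "n > 0"
  shows "(\<integral>\<^sup>+ w. ennreal (earlier_neighbours n w) \<partial>weight_law n) = ennreal (4 * (real n - 1) - 2 * real n * mst_mean n)"
proof -
  define d where "d x t w = vertex_degree n (kruskal w (edges_below n w t)) x" for x t w
  define h where "h x y t w = ennreal (of_bool (\<not> conn (edges_below n w t) x y) * d x t w)" for x y t w
  define \<Phi> where "\<Phi> H = 2 * real (card (nonconn n H)) - 2 * real n * (comp_count n H - 1)" for H
  define P where "P = (SIGMA x:{..<n}. {..<n} - {x})"
  have finP: "finite P"
    by (simp add: P_def)
  have d_nonneg: "d x t w \<ge> 0" for x t w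
    by (simp add: d_def vertex_degree_nonneg)
  have d_meas [measurable]: "(\<lambda>p. d x (fst p) (snd p)) \<in> borel_measurable (borel \<Otimes>\<^sub>M weight_law n)" if "x < n" for x
  proof -
    have "Measurable.pred (borel \<Otimes>\<^sub>M weight_law n) (\<lambda>p. {x, v} \<in> kruskal (snd p) (edges_below n (snd p) (fst p)))"
      if v: "v \<in> {..<n} - {x}" for v
    proof -
      have e: "{x, v} \<in> complete_edges n"
        using v \<open>x < n\<close> by auto
      have [measurable]: "Measurable.pred (borel \<Otimes>\<^sub>M weight_law n) (\<lambda>p. {x, v} \<in> kruskal (snd p) (complete_edges n))"
        by (rule measurable_compose[OF measurable_snd measurable_in_kruskal])
      have [measurable]: "(\<lambda>p. snd p {x, v}) \<in> borel_measurable (borel \<Otimes>\<^sub>M weight_law n)"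
        by (rule measurable_compose[OF measurable_snd measurable_weight[OF e]])
      show ?thesis
        unfolding kruskal_edges_below by simp
    qed
    then show ?thesis
      unfolding d_def vertex_degree_def by (intro borel_measurable_sum) simp
  qed
  have h_meas [measurable]: "(\<lambda>p. h x y (fst p) (snd p)) \<in> borel_measurable (borel \<Otimes>\<^sub>M weight_law n)" if "x < n" for x y
  proof -
    have [measurable]: "Measurable.pred (borel \<Otimes>\<^sub>M weight_law n) (\<lambda>p. \<not> conn (edges_below n (snd p) (fst p)) x y)"
      by (rule measurable_edges_below_comp(1)[where Q = "\<lambda>H. \<not> conn H x y"]) auto
    show ?thesis
      using d_meas[OF that] unfolding h_def by simp
  qed
  have palm: "(\<integral>\<^sup>+ w. h x y (w {x, y}) w \<partial>weight_law n)
      = (\<integral>\<^sup>+ t. (\<integral>\<^sup>+ w. h x y t w \<partial>weight_law n) * indicator {0..} t \<partial>lborel)"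
    if xy: "(x, y) \<in> P" for x y
  proof -
    have e: "{x, y} \<in> complete_edges n" and x: "x < n"
      using xy by (auto simp: P_def)
    \<comment> \<open>At level t only edges lighter than t are seen, so a weight of the edge that is
      at least t has no influence.\<close>
    have inv: "h x y t (w({x, y} := s)) = h x y t (w({x, y} := t))" if "t \<le> s" for t s w
    proof -
      have "edges_below n (w({x, y} := s)) t = edges_below n (w({x, y} := t)) t"
        using that by (auto simp: edges_below_def)
      moreover have "kruskal (w({x, y} := s)) (edges_below n (w({x, y} := t)) t)
          = kruskal (w({x, y} := t)) (edges_below n (w({x, y} := t)) t)"
        by (rule kruskal_cong) (auto simp: edges_below_def)
      ultimately show ?thesis
        by (simp add: h_def d_def)
    qed
    have "(\<integral>\<^sup>+ w. h x y (w {x, y}) w \<partial>weight_law n)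
        = (\<integral>\<^sup>+ t. (\<integral>\<^sup>+ w. h x y t w * indicator {t..} (w {x, y}) \<partial>weight_law n) * indicator {0..} t \<partial>lborel)"
    proof (rule nn_integral_at_weight[where h = "h x y", OF e])
      show "(\<lambda>(t, w). h x y t w) \<in> borel_measurable (borel \<Otimes>\<^sub>M weight_law n)"
        unfolding case_prod_beta by (rule h_meas[OF x])
    qed (rule inv)
    \<comment> \<open>If the edge is lighter than t, it already connects x and y, and
      \<open>h\<close> vanishes without the indicator.\<close>
    moreover have "h x y t w * indicator {t..} (w {x, y}) = h x y t w" for t w
      using e conn_edge[of x y "edges_below n w t"] by (auto simp: h_def edges_below_def split: split_indicator)
    ultimately show ?thesis
      by simp
  qed
  have "(\<integral>\<^sup>+ w. ennreal (earlier_neighbours n w) \<partial>weight_law n)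
      = (\<integral>\<^sup>+ w. (\<Sum>(x, y)\<in>P. h x y (w {x, y}) w) \<partial>weight_law n)"
  proof (intro nn_integral_cong)
    fix w
    have "earlier_neighbours n w = (\<Sum>(x, y)\<in>P. of_bool ({x, y} \<in> kruskal w (complete_edges n)) * d x (w {x, y}) w)"
      unfolding earlier_neighbours_def P_def d_def by (rule sum.Sigma) auto
    also have "\<dots> = (\<Sum>(x, y)\<in>P. of_bool (\<not> conn (edges_below n w (w {x, y})) x y) * d x (w {x, y}) w)"
    proof (intro sum.cong refl)
      show "(case p of (x, y) \<Rightarrow> of_bool ({x, y} \<in> kruskal w (complete_edges n)) * d x (w {x, y}) w)
          = (case p of (x, y) \<Rightarrow> of_bool (\<not> conn (edges_below n w (w {x, y})) x y) * d x (w {x, y}) w)"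
        if "p \<in> P" for p
        using that by (cases p) (simp add: P_def unlinked_in_kruskal unlinked_doubleton neq_commute)
    qed
    finally show "ennreal (earlier_neighbours n w) = (\<Sum>(x, y)\<in>P. h x y (w {x, y}) w)"
      using d_nonneg by (simp add: h_def case_prod_beta sum_ennreal)
  qed
  also have "\<dots> = (\<Sum>(x, y)\<in>P. \<integral>\<^sup>+ w. h x y (w {x, y}) w \<partial>weight_law n)"
  proof -
    have "(\<lambda>w. h (fst p) (snd p) (w {fst p, snd p}) w) \<in> borel_measurable (weight_law n)" if "p \<in> P" for p
    proof -
      have "fst p < n" and e: "{fst p, snd p} \<in> complete_edges n"
        using that by (auto simp: P_def)
      then show ?thesis
        using measurable_compose[OF measurable_Pair[OF measurable_weight[OF e] measurable_ident_sets[OF refl]] h_meas]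
        by simp
    qed
    then show ?thesis
      unfolding case_prod_beta by (rule nn_integral_sum)
  qed
  also have "\<dots> = (\<Sum>(x, y)\<in>P. \<integral>\<^sup>+ t. (\<integral>\<^sup>+ w. h x y t w \<partial>weight_law n) * indicator {0..} t \<partial>lborel)"
    by (intro sum.cong) (auto simp: palm)
  also have "\<dots> = (\<integral>\<^sup>+ t. (\<Sum>(x, y)\<in>P. (\<integral>\<^sup>+ w. h x y t w \<partial>weight_law n) * indicator {0..} t) \<partial>lborel)"
  proof -
    interpret prob_space "weight_law n" by (rule prob_space_weight_law)
    have "(\<lambda>t. (\<integral>\<^sup>+ w. h (fst p) (snd p) t w \<partial>weight_law n) * indicator {0..} t) \<in> borel_measurable lborel"
      if "p \<in> P" for p
    proof -
      have "fst p < n"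
        using that by (auto simp: P_def)
      from h_meas[OF this, of "snd p"] have [measurable]:
        "(\<lambda>(t, w). h (fst p) (snd p) t w) \<in> borel_measurable (borel \<Otimes>\<^sub>M weight_law n)"
        by (simp add: case_prod_beta)
      show ?thesis
        by measurable
    qed
    then show ?thesis
      unfolding case_prod_beta by (intro nn_integral_sum[symmetric])
  qed
  also have "\<dots> = (\<integral>\<^sup>+ t. (\<integral>\<^sup>+ w. ennreal (\<Phi> (edges_below n w t)) \<partial>weight_law n) * indicator {0..} t \<partial>lborel)"
  proof (intro nn_integral_cong)
    fix t :: real
    have "(\<Sum>(x, y)\<in>P. (\<integral>\<^sup>+ w. h x y t w \<partial>weight_law n)) = (\<integral>\<^sup>+ w. (\<Sum>(x, y)\<in>P. h x y t w) \<partial>weight_law n)"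
    proof -
      have "(\<lambda>w. h (fst p) (snd p) t w) \<in> borel_measurable (weight_law n)" if "p \<in> P" for p
      proof -
        have "fst p < n"
          using that by (auto simp: P_def)
        then show ?thesis
          using measurable_compose[OF measurable_Pair[OF measurable_const[of t] measurable_ident_sets[OF refl]] h_meas]
          by simp
      qed
      then show ?thesis
        unfolding case_prod_beta by (rule nn_integral_sum[symmetric])
    qed
    also have "\<dots> = (\<integral>\<^sup>+ w. ennreal (\<Phi> (edges_below n w t)) \<partial>weight_law n)"
    proof (rule nn_integral_cong_AE)
      show "AE w in weight_law n. (\<Sum>(x, y)\<in>P. h x y t w) = ennreal (\<Phi> (edges_below n w t))"
        using AE_inj_weights
      proof eventually_elim
        case (elim w)
        then have inj: "inj_on w (edges_below n w t)"
          using edges_below_subset by (rule inj_on_subset)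
        have "(\<Sum>(x, y)\<in>P. of_bool (\<not> conn (edges_below n w t) x y) * d x t w)
            = (\<Sum>(x, y)\<in>nonconn n (edges_below n w t). d x t w)"
          by (rule sum.mono_neutral_cong_right) (auto simp: finP, auto simp: P_def nonconn_def)
        also have "\<dots> = \<Phi> (edges_below n w t)"
          unfolding d_def \<Phi>_def by (rule sum_nonconn_degree_kruskal[OF edges_below_subset inj])
        finally show ?case
          using d_nonneg by (simp add: h_def case_prod_beta sum_ennreal)
      qed
    qed
    finally show "(\<Sum>(x, y)\<in>P. (\<integral>\<^sup>+ w. h x y t w \<partial>weight_law n) * indicator {0..} t)
        = (\<integral>\<^sup>+ w. ennreal (\<Phi> (edges_below n w t)) \<partial>weight_law n) * indicator {0..} t"
      by (simp add: sum_distrib_right[symmetric] case_prod_beta)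
  qed
  also have "\<dots> = ennreal (avg n \<Phi>)"
  proof (rule nn_integral_edges_below)
    fix H assume H: "H \<subseteq> complete_edges n"
    \<comment> \<open>\<Phi> involves no weights, but its sign is read off from a sum of degrees,
      for which any injective weights serve.\<close>
    obtain w :: "nat set \<Rightarrow> real" where "inj_on w (complete_edges n)"
      using exists_inj_weights by auto
    then have "inj_on w H"
      using H by (rule inj_on_subset)
    then show "\<Phi> H \<ge> 0"
      unfolding \<Phi>_def sum_nonconn_degree_kruskal[OF H \<open>inj_on w H\<close>, symmetric]
      by (auto intro!: sum_nonneg vertex_degree_nonneg)
  next
    show "\<Phi> (complete_edges n) = 0"
      using assms by (simp add: \<Phi>_def nonconn_complete comp_total_complete)
  qed
  also have "avg n \<Phi> = 4 * (real n - 1) - 2 * real n * mst_mean n"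
    unfolding \<Phi>_def avg_diff avg_cmult avg_card_nonconn[OF assms] mst_mean_def by simp
  finally show ?thesis .
qed

text \<open>Layer-cake formula: the weight of an edge is the length of [0, \<open>w e\<close>]. The
  tree has n - 1 edges and its part below t has n minus the number of components, so the edges of
  weight at least t number the components minus one.\<close>

lemma nn_integral_kruskal_weight:
  assumes "n > 0"
  shows "(\<integral>\<^sup>+ w. ennreal (\<Sum>e\<in>kruskal w (complete_edges n). w e) \<partial>weight_law n) = ennreal (mst_mean n)"
proof -
  interpret prob_space "weight_law n" by (rule prob_space_weight_law)
  interpret pair_sigma_finite lborel "weight_law n" ..
  define \<Phi> where "\<Phi> H = comp_count n H - 1" for H
  have \<Phi>_nonneg: "\<Phi> H \<ge> 0" for H
  proof -
    have "(\<Sum>v<n. 1 / real n) \<le> comp_count n H"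
      unfolding comp_total_def
      by (intro sum_mono divide_left_mono) (use csize_le csize_pos[of _ n H] assms in auto)
    then show ?thesis
      using assms by (simp add: \<Phi>_def)
  qed
  have "(\<integral>\<^sup>+ w. ennreal (\<Sum>e\<in>kruskal w (complete_edges n). w e) \<partial>weight_law n)
      = (\<integral>\<^sup>+ w. (\<integral>\<^sup>+ t. ennreal (\<Phi> (edges_below n w t)) * indicator {0..} t \<partial>lborel) \<partial>weight_law n)"
  proof (rule nn_integral_cong_AE)
    show "AE w in weight_law n. ennreal (\<Sum>e\<in>kruskal w (complete_edges n). w e)
        = (\<integral>\<^sup>+ t. ennreal (\<Phi> (edges_below n w t)) * indicator {0..} t \<partial>lborel)"
      using AE_inj_weights AE_nonneg_weights
    proof eventually_elim
      case (elim w)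
      let ?K = "kruskal w (complete_edges n)"
      have fin: "finite ?K"
        using kruskal_subset by (rule finite_subset) simp
      have nonneg: "w e \<ge> 0" if "e \<in> ?K" for e
        using elim that kruskal_subset by blast
      have count: "(\<Sum>e\<in>?K. indicator {..w e} t) = \<Phi> (edges_below n w t)" for t :: real
      proof -
        have "inj_on w (edges_below n w t)"
          using elim(1) edges_below_subset by (rule inj_on_subset)
        then have "real (card {e \<in> ?K. w e < t}) = n - comp_count n (edges_below n w t)"
          unfolding kruskal_edges_below[symmetric] by (rule card_kruskal[OF edges_below_subset])
        moreover have "real (card ?K) = real n - 1"
          using card_kruskal[OF order_refl elim(1)] assms by (simp add: comp_total_complete)
        moreover have "card ?K = card {e \<in> ?K. w e < t} + card {e \<in> ?K. t \<le> w e}"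
          using fin by (subst card_Un_disjoint[symmetric]) (auto intro!: arg_cong[where f = card])
        moreover have "(\<Sum>e\<in>?K. indicator {..w e} t) = real (card {e \<in> ?K. t \<le> w e})"
          using fin by (simp add: indicator_def sum.If_cases Int_def)
        ultimately show ?thesis
          by (simp add: \<Phi>_def)
      qed
      have "ennreal (\<Sum>e\<in>?K. w e) = (\<Sum>e\<in>?K. ennreal (w e))"
        using nonneg by (intro sum_ennreal[symmetric])
      also have "\<dots> = (\<Sum>e\<in>?K. \<integral>\<^sup>+ t. ennreal (indicator {..w e} t) * indicator {0..} t \<partial>lborel)"
      proof (intro sum.cong refl)
        fix e assume "e \<in> ?K"
        have "(\<integral>\<^sup>+ t. ennreal (indicator {..w e} t) * indicator {0..} t \<partial>lborel) = (\<integral>\<^sup>+ t. indicator {0..w e} t \<partial>lborel)"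
          by (intro nn_integral_cong) (auto split: split_indicator)
        then show "ennreal (w e) = (\<integral>\<^sup>+ t. ennreal (indicator {..w e} t) * indicator {0..} t \<partial>lborel)"
          using nonneg[OF \<open>e \<in> ?K\<close>] by simp
      qed
      also have "\<dots> = (\<integral>\<^sup>+ t. (\<Sum>e\<in>?K. ennreal (indicator {..w e} t) * indicator {0..} t) \<partial>lborel)"
        by (rule nn_integral_sum[symmetric]) simp
      also have "\<dots> = (\<integral>\<^sup>+ t. ennreal (\<Phi> (edges_below n w t)) * indicator {0..} t \<partial>lborel)"
        unfolding sum_distrib_right[symmetric] count[symmetric] by (subst sum_ennreal) auto
      finally show ?case .
    qed
  qed
  also have "\<dots> = (\<integral>\<^sup>+ t. (\<integral>\<^sup>+ w. ennreal (\<Phi> (edges_below n w t)) * indicator {0..} t \<partial>weight_law n) \<partial>lborel)"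
  proof (rule Fubini')
    have "(\<lambda>p. \<Phi> (edges_below n (snd p) (fst p))) \<in> borel_measurable (lborel \<Otimes>\<^sub>M weight_law n)"
      by (rule measurable_edges_below_comp(2)) auto
    then show "(\<lambda>(t, w). ennreal (\<Phi> (edges_below n w t)) * indicator {0..} t) \<in> borel_measurable (lborel \<Otimes>\<^sub>M weight_law n)"
      by (simp add: case_prod_beta)
  qed
  also have "\<dots> = (\<integral>\<^sup>+ t. (\<integral>\<^sup>+ w. ennreal (\<Phi> (edges_below n w t)) \<partial>weight_law n) * indicator {0..} t \<partial>lborel)"
    by (intro nn_integral_cong) (simp split: split_indicator)
  also have "\<dots> = ennreal (avg n \<Phi>)"
    using \<Phi>_nonneg assms by (intro nn_integral_edges_below) (auto simp: \<Phi>_def comp_total_complete)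
  finally show ?thesis
    by (simp add: mst_mean_def \<Phi>_def[abs_def])
qed

section \<open>Inclusion probabilities\<close>

definition kruskal_prob :: "nat \<Rightarrow> nat set set \<Rightarrow> real" where
  "kruskal_prob n S = measure (weight_law n) {w \<in> space (weight_law n). S \<subseteq> kruskal w (complete_edges n)}"

lemma measurable_subset_kruskal:
  assumes "finite S"
  shows "Measurable.pred (weight_law n) (\<lambda>w. S \<subseteq> kruskal w (complete_edges n))"
  unfolding subset_eq using assms measurable_in_kruskal by (intro pred_intros_finite) auto

lemma kruskal_prob_nonneg: "kruskal_prob n S \<ge> 0"
  by (simp add: kruskal_prob_def)

lemma nn_integral_sum_kruskal:
  assumes "finite I" "\<And>i. i \<in> I \<Longrightarrow> finite (S i)"
  shows "(\<integral>\<^sup>+ w. ennreal (\<Sum>i\<in>I. of_bool (S i \<subseteq> kruskal w (complete_edges n))) \<partial>weight_law n)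
    = ennreal (\<Sum>i\<in>I. kruskal_prob n (S i))"
proof -
  interpret prob_space "weight_law n" by (rule prob_space_weight_law)
  let ?A = "\<lambda>i. {w \<in> space (weight_law n). S i \<subseteq> kruskal w (complete_edges n)}"
  have A: "?A i \<in> sets (weight_law n)" if "i \<in> I" for i
    using measurable_subset_kruskal[OF assms(2)[OF that], of n] by simp
  have "(\<integral>\<^sup>+ w. ennreal (\<Sum>i\<in>I. of_bool (S i \<subseteq> kruskal w (complete_edges n))) \<partial>weight_law n)
     = (\<integral>\<^sup>+ w. (\<Sum>i\<in>I. indicator (?A i) w) \<partial>weight_law n)"
  proof (intro nn_integral_cong)
    fix w assume w: "w \<in> space (weight_law n)"
    have "ennreal (\<Sum>i\<in>I. of_bool (S i \<subseteq> kruskal w (complete_edges n)))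
        = (\<Sum>i\<in>I. ennreal (of_bool (S i \<subseteq> kruskal w (complete_edges n))))"
      by (rule sum_ennreal[symmetric]) simp
    also have "\<dots> = (\<Sum>i\<in>I. indicator (?A i) w)"
      using w by (intro sum.cong) (auto split: split_indicator)
    finally show "ennreal (\<Sum>i\<in>I. of_bool (S i \<subseteq> kruskal w (complete_edges n))) = (\<Sum>i\<in>I. indicator (?A i) w)" .
  qed
  also have "\<dots> = (\<Sum>i\<in>I. emeasure (weight_law n) (?A i))"
    using A by (subst nn_integral_sum) auto
  also have "\<dots> = ennreal (\<Sum>i\<in>I. kruskal_prob n (S i))"
    by (simp add: emeasure_eq_measure kruskal_prob_def sum_ennreal)
  finally show ?thesis .
qed

section \<open>Symmetry under vertex permutations and pair probabilities\<close>

lemma conn_image: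
  assumes "conn L x y"
  shows "conn ((`) \<pi> ` L) (\<pi> x) (\<pi> y)"
  using assms
proof (induction rule: conn_induct)
  case (step y z)
  have "{\<pi> y, \<pi> z} = \<pi> ` {y, z}"
    by simp
  then have "{\<pi> y, \<pi> z} \<in> (`) \<pi> ` L"
    using step.hyps by blast
  then show ?case
    using step.IH conn_trans conn_edge by metis
qed simp

lemma permutes_image_complete_edges:
  assumes "\<pi> permutes {..<n}"
  shows "\<pi> ` e \<in> complete_edges n \<longleftrightarrow> e \<in> complete_edges n"
proof -
  have "inj_on \<pi> e"
    using permutes_inj[OF assms] by (rule inj_on_subset) simp
  moreover have "\<pi> ` e \<subseteq> {..<n} \<longleftrightarrow> e \<subseteq> {..<n}"
    using permutes_in_image[OF assms] by auto
  ultimately show ?thesis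
    by (simp add: complete_edges_def card_image)
qed

lemma kruskal_permuted:
  assumes "\<pi> permutes {..<n}"
  shows "e \<in> kruskal (\<lambda>f. w (\<pi> ` f)) (complete_edges n) \<longleftrightarrow> \<pi> ` e \<in> kruskal w (complete_edges n)"
proof (cases "e \<in> complete_edges n")
  case True
  then obtain x y where e: "e = {x, y}"
    by (elim complete_edgesE)
  let ?\<sigma> = "inv \<pi>"
  let ?L = "{f \<in> complete_edges n. w (\<pi> ` f) < w (\<pi> ` e)}"
  let ?M = "{f \<in> complete_edges n. w f < w (\<pi> ` e)}"
  have inv: "?\<sigma> (\<pi> v) = v" "\<pi> (?\<sigma> v) = v" for v
    using permutes_inverses[OF assms] by auto
  have img: "?\<sigma> ` (\<pi> ` f) = f" "\<pi> ` (?\<sigma> ` f) = f" for f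
    by (simp_all add: image_image inv)
  have sub1: "(`) \<pi> ` ?L \<subseteq> ?M"
    using permutes_image_complete_edges[OF assms] by auto
  have sub2: "(`) ?\<sigma> ` ?M \<subseteq> ?L"
    using permutes_image_complete_edges[OF permutes_inv[OF assms]] by (auto simp: img)
  have "conn ?L x y \<longleftrightarrow> conn ?M (\<pi> x) (\<pi> y)"
  proof
    assume "conn ?L x y"
    then show "conn ?M (\<pi> x) (\<pi> y)"
      by (rule conn_mono[OF sub1 conn_image])
  next
    assume "conn ?M (\<pi> x) (\<pi> y)"
    from conn_mono[OF sub2 conn_image[OF this]] show "conn ?L x y"
      by (simp only: inv)
  qed
  moreover have "\<pi> ` e = {\<pi> x, \<pi> y}"
    by (simp add: e)
  moreover have "\<pi> ` e \<in> complete_edges n"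
    using True permutes_image_complete_edges[OF assms] by simp
  ultimately show ?thesis
    using True by (simp add: kruskal_def unlinked_doubleton e)
next
  case False
  then show ?thesis
    using permutes_image_complete_edges[OF assms, of e] kruskal_subset by blast
qed

text \<open>A vertex permutation permutes the edges, and permuting the coordinates of i.i.d. weights
  preserves their product law.\<close>

lemma kruskal_prob_permute:
  assumes "\<pi> permutes {..<n}" "finite S"
  shows "kruskal_prob n ((`) \<pi> ` S) = kruskal_prob n S"
proof -
  let ?E = "complete_edges n"
  let ?\<tau> = "\<lambda>w. \<lambda>e\<in>?E. w (\<pi> ` e)"
  have "inj_on ((`) \<pi>) ?E"
    using inj_image_eq_iff[OF permutes_inj[OF assms(1)]] by (auto simp: inj_on_def)
  then have law: "distr (weight_law n) (weight_law n) ?\<tau> = weight_law n"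
    unfolding weight_law_def
    by (intro distr_PiM_reindex[where M = "\<lambda>_. exp1"] prob_space_exp1)
       (auto simp: permutes_image_complete_edges[OF assms(1)])
  have meas: "?\<tau> \<in> measurable (weight_law n) (weight_law n)"
    unfolding weight_law_def
    by (intro measurable_restrict measurable_component_singleton)
       (simp add: permutes_image_complete_edges[OF assms(1)])
  have "kruskal_prob n S = measure (distr (weight_law n) (weight_law n) ?\<tau>) {w \<in> space (weight_law n). S \<subseteq> kruskal w ?E}"
    by (simp add: law kruskal_prob_def)
  also have "\<dots> = measure (weight_law n) (?\<tau> -` {w \<in> space (weight_law n). S \<subseteq> kruskal w ?E} \<inter> space (weight_law n))"
    using measurable_subset_kruskal[OF assms(2), of n] by (intro measure_distr meas) simp
  also have "?\<tau> -` {w \<in> space (weight_law n). S \<subseteq> kruskal w ?E} \<inter> space (weight_law n)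
      = {w \<in> space (weight_law n). (`) \<pi> ` S \<subseteq> kruskal w ?E}"
  proof -
    have "kruskal (?\<tau> w) ?E = kruskal (\<lambda>f. w (\<pi> ` f)) ?E" for w
      by (rule kruskal_cong) simp
    then have "S \<subseteq> kruskal (?\<tau> w) ?E \<longleftrightarrow> (`) \<pi> ` S \<subseteq> kruskal w ?E" for w
      by (simp add: subset_eq kruskal_permuted[OF assms(1)])
    then show ?thesis
      using measurable_space[OF meas] by auto
  qed
  finally show ?thesis
    by (simp add: kruskal_prob_def)
qed

lemma obtain_permutation:
  fixes f g :: "nat \<Rightarrow> nat"
  assumes "finite A" "A \<subseteq> {..<n}" "inj_on g A" "g ` A \<subseteq> {..<n}"
  obtains \<pi> where "\<pi> permutes {..<n}" "\<And>a. a \<in> A \<Longrightarrow> \<pi> a = g a"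
proof -
  have "card ({..<n} - A) = card ({..<n} - g ` A)"
    using assms by (simp add: card_Diff_subset card_image)
  then obtain h where h: "bij_betw h ({..<n} - A) ({..<n} - g ` A)"
    using finite_same_card_bij[of "{..<n} - A" "{..<n} - g ` A"] by auto
  define \<pi> where "\<pi> v = (if v \<in> A then g v else if v < n then h v else v)" for v
  have "bij_betw \<pi> A (g ` A)"
    using assms(3) by (auto simp: bij_betw_def \<pi>_def inj_on_def)
  moreover have "bij_betw \<pi> ({..<n} - A) ({..<n} - g ` A)"
    using h bij_betw_cong[of "{..<n} - A" \<pi> h "{..<n} - g ` A"] by (simp add: \<pi>_def)
  ultimately have "bij_betw \<pi> (A \<union> ({..<n} - A)) (g ` A \<union> ({..<n} - g ` A))"
    by (rule bij_betw_combine) auto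
  moreover have "A \<union> ({..<n} - A) = {..<n}" "g ` A \<union> ({..<n} - g ` A) = {..<n}"
    using assms by auto
  ultimately have "bij_betw \<pi> {..<n} {..<n}"
    by simp
  then have "\<pi> permutes {..<n}"
    by (rule bij_imp_permutes) (use assms in \<open>auto simp: \<pi>_def\<close>)
  then show thesis
    by (rule that) (simp add: \<pi>_def)
qed

lemma obtain_permutation_of_list:
  fixes xs ys :: "nat list"
  assumes "distinct xs" "distinct ys" "length xs = length ys" "set xs \<subseteq> {..<n}" "set ys \<subseteq> {..<n}"
  obtains \<pi> where "\<pi> permutes {..<n}" "map \<pi> xs = ys"
proof -
  define g where "g = the \<circ> map_of (zip xs ys)"
  have g: "map g xs = ys"
    using assms by (intro nth_equalityI) (auto simp: g_def map_of_zip_nth)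
  then have im: "g ` set xs = set ys"
    by (metis set_map)
  have "inj_on g (set xs)"
    using g assms(1,2) by (simp add: distinct_map flip: g)
  then obtain \<pi> where "\<pi> permutes {..<n}" "\<And>a. a \<in> set xs \<Longrightarrow> \<pi> a = g a"
    using obtain_permutation[of "set xs" n g] assms im by auto
  then show thesis
    using that[of \<pi>] g by (metis map_cong)
qed

lemma kruskal_prob_edge:
  assumes "x < n" "y < n" "x \<noteq> y" "x' < n" "y' < n" "x' \<noteq> y'"
  shows "kruskal_prob n {{x, y}} = kruskal_prob n {{x', y'}}"
proof -
  obtain \<pi> where "\<pi> permutes {..<n}" "map \<pi> [x, y] = [x', y']"
    by (rule obtain_permutation_of_list[of "[x, y]" "[x', y']" n, OF _ _ _ _ _ that]) (use assms in simp_all)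
  then show ?thesis
    using kruskal_prob_permute[of \<pi> n "{{x, y}}"] by simp
qed

lemma kruskal_prob_path:
  assumes "distinct [x, y, z]" "{x, y, z} \<subseteq> {..<n}" "distinct [x', y', z']" "{x', y', z'} \<subseteq> {..<n}"
  shows "kruskal_prob n {{x, y}, {x, z}} = kruskal_prob n {{x', y'}, {x', z'}}"
proof -
  obtain \<pi> where "\<pi> permutes {..<n}" "map \<pi> [x, y, z] = [x', y', z']"
    by (rule obtain_permutation_of_list[of "[x, y, z]" "[x', y', z']" n, OF _ _ _ _ _ that]) (use assms in simp_all)
  then show ?thesis
    using kruskal_prob_permute[of \<pi> n "{{x, y}, {x, z}}"] by simp
qed

lemma kruskal_prob_matching:
  assumes "distinct [x, y, u, v]" "{x, y, u, v} \<subseteq> {..<n}" "distinct [x', y', u', v']" "{x', y', u', v'} \<subseteq> {..<n}"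
  shows "kruskal_prob n {{x, y}, {u, v}} = kruskal_prob n {{x', y'}, {u', v'}}"
proof -
  obtain \<pi> where "\<pi> permutes {..<n}" "map \<pi> [x, y, u, v] = [x', y', u', v']"
    by (rule obtain_permutation_of_list[of "[x, y, u, v]" "[x', y', u', v']" n, OF _ _ _ _ _ that]) (use assms in simp_all)
  then show ?thesis
    using kruskal_prob_permute[of \<pi> n "{{x, y}, {u, v}}"] by simp
qed

lemma AE_card_kruskal:
  assumes "n > 0"
  shows "AE w in weight_law n. real (card (kruskal w (complete_edges n))) = real n - 1"
  using AE_inj_weights
  by eventually_elim (use assms card_kruskal[OF order_refl] in \<open>simp add: comp_total_complete\<close>)

lemma sum_kruskal_prob_edges:
  assumes "n > 0"
  shows "(\<Sum>e\<in>complete_edges n. kruskal_prob n {e}) = real n - 1"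
proof -
  interpret prob_space "weight_law n" by (rule prob_space_weight_law)
  have "ennreal (\<Sum>e\<in>complete_edges n. kruskal_prob n {e})
     = (\<integral>\<^sup>+ w. ennreal (\<Sum>e\<in>complete_edges n. of_bool ({e} \<subseteq> kruskal w (complete_edges n))) \<partial>weight_law n)"
    by (rule nn_integral_sum_kruskal[symmetric]) auto
  also have "\<dots> = (\<integral>\<^sup>+ w. ennreal (real n - 1) \<partial>weight_law n)"
  proof (rule nn_integral_cong_AE)
    show "AE w in weight_law n. ennreal (\<Sum>e\<in>complete_edges n. of_bool ({e} \<subseteq> kruskal w (complete_edges n))) = ennreal (real n - 1)"
      using AE_card_kruskal[OF assms]
    proof eventually_elim
      case (elim w)
      have "(\<Sum>e\<in>complete_edges n. of_bool ({e} \<subseteq> kruskal w (complete_edges n))) = real (card (kruskal w (complete_edges n)))"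
        using kruskal_subset[of w "complete_edges n"] by (simp add: of_bool_def sum.If_cases Int_absorb1 Collect_mem_eq)
      then show ?case
        by (simp only: elim)
    qed
  qed
  also have "\<dots> = ennreal (real n - 1)"
    by (simp add: emeasure_space_1)
  finally show ?thesis
    using assms by (simp add: sum_nonneg kruskal_prob_nonneg)
qed

text \<open>By symmetry the n - 1 tree edges are shared equally among the n (n - 1) / 2
  edges.\<close>

lemma kruskal_prob_single:
  assumes "n \<ge> 2" "e \<in> complete_edges n"
  shows "kruskal_prob n {e} = 2 / n"
proof -
  have "kruskal_prob n {f} = kruskal_prob n {e}" if "f \<in> complete_edges n" for f
    using that assms(2) by (elim complete_edgesE) (auto intro!: kruskal_prob_edge)
  then have "(\<Sum>f\<in>complete_edges n. kruskal_prob n {f}) = card (complete_edges n) * kruskal_prob n {e}"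
    by simp
  then have "2 * (real n - 1) = (2 * real (card (complete_edges n))) * kruskal_prob n {e}"
    using sum_kruskal_prob_edges[of n] assms(1) by simp
  also have "\<dots> = (real n - 1) * (n * kruskal_prob n {e})"
    unfolding card_complete_edges by simp
  finally have "(real n - 1) * (n * kruskal_prob n {e}) = (real n - 1) * 2"
    by simp
  then have "n * kruskal_prob n {e} = 2"
    unfolding mult_cancel_left using assms(1) by simp
  then show ?thesis
    using assms(1) by (simp add: field_simps)
qed

text \<open>Exactly one of the edges to y and z is lighter, and swapping y and z exchanges the two
  cases.\<close>

lemma two_earlier_neighbours:
  assumes "inj_on w (complete_edges n)"
  shows "(\<Sum>x<n. \<Sum>y\<in>{..<n} - {x}. \<Sum>z\<in>{..<n} - {x, y}. of_bool ({{x, y}, {x, z}} \<subseteq> kruskal w (complete_edges n)))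
    = 2 * earlier_neighbours n w"
proof -
  let ?K = "kruskal w (complete_edges n)"
  have "(\<Sum>y\<in>{..<n} - {x}. \<Sum>z\<in>{..<n} - {x, y}. of_bool ({{x, y}, {x, z}} \<subseteq> ?K))
     = 2 * (\<Sum>y\<in>{..<n} - {x}. of_bool ({x, y} \<in> ?K) * vertex_degree n (kruskal w (edges_below n w (w {x, y}))) x)"
    if x: "x < n" for x
  proof -
    define V where "V = {..<n} - {x}"
    define b where "b y z = (of_bool ({x, y} \<in> ?K \<and> {x, z} \<in> ?K \<and> w {x, z} < w {x, y}) :: real)" for y z
    have fin: "finite V"
      by (simp add: V_def)
    have "(\<Sum>z\<in>{..<n} - {x, y}. of_bool ({{x, y}, {x, z}} \<subseteq> ?K)) = (\<Sum>z\<in>V. b y z + b z y)" if y: "y \<in> V" for y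
    proof (rule sum.mono_neutral_cong_left)
      show "{..<n} - {x, y} \<subseteq> V"
        by (auto simp: V_def)
      show "\<forall>z\<in>V - ({..<n} - {x, y}). b y z + b z y = 0"
        by (auto simp: V_def b_def)
      show "of_bool ({{x, y}, {x, z}} \<subseteq> ?K) = b y z + b z y" if z: "z \<in> {..<n} - {x, y}" for z
      proof -
        have "{x, y} \<in> complete_edges n" "{x, z} \<in> complete_edges n" "{x, y} \<noteq> {x, z}"
          using x y z by (auto simp: V_def doubleton_eq_iff)
        then have "w {x, y} \<noteq> w {x, z}"
          using assms by (meson inj_onD)
        then show ?thesis
          by (auto simp: b_def)
      qed
    qed (rule fin)
    then have "(\<Sum>y\<in>V. \<Sum>z\<in>{..<n} - {x, y}. of_bool ({{x, y}, {x, z}} \<subseteq> ?K)) = (\<Sum>y\<in>V. \<Sum>z\<in>V. b y z + b z y)"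
      by (rule sum.cong[OF refl])
    also have "\<dots> = (\<Sum>y\<in>V. \<Sum>z\<in>V. b y z) + (\<Sum>y\<in>V. \<Sum>z\<in>V. b z y)"
      by (simp add: sum.distrib)
    also have "(\<Sum>y\<in>V. \<Sum>z\<in>V. b z y) = (\<Sum>y\<in>V. \<Sum>z\<in>V. b y z)"
      by (rule sum.swap)
    also have "(\<Sum>y\<in>V. \<Sum>z\<in>V. b y z) + (\<Sum>y\<in>V. \<Sum>z\<in>V. b y z)
        = 2 * (\<Sum>y\<in>V. of_bool ({x, y} \<in> ?K) * vertex_degree n (kruskal w (edges_below n w (w {x, y}))) x)"
    proof -
      have "(\<Sum>z\<in>V. b y z) = of_bool ({x, y} \<in> ?K) * vertex_degree n (kruskal w (edges_below n w (w {x, y}))) x" for y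
        unfolding vertex_degree_def sum_distrib_left V_def[symmetric] kruskal_edges_below b_def
        by (intro sum.cong) auto
      then show ?thesis
        by simp
    qed
    finally show ?thesis
      by (simp add: V_def)
  qed
  then show ?thesis
    by (simp add: earlier_neighbours_def sum_distrib_left)
qed

text \<open>All n (n - 1) (n - 2) ordered triples have the same probability, and their sum is twice
  the mean of \<open>earlier_neighbours\<close>.\<close>

lemma kruskal_prob_adjacent:
  assumes "distinct [a, b, c]" "{a, b, c} \<subseteq> {..<n}"
  shows "real n * (real n - 1) * (real n - 2) * kruskal_prob n {{a, b}, {a, c}} = 8 * (real n - 1) - 4 * real n * mst_mean n"
proof -
  define p where "p = kruskal_prob n {{a, b}, {a, c}}"
  define P where "P = (SIGMA x:{..<n}. SIGMA y:{..<n} - {x}. {..<n} - {x, y})"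
  have n: "n \<ge> 3"
    using assms by auto
  define S :: "(nat set \<Rightarrow> real) \<Rightarrow> real" where "S w = (\<Sum>(x, y, z)\<in>P. of_bool ({{x, y}, {x, z}} \<subseteq> kruskal w (complete_edges n))) / 2" for w
  have fin: "finite P"
    by (simp add: P_def)
  have S_meas: "S \<in> borel_measurable (weight_law n)"
  proof -
    have "Measurable.pred (weight_law n) (\<lambda>w. {{x, y}, {x, z}} \<subseteq> kruskal w (complete_edges n))" for x y z :: nat
      by (rule measurable_subset_kruskal) simp
    then show ?thesis
      unfolding S_def case_prod_beta by (intro borel_measurable_divide borel_measurable_sum) simp_all
  qed
  have sumP: "(\<Sum>(x, y, z)\<in>P. f x y z) = (\<Sum>x<n. \<Sum>y\<in>{..<n} - {x}. \<Sum>z\<in>{..<n} - {x, y}. f x y z)" for f :: "nat \<Rightarrow> nat \<Rightarrow> nat \<Rightarrow> real"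
    unfolding P_def by (subst sum.Sigma[symmetric], simp, simp)+ simp
  have "(\<Sum>(x, y, z)\<in>P. kruskal_prob n {{x, y}, {x, z}}) = (\<Sum>(x, y, z)\<in>P. p)"
    unfolding p_def by (intro sum.cong refl) (use assms in \<open>auto simp: P_def intro!: kruskal_prob_path\<close>)
  also have "\<dots> = real n * (real n - 1) * (real n - 2) * p"
    unfolding sumP using n by (simp add: card_Diff_subset of_nat_diff)
  finally have count: "(\<Sum>(x, y, z)\<in>P. kruskal_prob n {{x, y}, {x, z}}) = real n * (real n - 1) * (real n - 2) * p" .
  have "ennreal (\<Sum>(x, y, z)\<in>P. kruskal_prob n {{x, y}, {x, z}})
     = (\<integral>\<^sup>+ w. ennreal (\<Sum>(x, y, z)\<in>P. of_bool ({{x, y}, {x, z}} \<subseteq> kruskal w (complete_edges n))) \<partial>weight_law n)"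
    using nn_integral_sum_kruskal[of P "\<lambda>(x, y, z). {{x, y}, {x, z}}" n] fin by (simp add: case_prod_beta)
  also have "\<dots> = (\<integral>\<^sup>+ w. 2 * ennreal (S w) \<partial>weight_law n)"
  proof (intro nn_integral_cong)
    fix w
    have "(\<Sum>(x, y, z)\<in>P. of_bool ({{x, y}, {x, z}} \<subseteq> kruskal w (complete_edges n))) = 2 * S w"
      by (simp add: S_def)
    then show "ennreal (\<Sum>(x, y, z)\<in>P. of_bool ({{x, y}, {x, z}} \<subseteq> kruskal w (complete_edges n))) = 2 * ennreal (S w)"
      using ennreal_mult'[of 2 "S w"] by simp
  qed
  also have "\<dots> = 2 * (\<integral>\<^sup>+ w. ennreal (S w) \<partial>weight_law n)"
    by (rule nn_integral_cmult) (use S_meas in simp)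
  also have "(\<integral>\<^sup>+ w. ennreal (S w) \<partial>weight_law n) = (\<integral>\<^sup>+ w. ennreal (earlier_neighbours n w) \<partial>weight_law n)"
  proof (rule nn_integral_cong_AE)
    show "AE w in weight_law n. ennreal (S w) = ennreal (earlier_neighbours n w)"
      using AE_inj_weights
    proof eventually_elim
      case (elim w)
      show ?case
        unfolding S_def sumP two_earlier_neighbours[OF elim] by simp
    qed
  qed
  also have "\<dots> = ennreal (4 * (real n - 1) - 2 * real n * mst_mean n)"
    using n by (intro nn_integral_earlier_neighbours) simp
  also have "2 * \<dots> = ennreal (2 * (4 * (real n - 1) - 2 * real n * mst_mean n))"
    by (subst ennreal_mult') simp_all
  finally have eq: "ennreal (\<Sum>(x, y, z)\<in>P. kruskal_prob n {{x, y}, {x, z}})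
    = ennreal (2 * (4 * (real n - 1) - 2 * real n * mst_mean n))" .
  \<comment> \<open>\<open>ennreal\<close> sends negative numbers to 0, so returning to reals
    requires a nonnegative right-hand side. The upper bound for the mean supplies it, through n *
    \<open>mst_mean n\<close> \<le> 2 (n - 1).\<close>
  have "n * mst_mean n \<le> n * ((real n - 1) * (5 * real n + 6) / (4 * (real n)\<^sup>2))"
    using n by (intro mult_left_mono mst_mean_le) auto
  also have "\<dots> = (real n - 1) * ((5 * real n + 6) / (4 * real n))"
    using n by (simp add: power2_eq_square)
  also have "\<dots> \<le> (real n - 1) * 2"
    using n by (intro mult_left_mono) (auto simp: field_simps)
  finally have "2 * (4 * (real n - 1) - 2 * real n * mst_mean n) \<ge> 0"
    by simp
  moreover have "(\<Sum>(x, y, z)\<in>P. kruskal_prob n {{x, y}, {x, z}}) \<ge> 0"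
    by (intro sum_nonneg) (auto simp: kruskal_prob_nonneg)
  ultimately have "(\<Sum>(x, y, z)\<in>P. kruskal_prob n {{x, y}, {x, z}}) = 2 * (4 * (real n - 1) - 2 * real n * mst_mean n)"
    using eq by (simp only: ennreal_inj)
  then show ?thesis
    unfolding count p_def by (simp add: algebra_simps)
qed

text \<open>When e lies in the tree, exactly n - 1 choices of f do, including f = e, where the pair
  collapses to {e}.\<close>

lemma sum_kruskal_prob_pair:
  assumes "n \<ge> 2" "e \<in> complete_edges n"
  shows "(\<Sum>f\<in>complete_edges n. kruskal_prob n {e, f}) = (real n - 1) * (2 / n)"
proof -
  let ?E = "complete_edges n"
  interpret prob_space "weight_law n" by (rule prob_space_weight_law)
  have "ennreal (\<Sum>f\<in>?E. kruskal_prob n {e, f})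
      = (\<integral>\<^sup>+ w. ennreal (\<Sum>f\<in>?E. of_bool ({e, f} \<subseteq> kruskal w ?E)) \<partial>weight_law n)"
    by (rule nn_integral_sum_kruskal[symmetric]) auto
  also have "\<dots> = (\<integral>\<^sup>+ w. ennreal (real n - 1) * indicator {w \<in> space (weight_law n). {e} \<subseteq> kruskal w ?E} w \<partial>weight_law n)"
  proof (rule nn_integral_cong_AE)
    have "AE w in weight_law n. real (card (kruskal w ?E)) = real n - 1"
      using assms(1) by (intro AE_card_kruskal) simp
    then show "AE w in weight_law n. ennreal (\<Sum>f\<in>?E. of_bool ({e, f} \<subseteq> kruskal w ?E))
        = ennreal (real n - 1) * indicator {w \<in> space (weight_law n). {e} \<subseteq> kruskal w ?E} w"
      using AE_space
    proof eventually_elim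
      case (elim w)
      let ?K = "kruskal w ?E"
      have "(\<Sum>f\<in>?E. of_bool ({e, f} \<subseteq> ?K)) = of_bool (e \<in> ?K) * (\<Sum>f\<in>?E. of_bool (f \<in> ?K) :: real)"
        by (cases "e \<in> ?K") simp_all
      also have "(\<Sum>f\<in>?E. of_bool (f \<in> ?K)) = real (card ?K)"
        using kruskal_subset[of w ?E] by (simp add: of_bool_def sum.If_cases Int_absorb1)
      finally have "(\<Sum>f\<in>?E. of_bool ({e, f} \<subseteq> ?K)) = of_bool (e \<in> ?K) * (real n - 1)"
        by (simp only: elim(1))
      then show ?case
        using elim(2) by (cases "e \<in> ?K") simp_all
    qed
  qed
  also have "\<dots> = ennreal (real n - 1) * ennreal (kruskal_prob n {e})"
    using measurable_subset_kruskal[of "{e}" n]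
    by (subst nn_integral_cmult_indicator) (auto simp: emeasure_eq_measure kruskal_prob_def)
  also have "\<dots> = ennreal ((real n - 1) * (2 / n))"
    unfolding kruskal_prob_single[OF assms] using assms(1) by (intro ennreal_mult[symmetric]) auto
  finally show ?thesis
    using assms(1) by (subst (asm) ennreal_inj) (auto intro!: sum_nonneg simp: kruskal_prob_nonneg)
qed

text \<open>Sorts the second edge by its intersection with {a, b}. In ordered pairs there are 2 for
  the edge itself, 4 (n - 2) adjacent and (n - 2) (n - 3) disjoint ones; subtracting the edge itself
  turns 2 (n - 1) into 2 (n - 2).\<close>

lemma kruskal_prob_disjoint:
  assumes "distinct [a, b, c, d]" "{a, b, c, d} \<subseteq> {..<n}"
  shows "4 * (real n - 2) * kruskal_prob n {{a, b}, {a, c}} + (real n - 2) * (real n - 3) * kruskal_prob n {{a, b}, {c, d}}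
    = 2 * (real n - 2) * (2 / n)"
proof -
  let ?p1 = "kruskal_prob n {{a, b}, {a, c}}" and ?p2 = "kruskal_prob n {{a, b}, {c, d}}"
  define g where "g x y = kruskal_prob n {{a, b}, {x, y}}" for x y
  define R where "R = {..<n} - {a, b}"
  have n: "n \<ge> 4"
    using card_mono[OF _ assms(2)] assms(1) by simp
  have e: "{a, b} \<in> complete_edges n"
    using assms by auto
  have cardR: "real (card R) = real n - 2" and finR: "finite R"
    using assms n by (auto simp: R_def card_Diff_subset of_nat_diff)
  have g_sym: "g x y = g y x" for x y
    by (simp add: g_def insert_commute)
  have g_ab: "g a b = 2 / n"
    using kruskal_prob_single[OF _ e] n by (simp add: g_def)
  have g_a: "g a y = ?p1" if "y \<in> R" for y
    unfolding g_def by (rule kruskal_prob_path) (use that assms in \<open>auto simp: R_def\<close>)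
  have g_b: "g b y = ?p1" if "y \<in> R" for y
  proof -
    have "kruskal_prob n {{b, a}, {b, y}} = ?p1"
      by (rule kruskal_prob_path) (use that assms in \<open>auto simp: R_def\<close>)
    then show ?thesis
      by (simp add: g_def insert_commute)
  qed
  have g_R: "g x y = ?p2" if "x \<in> R" "y \<in> R - {x}" for x y
    unfolding g_def by (rule kruskal_prob_matching) (use that assms in \<open>auto simp: R_def\<close>)
  have V: "{..<n} = insert a (insert b R)" and ab: "a \<noteq> b" "a \<notin> R" "b \<notin> R"
    using assms by (auto simp: R_def)
  have "(\<Sum>x<n. \<Sum>y\<in>{..<n} - {x}. g x y)
      = (\<Sum>y\<in>insert b R. g a y) + (\<Sum>y\<in>insert a R. g b y) + (\<Sum>x\<in>R. \<Sum>y\<in>insert a (insert b (R - {x})). g x y)"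
  proof -
    have "{..<n} - {a} = insert b R" "{..<n} - {b} = insert a R"
      using ab by (auto simp: V)
    moreover have "{..<n} - {x} = insert a (insert b (R - {x}))" if "x \<in> R" for x
      using ab that by (auto simp: V)
    moreover have "(\<Sum>x<n. h x) = h a + h b + (\<Sum>x\<in>R. h x)" for h :: "nat \<Rightarrow> real"
      unfolding V using ab finR by simp
    ultimately show ?thesis
      by simp
  qed
  also have "(\<Sum>y\<in>insert b R. g a y) = 2 / n + (real n - 2) * ?p1"
    using ab finR by (simp add: g_ab g_a cardR)
  also have "(\<Sum>y\<in>insert a R. g b y) = 2 / n + (real n - 2) * ?p1"
    using ab finR by (simp add: g_sym[of b a] g_ab g_b cardR)
  also have "(\<Sum>x\<in>R. \<Sum>y\<in>insert a (insert b (R - {x})). g x y) = (\<Sum>x\<in>R. 2 * ?p1 + (real n - 3) * ?p2)"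
  proof (intro sum.cong refl)
    fix x assume x: "x \<in> R"
    have "real (card (R - {x})) = real n - 3"
      using cardR card.remove[OF finR x] by linarith
    moreover have "(\<Sum>y\<in>R - {x}. g x y) = (\<Sum>y\<in>R - {x}. ?p2)"
      using g_R[OF x] by (intro sum.cong) auto
    ultimately show "(\<Sum>y\<in>insert a (insert b (R - {x})). g x y) = 2 * ?p1 + (real n - 3) * ?p2"
      using ab finR x by (simp add: g_sym[of x a] g_sym[of x b] g_a g_b)
  qed
  also have "\<dots> = (real n - 2) * (2 * ?p1 + (real n - 3) * ?p2)"
    by (simp add: cardR)
  finally have "2 * ((real n - 1) * (2 / n)) = 2 / n + (real n - 2) * ?p1 + (2 / n + (real n - 2) * ?p1)
      + (real n - 2) * (2 * ?p1 + (real n - 3) * ?p2)"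
    using sum_complete_edges[where n = n and f = "\<lambda>f. kruskal_prob n {{a, b}, f}"] sum_kruskal_prob_pair[OF _ e] n
    by (simp add: g_def)
  moreover have "4 * (m - 2) * p + (m - 2) * (m - 3) * q = 2 * (m - 2) * r"
    if "2 * ((m - 1) * r) = r + (m - 2) * p + (r + (m - 2) * p) + (m - 2) * (2 * p + (m - 3) * q)"
    for m p q r :: real
    using that by (simp add: algebra_simps)
  ultimately show ?thesis
    by blast
qed

section \<open>Transfer to the minimum spanning tree of the given weights\<close>

lemma is_mst_cong:
  assumes "\<And>e. e \<in> complete_edges n \<Longrightarrow> w e = w' e"
  shows "is_mst n w = is_mst n w'"
proof -
  have "sum w F = sum w' F" if "spanning_tree n F" for F
    using that assms by (intro sum.cong) (auto simp: spanning_tree_def)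
  then show ?thesis
    by (auto simp: is_mst_def is_arg_min_def fun_eq_iff)
qed

lemma mst_subset:
  assumes "n > 0"
  shows "mst n w \<subseteq> complete_edges n"
proof -
  obtain w0 :: "nat set \<Rightarrow> real" where "inj_on w0 (complete_edges n)"
    using exists_inj_weights[of n] by auto
  then have "{F. spanning_tree n F} \<noteq> {}"
    using kruskal_spanning_tree[OF assms] by auto
  then obtain F where "is_mst n w F"
    using ex_is_arg_min_if_finite[OF spanning_trees_finite[of n], of "sum w"]
    unfolding is_mst_def by auto
  then have "is_mst n w (mst n w)"
    unfolding mst_def by (rule someI)
  then show ?thesis
    by (simp add: is_mst_def is_arg_min_def spanning_tree_def)
qed

lemma measurable_weight_sum:
  assumes "F \<subseteq> complete_edges n"
  shows "(\<lambda>w. sum w F) \<in> borel_measurable (weight_law n)"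
  using assms by (intro borel_measurable_sum measurable_weight) auto

text \<open>The choice made by \<open>mst\<close> depends on the weights only through the set of
  minimizers, a measurable map into a finite discrete space; so arbitrary tie-breaking stays
  measurable.\<close>

lemma measurable_mst: "Measurable.pred (weight_law n) (\<lambda>w. Q (mst n w))"
proof -
  define A where "A w = {F \<in> Pow (complete_edges n). is_mst n w F}" for w
  have A: "A \<in> measurable (weight_law n) (count_space (Pow (Pow (complete_edges n))))"
  proof (rule measurable_set_valued)
    fix F assume F: "F \<in> Pow (complete_edges n)"
    have "Measurable.pred (weight_law n) (\<lambda>w. \<forall>F'\<in>{F'. spanning_tree n F'}. \<not> sum w F' < sum w F)"
    proof (intro pred_intros_finite spanning_trees_finite pred_intros_logic)
      fix F' assume "F' \<in> {F'. spanning_tree n F'}"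
      then have "F' \<subseteq> complete_edges n"
        by (simp add: spanning_tree_def)
      from measurable_weight_sum[OF this] measurable_weight_sum[of F n] F
      show "Measurable.pred (weight_law n) (\<lambda>w. sum w F' < sum w F)"
        by simp
    qed
    then show "Measurable.pred (weight_law n) (\<lambda>w. F \<in> A w)"
      using F by (cases "spanning_tree n F") (simp_all add: A_def is_mst_def is_arg_min_def)
  qed (auto simp: A_def)
  have "is_mst n w F \<longleftrightarrow> F \<in> A w" for w F
    by (auto simp: A_def is_mst_def is_arg_min_def spanning_tree_def)
  then have "mst n w = (SOME F. F \<in> A w)" for w
    by (simp add: mst_def)
  moreover have "Measurable.pred (weight_law n) (\<lambda>w. Q (SOME F. F \<in> A w))"
    by (rule measurable_compose[OF A, where g = "\<lambda>A. Q (SOME F. F \<in> A)"]) simp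
  ultimately show ?thesis
    by simp
qed

lemma AE_mst_eq_kruskal:
  assumes "n > 0"
  shows "AE w in weight_law n. mst n w = kruskal w (complete_edges n)"
  using AE_inj_weights by eventually_elim (rule mst_eq_kruskal[OF assms])

lemma prob_subset_mst:
  assumes "n > 0" "finite S"
  shows "measure (weight_law n) {w \<in> space (weight_law n). S \<subseteq> mst n w} = kruskal_prob n S"
  unfolding kruskal_prob_def
proof (rule measure_eq_AE)
  show "AE w in weight_law n. w \<in> {w \<in> space (weight_law n). S \<subseteq> mst n w}
      \<longleftrightarrow> w \<in> {w \<in> space (weight_law n). S \<subseteq> kruskal w (complete_edges n)}"
    using AE_mst_eq_kruskal[OF assms(1)] by eventually_elim simp
qed (use measurable_mst[where n = n and Q = "\<lambda>F. S \<subseteq> F"] measurable_subset_kruskal[OF assms(2), of n] in simp_all)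

lemma measurable_mst_weight:
  assumes "n > 0"
  shows "(\<lambda>w. \<Sum>e\<in>mst n w. w e) \<in> borel_measurable (weight_law n)"
proof -
  have "(\<Sum>e\<in>mst n w. w e) = (\<Sum>e\<in>complete_edges n. of_bool (e \<in> mst n w) * w e)" for w
    using mst_subset[OF assms, of w] by (intro sum.mono_neutral_cong_left) auto
  moreover have "(\<lambda>w. \<Sum>e\<in>complete_edges n. of_bool (e \<in> mst n w) * w e) \<in> borel_measurable (weight_law n)"
  proof (rule borel_measurable_sum)
    fix e assume "e \<in> complete_edges n"
    from measurable_weight[OF this] measurable_mst[where n = n and Q = "\<lambda>F. e \<in> F"]
    show "(\<lambda>w. of_bool (e \<in> mst n w) * w e) \<in> borel_measurable (weight_law n)"
      by simp
  qed
  ultimately show ?thesis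
    by simp
qed

lemma integral_mst_weight:
  assumes "n > 0"
  shows "(\<integral>w. (\<Sum>e\<in>mst n w. w e) \<partial>weight_law n) = mst_mean n"
proof -
  \<comment> \<open>The lower bound serves here to show that the mean is nonnegative, so that
    \<open>enn2real\<close> returns it unchanged.\<close>
  have "mst_mean n \<ge> (real n - 1) * (real n + 2) / (real n)\<^sup>2"
    by (rule mst_mean_ge_simple[OF assms])
  moreover have "(real n - 1) * (real n + 2) / (real n)\<^sup>2 \<ge> 0"
    using assms by simp
  ultimately have nonneg: "mst_mean n \<ge> 0"
    by linarith
  have "AE w in weight_law n. 0 \<le> (\<Sum>e\<in>mst n w. w e)"
    using AE_nonneg_weights
    by eventually_elim (use mst_subset[OF assms] in \<open>auto intro!: sum_nonneg\<close>)
  then have "(\<integral>w. (\<Sum>e\<in>mst n w. w e) \<partial>weight_law n) = enn2real (\<integral>\<^sup>+ w. ennreal (\<Sum>e\<in>mst n w. w e) \<partial>weight_law n)"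
    by (intro integral_eq_nn_integral measurable_mst_weight assms)
  also have "(\<integral>\<^sup>+ w. ennreal (\<Sum>e\<in>mst n w. w e) \<partial>weight_law n)
      = (\<integral>\<^sup>+ w. ennreal (\<Sum>e\<in>kruskal w (complete_edges n). w e) \<partial>weight_law n)"
    by (rule nn_integral_cong_AE) (use AE_mst_eq_kruskal[OF assms] in \<open>eventually_elim, simp\<close>)
  also have "\<dots> = ennreal (mst_mean n)"
    by (rule nn_integral_kruskal_weight[OF assms])
  finally show ?thesis
    using nonneg by simp
qed

lemma distr_weights:
  assumes "prob_space M" "prob_space.indep_vars M (\<lambda>_. borel) W (complete_edges n)" "n \<ge> 2"
    and "\<And>e. e \<in> complete_edges n \<Longrightarrow> distributed M lborel (W e) (exponential_density 1)"
  shows "(\<lambda>\<omega>. \<lambda>e\<in>complete_edges n. W e \<omega>) \<in> measurable M (weight_law n)"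
    and "distr M (weight_law n) (\<lambda>\<omega>. \<lambda>e\<in>complete_edges n. W e \<omega>) = weight_law n"
proof -
  interpret prob_space M by fact
  let ?E = "complete_edges n"
  have rv: "W e \<in> borel_measurable M" if "e \<in> ?E" for e
    using distributed_measurable[OF assms(4)[OF that]] by simp
  have law: "distr M borel (W e) = exp1" if "e \<in> ?E" for e
  proof -
    have "distr M borel (W e) = distr M lborel (W e)"
      by (rule distr_cong) auto
    then show ?thesis
      using distributed_distr_eq_density[OF assms(4)[OF that]] by (simp add: exp1_def)
  qed
  have sets: "sets (weight_law n) = sets (\<Pi>\<^sub>M e\<in>?E. borel)"
    unfolding weight_law_def by (rule sets_PiM_cong) auto
  have "(\<lambda>\<omega>. \<lambda>e\<in>?E. W e \<omega>) \<in> measurable M (\<Pi>\<^sub>M e\<in>?E. borel)"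
    by (intro measurable_restrict rv)
  then show "(\<lambda>\<omega>. \<lambda>e\<in>?E. W e \<omega>) \<in> measurable M (weight_law n)"
    by (simp add: measurable_cong_sets[OF refl sets])
  \<comment> \<open>Independence is turned into a product law over a nonempty index set; n \<ge> 2
    provides an edge.\<close>
  have "{0, 1} \<in> ?E"
    using assms(3) by simp
  then have "?E \<noteq> {}"
    by blast
  then have "distr M (\<Pi>\<^sub>M e\<in>?E. borel) (\<lambda>\<omega>. \<lambda>e\<in>?E. W e \<omega>) = (\<Pi>\<^sub>M e\<in>?E. distr M borel (W e))"
    using assms(2) rv by (subst (asm) indep_vars_iff_distr_eq_PiM') auto
  also have "\<dots> = weight_law n"
    unfolding weight_law_def by (intro PiM_cong law) auto
  finally show "distr M (weight_law n) (\<lambda>\<omega>. \<lambda>e\<in>?E. W e \<omega>) = weight_law n"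
    using distr_cong[OF refl sets] by metis
qed

lemma adjacent_edges:
  assumes "e \<in> complete_edges n" "f \<in> complete_edges n" "e \<noteq> f" "e \<inter> f \<noteq> {}"
  obtains a b c where "e = {a, b}" "f = {a, c}" "distinct [a, b, c]" "{a, b, c} \<subseteq> {..<n}"
proof -
  obtain a where a: "a \<in> e" "a \<in> f"
    using assms(4) by auto
  obtain b where b: "e = {a, b}" "a \<noteq> b" "b < n"
    using assms(1) a(1) by (elim complete_edgesE) (auto simp: insert_commute intro: less_trans)
  obtain c where c: "f = {a, c}" "a \<noteq> c" "c < n"
    using assms(2) a(2) by (elim complete_edgesE) (auto simp: insert_commute intro: less_trans)
  have "b \<noteq> c"
    using assms(3) b c by auto
  then show thesis
    using that[of a b c] b c assms(1) by auto
qed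

lemma disjoint_edges:
  assumes "e \<in> complete_edges n" "f \<in> complete_edges n" "e \<inter> f = {}"
  obtains a b c d where "e = {a, b}" "f = {c, d}" "distinct [a, b, c, d]" "{a, b, c, d} \<subseteq> {..<n}"
proof -
  obtain a b where "e = {a, b}" "a < b" "b < n"
    using assms(1) by (rule complete_edgesE)
  moreover obtain c d where "f = {c, d}" "c < d" "d < n"
    using assms(2) by (rule complete_edgesE)
  ultimately show thesis
    using assms(3) that[of a b c d] by auto
qed

text \<open>The probability is a decreasing affine function of the mean, and it equals 4 / n^2
  exactly at the stated value.\<close>

lemma adjacent_prob_le_iff:
  assumes "distinct [a, b, c]" "{a, b, c} \<subseteq> {..<n}"
  shows "kruskal_prob n {{a, b}, {a, c}} \<le> (2 / real n)\<^sup>2 \<longleftrightarrow>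
    mst_mean n \<ge> (real n - 1) * (real n + 2) / (real n)\<^sup>2"
proof -
  let ?p = "kruskal_prob n {{a, b}, {a, c}}"
  let ?c = "(real n - 1) * (real n - 2)"
  have n: "n \<ge> 3"
    using card_mono[OF _ assms(2)] assms(1) by simp
  have c: "?c > 0"
    using n by simp
  have "real n * (real n * (real n - 1) * (real n - 2) * ?p) = real n * (8 * (real n - 1) - 4 * real n * mst_mean n)"
    by (simp only: kruskal_prob_adjacent[OF assms])
  then have rel: "?c * ((real n)\<^sup>2 * ?p) = 8 * real n * (real n - 1) - 4 * ((real n)\<^sup>2 * mst_mean n)"
    by (simp add: power2_eq_square algebra_simps)
  have "?p \<le> (2 / real n)\<^sup>2 \<longleftrightarrow> (real n)\<^sup>2 * ?p \<le> 4"
    using n by (simp add: power_divide pos_le_divide_eq mult.commute)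
  also have "\<dots> \<longleftrightarrow> ?c * ((real n)\<^sup>2 * ?p) \<le> ?c * 4"
    using mult_le_cancel_left_pos[OF c] by blast
  also have "\<dots> \<longleftrightarrow> (real n - 1) * (real n + 2) \<le> (real n)\<^sup>2 * mst_mean n"
  proof -
    have "?c * 4 = 8 * real n * (real n - 1) - 4 * ((real n - 1) * (real n + 2))"
      by (simp add: algebra_simps)
    then show ?thesis
      unfolding rel by linarith
  qed
  also have "\<dots> \<longleftrightarrow> mst_mean n \<ge> (real n - 1) * (real n + 2) / (real n)\<^sup>2"
    using n by (simp add: pos_divide_le_eq mult.commute)
  finally show ?thesis .
qed

lemma disjoint_prob_le_iff:
  assumes "distinct [a, b, c, d]" "{a, b, c, d} \<subseteq> {..<n}"
  shows "kruskal_prob n {{a, b}, {c, d}} \<le> (2 / real n)\<^sup>2 \<longleftrightarrow>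
    mst_mean n \<le> (real n - 1) * (5 * real n + 6) / (4 * (real n)\<^sup>2)"
proof -
  let ?p = "kruskal_prob n {{a, b}, {a, c}}" and ?q = "kruskal_prob n {{a, b}, {c, d}}"
  let ?c = "(real n - 1) * (real n - 2)"
  have n: "n \<ge> 4"
    using card_mono[OF _ assms(2)] assms(1) by simp
  have c: "?c > 0" and n3: "real n - 3 > 0"
    using n by simp_all
  have "kruskal_prob n {{a, b}, {a, c}} * (real n * (real n - 1) * (real n - 2)) = 8 * (real n - 1) - 4 * real n * mst_mean n"
    using kruskal_prob_adjacent[of a b c n] assms by (simp add: mult.commute)
  then have "real n * (?p * (real n * (real n - 1) * (real n - 2))) = real n * (8 * (real n - 1) - 4 * real n * mst_mean n)"
    by (simp only:)
  then have rel: "?c * ((real n)\<^sup>2 * ?p) = 8 * real n * (real n - 1) - 4 * ((real n)\<^sup>2 * mst_mean n)"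
    by (simp add: power2_eq_square algebra_simps)
  have "(real n - 2) * (4 * ?p + (real n - 3) * ?q) = (real n - 2) * (4 / n)"
  proof -
    have "(m - 2) * (4 * p + (m - 3) * q) = (m - 2) * (2 * r)"
      if "4 * (m - 2) * p + (m - 2) * (m - 3) * q = 2 * (m - 2) * r" for m p q r :: real
      using that by (simp add: algebra_simps)
    from this[OF kruskal_prob_disjoint[OF assms]] show ?thesis
      by simp
  qed
  then have "4 * ?p + (real n - 3) * ?q = 4 / n"
    unfolding mult_cancel_left using n by simp
  then have "(real n)\<^sup>2 * (4 * ?p + (real n - 3) * ?q) = (real n)\<^sup>2 * (4 / n)"
    by (simp only:)
  also have "\<dots> = 4 * real n"
    using n by (simp add: power2_eq_square)
  finally have rel2: "(real n - 3) * ((real n)\<^sup>2 * ?q) = 4 * real n - 4 * ((real n)\<^sup>2 * ?p)"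
    by (simp add: algebra_simps)
  have "?q \<le> (2 / real n)\<^sup>2 \<longleftrightarrow> (real n)\<^sup>2 * ?q \<le> 4"
    using n by (simp add: power_divide pos_le_divide_eq mult.commute)
  also have "\<dots> \<longleftrightarrow> (real n - 3) * ((real n)\<^sup>2 * ?q) \<le> (real n - 3) * 4"
    using mult_le_cancel_left_pos[OF n3] by blast
  \<comment> \<open>The disjoint probability decreases in the adjacent one and equals 4 / n^2 when
    the latter is 3 / n^2. As the latter decreases in the mean, the two reversals give an upper
    bound on the mean.\<close>
  also have "\<dots> \<longleftrightarrow> 3 \<le> (real n)\<^sup>2 * ?p"
    unfolding rel2 by (simp add: algebra_simps)
  also have "\<dots> \<longleftrightarrow> ?c * 3 \<le> ?c * ((real n)\<^sup>2 * ?p)"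
    using mult_le_cancel_left_pos[OF c] by blast
  also have "\<dots> \<longleftrightarrow> 4 * ((real n)\<^sup>2 * mst_mean n) \<le> (real n - 1) * (5 * real n + 6)"
  proof -
    have "?c * 3 = 8 * real n * (real n - 1) - (real n - 1) * (5 * real n + 6)"
      by (simp add: algebra_simps)
    then show ?thesis
      unfolding rel by linarith
  qed
  also have "\<dots> \<longleftrightarrow> mst_mean n \<le> (real n - 1) * (5 * real n + 6) / (4 * (real n)\<^sup>2)"
    using n by (simp add: pos_le_divide_eq mult_ac)
  finally show ?thesis .
qed

theorem corollaryD2:
  fixes n :: nat
    and M :: "'a measure"
    and W :: "nat set \<Rightarrow> 'a \<Rightarrow> real"
    and T :: "'a \<Rightarrow> nat set set"
    and EL p\<^sub>0 :: real
  assumes n: "n \<ge> 2"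
    and M: "prob_space M"
    and indep: "prob_space.indep_vars M (\<lambda>_. borel) W (complete_edges n)"
    and Exp1: "\<And>e. e \<in> complete_edges n \<Longrightarrow> distributed M lborel (W e) (exponential_density 1)"
  defines "T \<equiv> \<lambda>\<omega>. mst n (\<lambda>e. W e \<omega>)"
    and "EL \<equiv> \<integral>\<omega>. (\<Sum>e\<in>T \<omega>. W e \<omega>) \<partial>M"
    and "p\<^sub>0 \<equiv> 2 / real n"
  shows
    "(AE \<omega> in M. \<exists>!F. is_mst n (\<lambda>e. W e \<omega>) F) \<and>
     (\<forall>e \<in> complete_edges n. \<P>(\<omega> in M. e \<in> T \<omega>) = p\<^sub>0) \<and>

     (n \<ge> 3 \<longrightarrow>
       (\<forall>e \<in> complete_edges n. \<forall>f \<in> complete_edges n. e \<noteq> f \<and> e \<inter> f \<noteq> {} \<longrightarrow>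
         (\<P>(\<omega> in M. e \<in> T \<omega> \<and> f \<in> T \<omega>) \<le> p\<^sub>0\<^sup>2 \<longleftrightarrow>
          EL \<ge> (real n - 1) * (real n + 2) / (real n)\<^sup>2))) \<and>

     (n \<ge> 4 \<longrightarrow>
       (\<forall>e \<in> complete_edges n. \<forall>f \<in> complete_edges n. e \<inter> f = {} \<longrightarrow>
         (\<P>(\<omega> in M. e \<in> T \<omega> \<and> f \<in> T \<omega>) \<le> p\<^sub>0\<^sup>2 \<longleftrightarrow>
          EL \<le> (real n - 1) * (5 * real n + 6) / (4 * (real n)\<^sup>2)))) \<and>

     (EL \<ge> (real n - 1) * (real n + 2) / (real n)\<^sup>2 \<and>
      EL \<le> (real n - 1) * (5 * real n + 6) / (4 * (real n)\<^sup>2) \<and>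
      (n \<ge> 3 \<longrightarrow> EL > (real n - 1) * (real n + 2) / (real n)\<^sup>2) \<and>
      (n \<ge> 4 \<longrightarrow> EL < (real n - 1) * (5 * real n + 6) / (4 * (real n)\<^sup>2))) \<and>

     (EL \<ge> 1 + (harm n - 1) / real n - 1 / (real n)\<^sup>2 \<and>
      (n = 2 \<or> n = 3 \<longrightarrow> EL = 1 + (harm n - 1) / real n - 1 / (real n)\<^sup>2) \<and>
      (n \<ge> 4 \<longrightarrow> EL > 1 + (harm n - 1) / real n - 1 / (real n)\<^sup>2))"
proof -
  interpret prob_space M by fact
  \<comment> \<open>Weights off the edge set are cut away, so that \<phi> takes values in the space
    of \<open>weight_law n\<close>; minimum spanning trees do not notice, by
    \<open>is_mst_cong\<close>.\<close>
  define \<phi> where "\<phi> \<omega> = (\<lambda>e\<in>complete_edges n. W e \<omega>)" for \<omega>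
  have n0: "n > 0"
    using n by simp
  have law: "\<phi> \<in> measurable M (weight_law n)" "distr M (weight_law n) \<phi> = weight_law n"
    using distr_weights[OF M indep n Exp1] by (simp_all add: \<phi>_def[abs_def])
  have is_mst: "is_mst n (\<lambda>e. W e \<omega>) = is_mst n (\<phi> \<omega>)" for \<omega>
    by (rule is_mst_cong) (simp add: \<phi>_def)
  then have T: "T \<omega> = mst n (\<phi> \<omega>)" for \<omega>
    by (simp add: T_def mst_def)
  have prob_T: "prob {\<omega> \<in> space M. S \<subseteq> T \<omega>} = kruskal_prob n S" if "finite S" for S
  proof -
    have "kruskal_prob n S = measure (distr M (weight_law n) \<phi>) {w \<in> space (weight_law n). S \<subseteq> mst n w}"
      using prob_subset_mst[OF n0 that] law(2) by simp
    also have "\<dots> = prob (\<phi> -` {w \<in> space (weight_law n). S \<subseteq> mst n w} \<inter> space M)"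
      by (rule measure_distr[OF law(1) predE[OF measurable_mst]])
    also have "\<phi> -` {w \<in> space (weight_law n). S \<subseteq> mst n w} \<inter> space M = {\<omega> \<in> space M. S \<subseteq> T \<omega>}"
      using measurable_space[OF law(1)] by (auto simp: T)
    finally show ?thesis
      by (rule sym)
  qed
  have EL: "EL = mst_mean n"
  proof -
    have "(\<Sum>e\<in>T \<omega>. W e \<omega>) = (\<Sum>e\<in>mst n (\<phi> \<omega>). \<phi> \<omega> e)" for \<omega>
      unfolding T using mst_subset[OF n0, of "\<phi> \<omega>"] by (intro sum.cong) (auto simp: \<phi>_def)
    then have "EL = (\<integral>\<omega>. (\<lambda>w. \<Sum>e\<in>mst n w. w e) (\<phi> \<omega>) \<partial>M)"
      by (simp add: EL_def)
    also have "\<dots> = (\<integral>w. (\<Sum>e\<in>mst n w. w e) \<partial>distr M (weight_law n) \<phi>)"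
      by (rule integral_distr[symmetric, OF law(1) measurable_mst_weight[OF n0]])
    finally show ?thesis
      by (simp only: law(2) integral_mst_weight[OF n0])
  qed
  have unique: "AE \<omega> in M. \<exists>!F. is_mst n (\<lambda>e. W e \<omega>) F"
  proof -
    have "AE w in distr M (weight_law n) \<phi>. inj_on w (complete_edges n)"
      using AE_inj_weights[of n] by (simp only: law(2))
    from AE_distrD[OF law(1) this] show ?thesis
      by eventually_elim (simp add: is_mst is_mst_iff[OF n0])
  qed
  have single: "\<P>(\<omega> in M. e \<in> T \<omega>) = p\<^sub>0" if "e \<in> complete_edges n" for e
    using prob_T[of "{e}"] kruskal_prob_single[OF n that] by (simp add: p\<^sub>0_def)
  have pair: "\<P>(\<omega> in M. e \<in> T \<omega> \<and> f \<in> T \<omega>) = kruskal_prob n {e, f}" for e f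
    using prob_T[of "{e, f}"] by simp
  have adjacent: "\<P>(\<omega> in M. e \<in> T \<omega> \<and> f \<in> T \<omega>) \<le> p\<^sub>0\<^sup>2 \<longleftrightarrow> EL \<ge> (real n - 1) * (real n + 2) / (real n)\<^sup>2"
    if ef: "e \<in> complete_edges n" "f \<in> complete_edges n" "e \<noteq> f" "e \<inter> f \<noteq> {}" for e f
  proof -
    obtain a b c where "e = {a, b}" "f = {a, c}" "distinct [a, b, c]" "{a, b, c} \<subseteq> {..<n}"
      by (rule adjacent_edges[OF ef])
    then show ?thesis
      unfolding pair EL p\<^sub>0_def using adjacent_prob_le_iff[of a b c n] by simp
  qed
  have disjoint: "\<P>(\<omega> in M. e \<in> T \<omega> \<and> f \<in> T \<omega>) \<le> p\<^sub>0\<^sup>2 \<longleftrightarrow> EL \<le> (real n - 1) * (5 * real n + 6) / (4 * (real n)\<^sup>2)"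
    if ef: "e \<in> complete_edges n" "f \<in> complete_edges n" "e \<inter> f = {}" for e f
  proof -
    obtain a b c d where "e = {a, b}" "f = {c, d}" "distinct [a, b, c, d]" "{a, b, c, d} \<subseteq> {..<n}"
      by (rule disjoint_edges[OF ef])
    then show ?thesis
      unfolding pair EL p\<^sub>0_def using disjoint_prob_le_iff[of a b c d n] by simp
  qed
  have equality: "n = 2 \<or> n = 3 \<longrightarrow> mst_mean n = 1 + (harm n - 1) / real n - 1 / (real n)\<^sup>2"
    using mst_mean_eq_harm[OF n0] by auto
  show ?thesis
    using unique single adjacent disjoint mst_mean_ge_simple[OF n0] mst_mean_le[OF n]
      mst_mean_greater_simple[of n] mst_mean_less[of n] mst_mean_ge[OF n0]
      equality mst_mean_greater[of n]
    unfolding EL by simp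
qed

end
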